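(* Let $A$ be a lower semi-bounded self-adjoint operator on a Hilbert space $X$. Let $\phi\in\mathcal{X}^2_{\mathrm{loc}}$ and suppose $$\|(\nabla_t^2-A)\phi(t)\|_X\le b(t)\|\phi(t)\|_X\quad (t>0)$$ for some $b\in L^\infty(\mathbb{R}_+)$. Further suppose one of the following is satisfied: (i) $\mathrm{spec}(A)$ contains arbitrarily large positive gaps; (ii) there exists $\delta>0$ such that $\mathbb{R}_+\setminus\mathrm{spec}(A)$ contains infinitely many disjoint intervals of length $\delta$, and $b(t)\to0$ as $t\to+\infty$. If $\phi$ satisfies $$\int_0^\infty e^{2\lambda t}\|\phi(t)\|_X^2\,dt<+\infty$$ for all $\lambda>0$, then $\phi\equiv0$.
   Context: $\mathbb{R}_+=(0,+\infty)$ and $\nabla_t$ denotes differentiation with respect to $t$. For $j=0,1,2$ set $X_j=\mathrm{Dom}(|A|^{j/2})\subseteq X$ (so $X_2=\mathrm{Dom}(A)$, $X_1$ is the form domain of $A$, $X_0=X$); for $j=1,2$, $X_j$ is made a Hilbert space via the isomorphism $|A|^{j/2}+I:X_j\to X$. Set $$\mathcal{X}^2_{\mathrm{loc}}=L^2_{\mathrm{loc}}(\mathbb{R}_+,X_2)\cap H^1_{\mathrm{loc}}(\mathbb{R}_+,X_1)\cap H^2_{\mathrm{loc}}(\mathbb{R}_+,X),\qquad \mathcal{X}^0_{\mathrm{loc}}=L^2_{\mathrm{loc}}(\mathbb{R}_+,X),$$ so that $\nabla_t^2-A$ maps $\mathcal{X}^2_{\mathrm{loc}}\to\mathcal{X}^0_{\mathrm{loc}}$.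 Here "loc" refers to compact subsets of the open half-line $\mathbb{R}_+$. Pointwise inequalities in $t$ are understood for almost every $t$ (and $b(t)\to0$ in the corresponding essential sense). A positive gap in $\mathrm{spec}(A)$ is a bounded open interval $(a,b)\subset\mathbb{R}_+$ with $(a,b)\cap\mathrm{spec}(A)=\emptyset$; "arbitrarily large positive gaps" means that for every $L>0$ there is such an interval of length at least $L$. *)

theory Defs
  imports "HOL-Analysis.Analysis"
begin

section \<open>Complex Hilbert spaces\<close>

text \<open>The real inner product of the underlying real Hilbert space is the real part of the complex
  one, so norm, topology and completeness are those of the library classes.  The complex inner
  product is linear in its first argument.\<close>

class complex_hilbert = real_inner + complete_space +
  fixes scaleC :: "complex \<Rightarrow> 'a \<Rightarrow> 'a" (infixr "*\<^sub>C" 75)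
    and cinner :: "'a \<Rightarrow> 'a \<Rightarrow> complex"
  assumes scaleC_add_right: "c *\<^sub>C (x + y) = c *\<^sub>C x + c *\<^sub>C y"
    and scaleC_add_left: "(c + d) *\<^sub>C x = c *\<^sub>C x + d *\<^sub>C x"
    and scaleC_scaleC: "c *\<^sub>C d *\<^sub>C x = (c * d) *\<^sub>C x"
    and scaleC_of_real: "complex_of_real r *\<^sub>C x = r *\<^sub>R x"
    and cinner_commute: "cinner x y = cnj (cinner y x)"
    and cinner_add_left: "cinner (x + y) z = cinner x z + cinner y z"
    and cinner_scaleC_left: "cinner (c *\<^sub>C x) y = c * cinner x y"
    and Re_cinner: "Re (cinner x y) = inner x y"

instantiation complex :: complex_hilbert
begin

definition scaleC_complex :: "complex \<Rightarrow> complex \<Rightarrow> complex"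
  where "scaleC_complex c x = c * x"

definition cinner_complex :: "complex \<Rightarrow> complex \<Rightarrow> complex"
  where "cinner_complex x y = x * cnj y"

instance
  by standard
    (simp_all add: scaleC_complex_def cinner_complex_def inner_complex_def algebra_simps
      scaleR_conv_of_real)

end

section \<open>Unbounded operators\<close>

text \<open>An operator with domain in \<open>'a\<close> is a partial map: \<open>dom A\<close> is its domain, equality of maps is
  equality of operators including domains, and \<open>A \<circ>\<^sub>m B\<close> is the composition on its natural
  domain.\<close>

definition linear_operator :: "('a::complex_hilbert \<rightharpoonup> 'a) \<Rightarrow> bool" where
  "linear_operator A \<longleftrightarrow>
     (\<forall>x\<in>dom A. \<forall>y\<in>dom A. A (x + y) = Some (the (A x) + the (A y))) \<and>
     (\<forall>c. \<forall>x\<in>dom A. A (c *\<^sub>C x) = Some (c *\<^sub>C the (A x)))"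

text \<open>The value of the adjoint is uniquely determined when \<open>A\<close> is densely defined.\<close>

definition adjoint_op :: "('a::complex_hilbert \<rightharpoonup> 'a) \<Rightarrow> ('a \<rightharpoonup> 'a)" where
  "adjoint_op A y =
     (if \<exists>z. \<forall>x\<in>dom A. cinner (the (A x)) y = cinner x z
      then Some (THE z. \<forall>x\<in>dom A. cinner (the (A x)) y = cinner x z)
      else None)"

definition self_adjoint :: "('a::complex_hilbert \<rightharpoonup> 'a) \<Rightarrow> bool" where
  "self_adjoint A \<longleftrightarrow> linear_operator A \<and> closure (dom A) = UNIV \<and> adjoint_op A = A"

text \<open>For self-adjoint \<open>A\<close> the number \<open>cinner (A x) x\<close> is real.\<close>

definition bounded_below_by :: "real \<Rightarrow> ('a::complex_hilbert \<rightharpoonup> 'a) \<Rightarrow> bool" where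
  "bounded_below_by c A \<longleftrightarrow> (\<forall>x\<in>dom A. c * (norm x)\<^sup>2 \<le> Re (cinner (the (A x)) x))"

definition lower_semibounded :: "('a::complex_hilbert \<rightharpoonup> 'a) \<Rightarrow> bool" where
  "lower_semibounded A \<longleftrightarrow> (\<exists>c. bounded_below_by c A)"

definition spectrum_op :: "('a::complex_hilbert \<rightharpoonup> 'a) \<Rightarrow> complex set" where
  "spectrum_op A =
     {z. \<not> (bij_betw (\<lambda>x. the (A x) - z *\<^sub>C x) (dom A) UNIV \<and>
            (\<exists>M. \<forall>x\<in>dom A. norm x \<le> M * norm (the (A x) - z *\<^sub>C x)))}"

text \<open>A nonnegative self-adjoint operator has exactly one nonnegative self-adjoint square root.\<close>

definition sqrt_op :: "('a::complex_hilbert \<rightharpoonup> 'a) \<Rightarrow> ('a \<rightharpoonup> 'a)" where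
  "sqrt_op B = (THE S. self_adjoint S \<and> bounded_below_by 0 S \<and> S \<circ>\<^sub>m S = B)"

definition abs_op :: "('a::complex_hilbert \<rightharpoonup> 'a) \<Rightarrow> ('a \<rightharpoonup> 'a)" where
  "abs_op A = sqrt_op (adjoint_op A \<circ>\<^sub>m A)"

definition plus_id :: "('a::complex_hilbert \<rightharpoonup> 'a) \<Rightarrow> ('a \<rightharpoonup> 'a)" where
  "plus_id B x = map_option (\<lambda>y. y + x) (B x)"

section \<open>Local Lebesgue and Sobolev spaces on the open half-line\<close>

text \<open>Elements of the function spaces are represented by functions on \<open>real\<close>; only their values for
  almost every \<open>t > 0\<close> matter.  The Bochner integral of the library needs a second countable range.
  As the Hilbert space need not be separable, strong measurability is spelled out with simple
  functions, and vector-valued integrals are Henstock-Kurzweil integrals, which coincide with the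
  Bochner integral on Bochner integrable functions.\<close>

abbreviation half_line :: "real measure" where
  "half_line \<equiv> lebesgue_on {0<..}"

definition strongly_measurable :: "(real \<Rightarrow> 'a::real_normed_vector) \<Rightarrow> bool" where
  "strongly_measurable f \<longleftrightarrow>
     (\<exists>s. (\<forall>n::nat. simple_function half_line (s n)) \<and>
          (AE t in half_line. (\<lambda>n. s n t) \<longlonglongrightarrow> f t))"

definition Lp_loc :: "nat \<Rightarrow> (real \<Rightarrow> 'a::real_normed_vector) set" where
  "Lp_loc p =
     {f. strongly_measurable f \<and>
         (\<forall>K. compact K \<and> K \<subseteq> {0<..} \<longrightarrow>
              (\<integral>\<^sup>+t\<in>K. ennreal (norm (f t) ^ p) \<partial>half_line) < \<infinity>)}"

definition test_function :: "(real \<Rightarrow> real) \<Rightarrow> bool" where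
  "test_function \<eta> \<longleftrightarrow>
     (\<forall>n t. ((deriv ^^ n) \<eta>) differentiable (at t)) \<and>
     (\<exists>K. compact K \<and> K \<subseteq> {0<..} \<and> (\<forall>t. t \<notin> K \<longrightarrow> \<eta> t = 0))"

text \<open>\<open>g\<close> is the \<open>k\<close>-th distributional derivative of \<open>f\<close>.\<close>

definition has_weak_deriv ::
  "nat \<Rightarrow> (real \<Rightarrow> 'a::{real_normed_vector,complete_space}) \<Rightarrow> (real \<Rightarrow> 'a) \<Rightarrow> bool" where
  "has_weak_deriv k f g \<longleftrightarrow>
     f \<in> Lp_loc 1 \<and> g \<in> Lp_loc 1 \<and>
     (\<forall>\<eta>. test_function \<eta> \<longrightarrow>
        integral {0<..} (\<lambda>t. (deriv ^^ k) \<eta> t *\<^sub>R f t) =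
        (-1) ^ k *\<^sub>R integral {0<..} (\<lambda>t. \<eta> t *\<^sub>R g t))"

definition H_loc :: "nat \<Rightarrow> (real \<Rightarrow> 'a::{real_normed_vector,complete_space}) set" where
  "H_loc k = {f \<in> Lp_loc 2. \<forall>j\<le>k. \<exists>g\<in>Lp_loc 2. has_weak_deriv j f g}"

text \<open>If \<open>F\<close> is a space of functions with values in \<open>X\<close> and \<open>J\<close> is a bijection from \<open>dom J\<close> onto
  \<open>X\<close>, then \<open>pullback_space J F\<close> is the corresponding space of functions with values in \<open>dom J\<close>,
  where \<open>dom J\<close> carries the Hilbert space structure that makes \<open>J\<close> an isomorphism.\<close>

definition pullback_space ::
  "('a::complex_hilbert \<rightharpoonup> 'a) \<Rightarrow> (real \<Rightarrow> 'a) set \<Rightarrow> (real \<Rightarrow> 'a) set" where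
  "pullback_space J F =
     {f. (AE t in half_line. f t \<in> dom J) \<and> (\<lambda>t. the (J (f t))) \<in> F}"

definition X2_loc :: "('a::complex_hilbert \<rightharpoonup> 'a) \<Rightarrow> (real \<Rightarrow> 'a) set" where
  "X2_loc A =
     pullback_space (plus_id (abs_op A)) (Lp_loc 2) \<inter>
     pullback_space (plus_id (sqrt_op (abs_op A))) (H_loc 1) \<inter>
     H_loc 2"

definition Linfty :: "(real \<Rightarrow> real) set" where
  "Linfty =
     {b. b \<in> borel_measurable half_line \<and> (\<exists>C. AE t in half_line. \<bar>b t\<bar> \<le> C)}"

definition ess_tendsto_0_at_top :: "(real \<Rightarrow> real) \<Rightarrow> bool" where
  "ess_tendsto_0_at_top b \<longleftrightarrow>
     (\<forall>\<epsilon>>0. \<exists>T. AE t in half_line. t > T \<longrightarrow> \<bar>b t\<bar> < \<epsilon>)"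

section \<open>Gap conditions\<close>

definition large_positive_gaps :: "complex set \<Rightarrow> bool" where
  "large_positive_gaps S \<longleftrightarrow>
     (\<forall>L>0. \<exists>l u. l < u \<and> u - l \<ge> L \<and> {l<..<u} \<subseteq> {0<..} \<and>
                  complex_of_real ` {l<..<u} \<inter> S = {})"

definition infinitely_many_gaps :: "real \<Rightarrow> complex set \<Rightarrow> bool" where
  "infinitely_many_gaps \<delta> S \<longleftrightarrow>
     (\<exists>\<I>. infinite \<I> \<and> disjoint \<I> \<and>
          (\<forall>I\<in>\<I>. is_interval I \<and> emeasure lborel I = ennreal \<delta> \<and>
                  I \<subseteq> {0<..} \<and> complex_of_real ` I \<inter> S = {}))"

end

theory Submission
  imports Defs
begin

text \<open>For \<open>u\<close> with compact support, integration by parts gives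
  \<open>\<parallel>u'' - 2\<mu>u' - Bu\<parallel>\<^sup>2 = \<parallel>u''\<parallel>\<^sup>2 + \<parallel>Bu\<parallel>\<^sup>2 + 2\<langle>Bu', u'\<rangle> + 4\<mu>\<^sup>2\<parallel>u'\<parallel>\<^sup>2\<close> where \<open>B = A - \<mu>\<^sup>2\<close>.  Since \<open>A\<close> is
  bounded below, this dominates \<open>d\<^sup>2\<parallel>u\<parallel>\<^sup>2\<close> once \<open>\<mu>\<^sup>2\<close> is large and has distance \<open>d\<close> from the spectrum;
  without any gap, Poincare's inequality still gives the constant \<open>\<mu>/L\<close> on intervals of length \<open>L\<close>.
  Applied to \<open>u = e\<^bsup>\<mu>t\<^esup>\<eta>\<phi>\<close> with a cutoff \<open>\<eta>\<close>, and with \<open>\<phi>'\<close> in the cutoff zones controlled by a Caccioppoli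
  inequality, the first bound absorbs the perturbation \<open>b\<phi>\<close>, and \<open>\<mu> \<rightarrow> \<infinity>\<close> yields \<open>\<phi> = 0\<close> wherever
  \<open>b\<close> is small compared to \<open>d\<close>.  In case (i) this is the whole half-line; in case (ii) it is a neighbourhood of
  infinity, and the second bound continues the zero set down to the origin.  All estimates are first proved
  for \<open>R\<phi>\<close> mollified in time, where \<open>R\<close> is a resolvent of \<open>A\<close>, so that no spectral theorem is needed.\<close>

section \<open>Self-adjoint operators\<close>

text \<open>Let \<open>A\<close> be bounded below by \<open>- \<gamma>\<close>. The term 2<Bu', u'>
  can then be as negative as -2(\<mu>^2 + \<gamma>)|u'|^2, and the term 4\<mu>^2|u'|^2 from the
  first-order part of the conjugated operator pays for it as soon as \<mu>^2 \<ge> \<gamma>. The two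
  bounds complement each other: with a gap the constant d stays fixed as \<mu> grows, while the
  cutoff may reach arbitrarily far because the decay of \<phi> removes the outer zone; the constant
  \<mu>/L beats every bounded perturbation, but L must stay fixed, so vanishing near infinity has to
  be known before. Regularisation dictates the order of limits. Resolvents are contractions
  commuting with A, so the source term of R\<phi> is bounded by b|\<phi>|, but not by b|R\<phi>|.
  Nothing can be absorbed before the regularisation is gone: it is removed with T and \<mu> fixed,
  by Fatou's lemma, and only then is the perturbation moved to the left. The operator |A| occurs in
  the definition of the function space, from which \<phi>(t) in the domain of A has to be extracted.
  The theory of square roots serves this purpose.\<close>

instance complex_hilbert \<subseteq> banach ..

text \<open>By the parallelogram law a minimising sequence for the distance from \<open>x\<close> to
  \<open>V\<close> is Cauchy; minimality of its limit along every line in \<open>V\<close> through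
  it gives orthogonality. The real inner product suffices, and it is the one available on the
  product space in which the graph of an operator is treated below.\<close>

lemma exists_orthogonal_projection:
  fixes V :: "'b::{real_inner,complete_space} set"
  assumes V: "subspace V" "closed V"
  obtains v where "v \<in> V" "\<And>w. w \<in> V \<Longrightarrow> inner (x - v) w = 0"
proof -
  define D where "D = Inf ((\<lambda>v. (norm (x - v))\<^sup>2) ` V)"
  have ne: "V \<noteq> {}" using V(1) subspace_0 by auto
  have bdd: "bdd_below ((\<lambda>v. (norm (x - v))\<^sup>2) ` V)" by (rule bdd_belowI[of _ 0]) auto
  have D_le: "D \<le> (norm (x - v))\<^sup>2" if "v \<in> V" for v
    unfolding D_def using bdd that by (intro cInf_lower) auto
  have "\<exists>v\<in>V. (norm (x - v))\<^sup>2 < D + 1 / real (Suc n)" for n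
  proof -
    have "D < D + 1 / real (Suc n)" by simp
    then show ?thesis
      unfolding D_def using cInf_lessD[of "(\<lambda>v. (norm (x - v))\<^sup>2) ` V"] ne by fastforce
  qed
  then obtain v where v: "\<And>n. v n \<in> V" "\<And>n::nat. (norm (x - v n))\<^sup>2 < D + 1 / real (Suc n)"
    by metis
  have key: "(norm (v m - v n))\<^sup>2 \<le> 2 / real (Suc m) + 2 / real (Suc n)" for m n
  proof -
    have "(1/2) *\<^sub>R (v m + v n) \<in> V"
      using V(1) v(1) by (intro subspace_scale subspace_add)
    from D_le[OF this] have "D \<le> (norm (x - (1/2) *\<^sub>R (v m + v n)))\<^sup>2" .
    moreover have "(norm (v m - v n))\<^sup>2 = 2 * (norm (x - v m))\<^sup>2 + 2 * (norm (x - v n))\<^sup>2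
        - 4 * (norm (x - (1/2) *\<^sub>R (v m + v n)))\<^sup>2"
      by (simp add: power2_norm_eq_inner inner_simps inner_commute algebra_simps)
    ultimately show ?thesis using v(2)[of m] v(2)[of n] by simp
  qed
  have "Cauchy v"
  proof (rule metric_CauchyI)
    fix e :: real assume e: "e > 0"
    obtain N where N: "4 / e\<^sup>2 < real N" using reals_Archimedean2 by blast
    show "\<exists>M. \<forall>m\<ge>M. \<forall>n\<ge>M. dist (v m) (v n) < e"
    proof (intro exI allI impI)
      fix m n assume mn: "m \<ge> N" "n \<ge> N"
      have N0: "real N > 0" using N e by (meson divide_pos_pos less_trans zero_less_numeral zero_less_power)
      have "2 / real (Suc m) \<le> 2 / real N" "2 / real (Suc n) \<le> 2 / real N"
        using mn N0 by (auto intro!: divide_left_mono)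
      then have "(norm (v m - v n))\<^sup>2 \<le> 4 / real N" using key[of m n] by linarith
      also have "\<dots> < e\<^sup>2" using N N0 e by (simp add: field_simps)
      finally show "dist (v m) (v n) < e" using e by (simp add: dist_norm power2_less_imp_less)
    qed
  qed
  then obtain l where l: "v \<longlonglongrightarrow> l" using Cauchy_convergent convergent_def by blast
  have lV: "l \<in> V" using V(2) v(1) l closed_sequentially by blast
  have "(norm (x - l))\<^sup>2 \<le> D"
  proof (rule LIMSEQ_le)
    show "(\<lambda>n. (norm (x - v n))\<^sup>2) \<longlonglongrightarrow> (norm (x - l))\<^sup>2"
      using l by (intro tendsto_intros)
    show "(\<lambda>n. D + 1 / real (Suc n)) \<longlonglongrightarrow> D"
      using tendsto_add[OF tendsto_const LIMSEQ_inverse_real_of_nat, of D] by (simp add: inverse_eq_divide)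
  qed (use v(2) less_imp_le in blast)
  have "inner (x - l) w = 0" if w: "w \<in> V" for w
  proof (cases "w = 0")
    case False
    define t where "t = inner (x - l) w / (norm w)\<^sup>2"
    have "l + t *\<^sub>R w \<in> V" using V(1) lV w by (intro subspace_scale subspace_add)
    from D_le[OF this] \<open>_ \<le> D\<close> have "(norm (x - l))\<^sup>2 \<le> (norm (x - l - t *\<^sub>R w))\<^sup>2"
      by (metis diff_diff_add order.trans)
    also have "\<dots> = (norm (x - l))\<^sup>2 - 2 * t * inner (x - l) w + t\<^sup>2 * (norm w)\<^sup>2"
      by (simp only: power2_norm_eq_inner) (simp add: inner_simps inner_commute algebra_simps power2_eq_square)
    finally have "2 * t * inner (x - l) w \<le> t\<^sup>2 * (norm w)\<^sup>2" by simp
    then have "(inner (x - l) w)\<^sup>2 / (norm w)\<^sup>2 \<le> 0"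
      using False by (simp add: t_def power2_eq_square field_simps)
    then show ?thesis using False by (simp add: divide_le_0_iff)
  qed auto
  with lV show ?thesis using that by blast
qed

section \<open>The complex structure in terms of the real inner product\<close>

lemma Im_cinner: "Im (cinner x y) = - inner (\<i> *\<^sub>C x) y"
  by (metis Re_cinner cinner_scaleC_left Re_i_times minus_minus)

text \<open>A complex identity amounts to two real ones, the second with
  \<open>\<i> *\<^sub>C x\<close> in place of \<open>x\<close>. As domains are complex subspaces,
  the operator theory can therefore test against the real \<open>inner\<close> alone.\<close>

lemma cinner_eq_iff: "cinner x y = cinner x' y' \<longleftrightarrow>
    inner x y = inner x' y' \<and> inner (\<i> *\<^sub>C x) y = inner (\<i> *\<^sub>C x') y'"
  by (simp add: complex_eq_iff Re_cinner Im_cinner)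

lemma norm_scaleC: "norm (c *\<^sub>C x) = cmod c * norm (x::'a::complex_hilbert)"
proof -
  have "cinner (c *\<^sub>C x) (c *\<^sub>C x) = c * cnj c * cinner x x"
    by (metis cinner_commute cinner_scaleC_left complex_cnj_mult mult.assoc complex_cnj_cnj)
  also have "cinner x x = of_real ((norm x)\<^sup>2)"
    using cinner_commute[of x x] Reals_cnj_iff complex_is_Real_iff
    by (simp add: complex_eq_iff Re_cinner power2_norm_eq_inner)
  also have "c * cnj c * of_real ((norm x)\<^sup>2) = of_real ((cmod c * norm x)\<^sup>2)"
    by (simp add: complex_norm_square[symmetric] power_mult_distrib)
  finally have "inner (c *\<^sub>C x) (c *\<^sub>C x) = (cmod c * norm x)\<^sup>2"
    by (metis Re_cinner Re_complex_of_real)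
  then show ?thesis by (metis power2_norm_eq_inner power2_eq_imp_eq norm_ge_zero mult_nonneg_nonneg)
qed

lemma bounded_linear_scaleC: "bounded_linear (\<lambda>x::'a::complex_hilbert. c *\<^sub>C x)"
proof (rule bounded_linear_intro)
  show "c *\<^sub>C (r *\<^sub>R x) = r *\<^sub>R c *\<^sub>C x" for r and x :: 'a
    by (metis mult.commute scaleC_of_real scaleC_scaleC)
  show "norm (c *\<^sub>C x) \<le> norm x * cmod c" for x :: 'a by (simp add: norm_scaleC)
qed (rule scaleC_add_right)

lemma dense_orthogonal_eq:
  fixes z z' :: "'b::real_inner"
  assumes "closure D = UNIV" "\<And>x. x \<in> D \<Longrightarrow> inner x z = inner x z'"
  shows "z = z'"
proof -
  have "closed {x. inner x z = inner x z'}"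
    by (intro closed_Collect_eq continuous_intros)
  then have "closure D \<subseteq> {x. inner x z = inner x z'}"
    using assms(2) by (intro closure_minimal) auto
  then have "inner (z - z') z = inner (z - z') z'" using assms(1) by auto
  then show ?thesis by (metis inner_diff_right inner_eq_zero_iff right_minus_eq diff_self)
qed

section \<open>Domains of linear and self-adjoint operators\<close>

lemma linear_operatorD:
  assumes "linear_operator A" "x \<in> dom A" "y \<in> dom A"
  shows "x + y \<in> dom A" "the (A (x + y)) = the (A x) + the (A y)"
    "c *\<^sub>C x \<in> dom A" "the (A (c *\<^sub>C x)) = c *\<^sub>C the (A x)"
    "r *\<^sub>R x \<in> dom A" "the (A (r *\<^sub>R x)) = r *\<^sub>R the (A x)"
    "x - y \<in> dom A" "the (A (x - y)) = the (A x) - the (A y)"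
proof -
  have add: "u + v \<in> dom A \<and> the (A (u + v)) = the (A u) + the (A v)"
    if "u \<in> dom A" "v \<in> dom A" for u v
    using assms(1) that unfolding linear_operator_def by (metis domI option.sel)
  have sc: "d *\<^sub>C u \<in> dom A \<and> the (A (d *\<^sub>C u)) = d *\<^sub>C the (A u)" if "u \<in> dom A" for d u
    using assms(1) that unfolding linear_operator_def by (metis domI option.sel)
  have sr: "s *\<^sub>R u \<in> dom A \<and> the (A (s *\<^sub>R u)) = s *\<^sub>R the (A u)" if "u \<in> dom A" for s u
    using sc[OF that, of "complex_of_real s"] by (simp add: scaleC_of_real)
  show "x + y \<in> dom A" "the (A (x + y)) = the (A x) + the (A y)"
    "c *\<^sub>C x \<in> dom A" "the (A (c *\<^sub>C x)) = c *\<^sub>C the (A x)"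
    "r *\<^sub>R x \<in> dom A" "the (A (r *\<^sub>R x)) = r *\<^sub>R the (A x)"
    using assms add sc sr by auto
  show "x - y \<in> dom A" "the (A (x - y)) = the (A x) - the (A y)"
    using assms add[of x "(-1) *\<^sub>R y"] sr[of y "-1"] by auto
qed

lemma self_adjoint_linear: "self_adjoint A \<Longrightarrow> linear_operator A"
  by (simp add: self_adjoint_def)

lemma self_adjoint_zero: "self_adjoint A \<Longrightarrow> 0 \<in> dom A"
proof -
  assume A: "self_adjoint A"
  then have "dom A \<noteq> {}" by (auto simp: self_adjoint_def)
  then obtain x where x: "x \<in> dom A" by blast
  then show ?thesis using linear_operatorD(5)[OF self_adjoint_linear[OF A] x x, of 0] by simp
qed

text \<open>The real identity, applied to \<open>\<i> *\<^sub>C x\<close> as well, gives the complex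
  one in the definition of the adjoint. Density makes its value unique, which resolves the definite
  description.\<close>

lemma adjoint_opI:
  fixes A :: "'a::complex_hilbert \<rightharpoonup> 'a"
  assumes lin: "linear_operator A" and dense: "closure (dom A) = UNIV"
    and z: "\<And>x. x \<in> dom A \<Longrightarrow> inner (the (A x)) y = inner x z"
  shows "adjoint_op A y = Some z"
proof -
  have ex: "\<forall>x\<in>dom A. cinner (the (A x)) y = cinner x z"
  proof
    fix x assume x: "x \<in> dom A"
    show "cinner (the (A x)) y = cinner x z"
      using z[OF x] z[OF linear_operatorD(3)[OF lin x x, of "\<i>"]] linear_operatorD(4)[OF lin x x, of "\<i>"]
      by (simp add: cinner_eq_iff)
  qed
  moreover have "z' = z" if "\<forall>x\<in>dom A. cinner (the (A x)) y = cinner x z'" for z'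
    using that ex by (intro dense_orthogonal_eq[OF dense]) (metis Re_cinner)
  ultimately have "(THE z. \<forall>x\<in>dom A. cinner (the (A x)) y = cinner x z) = z"
    by (rule the_equality)
  then show ?thesis unfolding adjoint_op_def using ex by auto
qed

text \<open>Maximality of a self-adjoint operator. This is the standard way below to show that a
  vector lies in the domain: exhibit the value that the operator would have to take there.\<close>

lemma self_adjoint_memI:
  fixes A :: "'a::complex_hilbert \<rightharpoonup> 'a"
  assumes "self_adjoint A" "\<And>x. x \<in> dom A \<Longrightarrow> inner (the (A x)) y = inner x z"
  shows "A y = Some z" "y \<in> dom A" "the (A y) = z"
proof -
  show "A y = Some z" using adjoint_opI[of A y z] assms by (simp add: self_adjoint_def)
  then show "y \<in> dom A" "the (A y) = z" by auto
qed

lemma self_adjoint_sym: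
  fixes A :: "'a::complex_hilbert \<rightharpoonup> 'a"
  assumes A: "self_adjoint A" and x: "x \<in> dom A" and y: "y \<in> dom A"
  shows "inner (the (A x)) y = inner x (the (A y))"
proof -
  have "adjoint_op A y = A y" using A by (simp add: self_adjoint_def)
  then obtain z where z: "\<forall>x\<in>dom A. cinner (the (A x)) y = cinner x z"
    using y unfolding adjoint_op_def by (auto split: if_splits)
  then have *: "inner (the (A u)) y = inner u z" if "u \<in> dom A" for u
    using that by (metis Re_cinner)
  then have "the (A y) = z" using self_adjoint_memI(3)[OF A, of y z] by blast
  with *[OF x] show ?thesis by simp
qed

lemma self_adjointI:
  fixes A :: "'a::complex_hilbert \<rightharpoonup> 'a"
  assumes lin: "linear_operator A" and dense: "closure (dom A) = UNIV"
    and sym: "\<And>x y. x \<in> dom A \<Longrightarrow> y \<in> dom A \<Longrightarrow> inner (the (A x)) y = inner x (the (A y))"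
    and max: "\<And>y z. (\<And>x. x \<in> dom A \<Longrightarrow> inner (the (A x)) y = inner x z) \<Longrightarrow> y \<in> dom A"
  shows "self_adjoint A"
proof -
  have "adjoint_op A y = A y" for y
  proof (cases "y \<in> dom A")
    case True
    have "adjoint_op A y = Some (the (A y))" by (rule adjoint_opI[OF lin dense]) (rule sym[OF _ True])
    then show ?thesis using True by auto
  next
    case False
    have "adjoint_op A y = None"
    proof (rule ccontr)
      assume "adjoint_op A y \<noteq> None"
      then obtain z where "\<forall>x\<in>dom A. cinner (the (A x)) y = cinner x z"
        unfolding adjoint_op_def by (auto split: if_splits)
      then have "y \<in> dom A" by (intro max[of y z]) (metis Re_cinner)
      with False show False by simp
    qed
    then show ?thesis using False by (metis domIff)
  qed
  then show ?thesis using lin dense by (auto simp: self_adjoint_def)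
qed

text \<open>Adjoints are closed: for each fixed \<open>w\<close> in the domain, the relation
  \<open>inner (the (A w)) x = inner w y\<close> survives limits in \<open>x\<close> and
  \<open>y\<close>.\<close>

lemma self_adjoint_closed:
  fixes A :: "'a::complex_hilbert \<rightharpoonup> 'a"
  assumes A: "self_adjoint A" and u: "\<And>n. u n \<in> dom A" "u \<longlonglongrightarrow> x" "(\<lambda>n. the (A (u n))) \<longlonglongrightarrow> y"
  shows "x \<in> dom A" "the (A x) = y"
proof -
  have "inner (the (A w)) x = inner w y" if w: "w \<in> dom A" for w
  proof (rule LIMSEQ_unique)
    show "(\<lambda>n. inner (the (A w)) (u n)) \<longlonglongrightarrow> inner (the (A w)) x"
      using u(2) by (intro tendsto_intros)
    have "(\<lambda>n. inner w (the (A (u n)))) \<longlonglongrightarrow> inner w y"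
      using u(3) by (intro tendsto_intros)
    then show "(\<lambda>n. inner (the (A w)) (u n)) \<longlonglongrightarrow> inner w y"
      using self_adjoint_sym[OF A w u(1)] by simp
  qed
  from self_adjoint_memI[OF A this] show "x \<in> dom A" "the (A x) = y" by auto
qed

text \<open>The lower bound makes \<open>A + k\<close> injective, and its range is closed since
  \<open>A\<close> is closed. A vector orthogonal to the range lies in the domain and in the kernel
  by maximality, hence is zero; so the range is everything. The point \<open>- k\<close> is later
  taken below the lower bound of \<open>A\<close> or inside a gap.\<close>

lemma self_adjoint_bounded_inverse:
  fixes A :: "'a::complex_hilbert \<rightharpoonup> 'a"
  assumes A: "self_adjoint A" and m: "m > 0"
    and low: "\<And>x. x \<in> dom A \<Longrightarrow> m * norm x \<le> norm (the (A x) + k *\<^sub>R x)"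
  obtains R where "bounded_linear R" "\<And>y. R y \<in> dom A" "\<And>y. the (A (R y)) + k *\<^sub>R R y = y"
    "\<And>x. x \<in> dom A \<Longrightarrow> R (the (A x) + k *\<^sub>R x) = x" "\<And>y. m * norm (R y) \<le> norm y"
    "\<And>x y. inner (R x) y = inner x (R y)" "\<And>c y. R (c *\<^sub>C y) = c *\<^sub>C R y"
proof -
  note L = linear_operatorD[OF self_adjoint_linear[OF A]]
  define L where "L x = the (A x) + k *\<^sub>R x" for x
  have Ladd: "L (x + y) = L x + L y" if "x \<in> dom A" "y \<in> dom A" for x y
    using L[OF that] by (simp add: L_def algebra_simps)
  have Lsc: "L (c *\<^sub>C x) = c *\<^sub>C L x" if "x \<in> dom A" for x c
    using L[OF that that] by (simp add: L_def scaleC_add_right)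
      (metis mult.commute scaleC_of_real scaleC_scaleC)
  have Lsr: "L (r *\<^sub>R x) = r *\<^sub>R L x" if "x \<in> dom A" for x r
    using L[OF that that] by (simp add: L_def algebra_simps)
  have Ldiff: "L (x - y) = L x - L y" if "x \<in> dom A" "y \<in> dom A" for x y
    using L[OF that] by (simp add: L_def algebra_simps)
  have inj: "x = y" if "x \<in> dom A" "y \<in> dom A" "L x = L y" for x y
  proof -
    have "m * norm (x - y) \<le> 0"
      using low[OF L(7)[OF that(1,2)]] Ldiff[OF that(1,2)] that(3) by (simp add: L_def)
    then show ?thesis using m by (simp add: mult_le_0_iff)
  qed
  define V where "V = L ` dom A"
  have "subspace V"
    unfolding V_def subspace_def
  proof (intro conjI ballI allI)
    show "0 \<in> L ` dom A"
      using self_adjoint_zero[OF A] Lsr[of 0 0] by (metis image_eqI scaleR_zero_left)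
  next
    fix x y assume "x \<in> L ` dom A" "y \<in> L ` dom A"
    then obtain x' y' where 1: "x' \<in> dom A" "y' \<in> dom A" "x = L x'" "y = L y'" by blast
    then show "x + y \<in> L ` dom A" using L(1)[OF 1(1,2)] Ladd[OF 1(1,2)] by (metis image_eqI)
  next
    fix x c assume "x \<in> L ` dom A"
    then obtain x' where 1: "x' \<in> dom A" "x = L x'" by blast
    then show "c *\<^sub>R x \<in> L ` dom A" using L(5)[OF 1(1,1), of c] Lsr[OF 1(1), of c] by (metis image_eqI)
  qed
  moreover have "closed V"
    unfolding closed_sequential_limits
  proof (intro allI impI, elim conjE)
    fix s l assume "\<forall>n. s n \<in> V" and sl: "s \<longlonglongrightarrow> l"
    then have "\<forall>n. \<exists>u. u \<in> dom A \<and> s n = L u" unfolding V_def by blast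
    then obtain u where u: "\<And>n. u n \<in> dom A" "\<And>n. s n = L (u n)" by metis
    have "Cauchy u"
    proof (rule metric_CauchyI)
      fix e :: real assume "e > 0"
      then obtain M where M: "\<And>p q. p \<ge> M \<Longrightarrow> q \<ge> M \<Longrightarrow> dist (s p) (s q) < m * e"
        using metric_CauchyD[OF LIMSEQ_imp_Cauchy[OF sl], of "m * e"] m by auto
      show "\<exists>M. \<forall>p\<ge>M. \<forall>q\<ge>M. dist (u p) (u q) < e"
      proof (intro exI allI impI)
        fix p q assume pq: "p \<ge> M" "q \<ge> M"
        have "m * norm (u p - u q) \<le> norm (s p - s q)"
          using low[OF L(7)[OF u(1,1)], of p q] Ldiff[OF u(1,1), of p q] u(2) by (simp add: L_def)
        also have "\<dots> < m * e" using M[OF pq] by (simp add: dist_norm)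
        finally show "dist (u p) (u q) < e" using m by (simp add: dist_norm)
      qed
    qed
    then obtain x where x: "u \<longlonglongrightarrow> x" using Cauchy_convergent convergent_def by blast
    have "(\<lambda>n. s n - k *\<^sub>R u n) \<longlonglongrightarrow> l - k *\<^sub>R x" using sl x by (intro tendsto_intros)
    then have "(\<lambda>n. the (A (u n))) \<longlonglongrightarrow> l - k *\<^sub>R x" by (simp add: u(2) L_def)
    from self_adjoint_closed[OF A u(1) x this] show "l \<in> V" unfolding V_def L_def by force
  qed
  ultimately have "\<exists>x\<in>dom A. L x = y" for y
  proof -
    assume V: "subspace V" "closed V"
    obtain v where v: "v \<in> V" "\<And>w. w \<in> V \<Longrightarrow> inner (y - v) w = 0"
      using exists_orthogonal_projection[OF V] by blast
    have "inner (the (A x)) (y - v) = inner x (- k *\<^sub>R (y - v))" if x: "x \<in> dom A" for x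
    proof -
      have "inner (y - v) (L x) = 0" using v(2) x by (auto simp: V_def)
      then show ?thesis by (simp add: L_def inner_simps inner_commute)
    qed
    from self_adjoint_memI[OF A this] have 1: "y - v \<in> dom A" and "the (A (y - v)) = - k *\<^sub>R (y - v)" by auto
    then have "m * norm (y - v) \<le> 0" using low[OF 1] by simp
    then have "y = v" using m by (simp add: mult_le_0_iff)
    with v(1) show ?thesis by (auto simp: V_def)
  qed
  then obtain R where R: "\<And>y. R y \<in> dom A" "\<And>y. L (R y) = y" by metis
  have Radd: "R (x + y) = R x + R y" for x y
    using inj[OF R(1) L(1)[OF R(1,1)]] Ladd[OF R(1,1)] R by simp
  have Rsc: "R (c *\<^sub>C y) = c *\<^sub>C R y" for c y
    using inj[OF R(1) L(3)[OF R(1,1)]] Lsc[OF R(1)] R by simp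
  have Rsr: "R (c *\<^sub>R y) = c *\<^sub>R R y" for c y
    using Rsc[of "complex_of_real c" y] by (simp add: scaleC_of_real)
  have Rn: "m * norm (R y) \<le> norm y" for y using low[OF R(1), of y] R(2)[of y] by (simp add: L_def)
  show ?thesis
  proof (rule that)
    show "bounded_linear R"
      by (rule bounded_linear_intro[where K = "1/m"]) (use Radd Rsr Rn m in \<open>auto simp: field_simps\<close>)
    show "inner (R x) y = inner x (R y)" for x y
    proof -
      have "inner (R x) (L (R y)) = inner (L (R x)) (R y)"
        using self_adjoint_sym[OF A R(1,1), of x y] by (simp add: L_def inner_simps)
      then show ?thesis by (simp add: R(2))
    qed
    show "R (the (A x) + k *\<^sub>R x) = x" if "x \<in> dom A" for x
      using inj[OF R(1) that] R(2) by (simp add: L_def)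
  qed (use R Rn Rsc in \<open>auto simp: L_def\<close>)
qed

text \<open>Von Neumann's argument: the graph of \<open>S\<close> is a closed subspace of the
  product, and \<open>(y, 0)\<close> is projected onto it. Orthogonality of the residual to the
  graph says precisely that \<open>S x\<close> satisfies the adjoint relation with value
  \<open>y - x\<close>.\<close>

lemma self_adjoint_one_plus_square_surj:
  fixes S :: "'a::complex_hilbert \<rightharpoonup> 'a"
  assumes S: "self_adjoint S"
  shows "\<exists>x\<in>dom S. the (S x) \<in> dom S \<and> x + the (S (the (S x))) = y"
proof -
  note L = linear_operatorD[OF self_adjoint_linear[OF S]]
  define V where "V = (\<lambda>x. (x, the (S x))) ` dom S"
  have "subspace V"
    unfolding V_def subspace_def
  proof (intro conjI ballI allI)
    show "0 \<in> (\<lambda>x. (x, the (S x))) ` dom S"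
      using self_adjoint_zero[OF S] L(6)[OF self_adjoint_zero[OF S] self_adjoint_zero[OF S], of 0]
      by (auto simp: zero_prod_def image_iff)
  next
    fix p q assume "p \<in> (\<lambda>x. (x, the (S x))) ` dom S" "q \<in> (\<lambda>x. (x, the (S x))) ` dom S"
    then obtain x y where 1: "x \<in> dom S" "y \<in> dom S" "p = (x, the (S x))" "q = (y, the (S y))" by blast
    then have "p + q = (x + y, the (S (x + y)))" using L(2)[OF 1(1,2)] by simp
    then show "p + q \<in> (\<lambda>x. (x, the (S x))) ` dom S" using L(1)[OF 1(1,2)] by blast
  next
    fix p c assume "p \<in> (\<lambda>x. (x, the (S x))) ` dom S"
    then obtain x where 1: "x \<in> dom S" "p = (x, the (S x))" by blast
    then have "c *\<^sub>R p = (c *\<^sub>R x, the (S (c *\<^sub>R x)))" using L(6)[OF 1(1,1)] by simp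
    then show "c *\<^sub>R p \<in> (\<lambda>x. (x, the (S x))) ` dom S" using L(5)[OF 1(1,1)] by blast
  qed
  moreover have "closed V"
    unfolding closed_sequential_limits
  proof (intro allI impI, elim conjE)
    fix s l assume "\<forall>n. s n \<in> V" and sl: "s \<longlonglongrightarrow> l"
    then have "\<forall>n. \<exists>u. u \<in> dom S \<and> s n = (u, the (S u))" unfolding V_def by blast
    then obtain u where u: "\<And>n. u n \<in> dom S" "\<And>n. s n = (u n, the (S (u n)))" by metis
    have "u \<longlonglongrightarrow> fst l" "(\<lambda>n. the (S (u n))) \<longlonglongrightarrow> snd l"
      using tendsto_fst[OF sl] tendsto_snd[OF sl] u(2) by auto
    from self_adjoint_closed[OF S u(1) this] show "l \<in> V" unfolding V_def by (auto simp: image_iff prod_eq_iff)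
  qed
  ultimately obtain v where v: "v \<in> V" "\<And>w. w \<in> V \<Longrightarrow> inner ((y, 0) - v) w = 0"
    using exists_orthogonal_projection by blast
  then obtain x where x: "x \<in> dom S" "v = (x, the (S x))" by (auto simp: V_def)
  have "inner (the (S w)) (the (S x)) = inner w (y - x)" if "w \<in> dom S" for w
  proof -
    have "inner ((y, 0) - v) (w, the (S w)) = 0" using that by (intro v(2)) (auto simp: V_def)
    then show ?thesis by (simp add: x inner_diff_left inner_diff_right inner_commute)
  qed
  from self_adjoint_memI[OF S this] have "the (S x) \<in> dom S" "the (S (the (S x))) = y - x" by auto
  with x(1) show ?thesis by (intro bexI[of _ x]) auto
qed

section \<open>Square roots of bounded operators\<close>

text \<open>Bounded operators of this type are only real-linear, and symmetry refers to the real
  inner product. Complex linearity of a root is recovered later from its commuting with scalar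
  multiplications.\<close>

definition symmetric_blinfun :: "('b::real_inner \<Rightarrow>\<^sub>L 'b) \<Rightarrow> bool" where
  "symmetric_blinfun T \<longleftrightarrow> (\<forall>x y. inner (blinfun_apply T x) y = inner x (blinfun_apply T y))"

definition nonneg_blinfun :: "('b::real_inner \<Rightarrow>\<^sub>L 'b) \<Rightarrow> bool" where
  "nonneg_blinfun T \<longleftrightarrow> (\<forall>x. 0 \<le> inner (blinfun_apply T x) x)"

lemma symmetric_blinfunD: "symmetric_blinfun T \<Longrightarrow> inner (blinfun_apply T x) y = inner x (blinfun_apply T y)"
  by (simp add: symmetric_blinfun_def)

lemma nonneg_blinfunD: "nonneg_blinfun T \<Longrightarrow> 0 \<le> inner (blinfun_apply T x) x"
  by (simp add: nonneg_blinfun_def)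

text \<open>This is the Cauchy-Schwarz inequality for the semi-inner product <T x, y>, applied to
  \<open>x\<close> and \<open>T x\<close>: it gives |T x|^4 \<le> <T x, x> <T T x, T x>, and the
  last factor is at most |T| |T x|^2.\<close>

lemma nonneg_blinfun_norm_le:
  fixes T :: "'b::real_inner \<Rightarrow>\<^sub>L 'b"
  assumes sym: "symmetric_blinfun T" and pos: "nonneg_blinfun T"
  shows "(norm (T x))\<^sup>2 \<le> norm T * inner (T x) x"
proof (cases "T x = 0")
  case False
  define a b c where "a = inner (T x) x" and "b = (norm (T x))\<^sup>2" and "c = inner (T (T x)) (T x)"
  have a: "a \<ge> 0" and c: "c \<ge> 0" using nonneg_blinfunD[OF pos] by (auto simp: a_def c_def)
  have b: "b > 0" using False by (simp add: b_def)
  have cb: "c \<le> norm T * b"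
  proof -
    have "c \<le> norm (T (T x)) * norm (T x)" unfolding c_def by (rule norm_cauchy_schwarz)
    also have "\<dots> \<le> (norm T * norm (T x)) * norm (T x)"
      by (intro mult_right_mono norm_blinfun) auto
    finally show ?thesis by (simp add: b_def power2_eq_square mult.assoc)
  qed
  have q: "0 \<le> a - 2 * t * b + t\<^sup>2 * c" for t
  proof -
    have "0 \<le> inner (T (x - t *\<^sub>R T x)) (x - t *\<^sub>R T x)" by (rule nonneg_blinfunD[OF pos])
    also have "\<dots> = a - 2 * t * b + t\<^sup>2 * c"
      using symmetric_blinfunD[OF sym, of "T x" x]
      by (simp only: a_def b_def c_def power2_norm_eq_inner blinfun.diff_right blinfun.scaleR_right)
        (simp add: inner_simps power2_eq_square algebra_simps)
    finally show ?thesis .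
  qed
  have "b\<^sup>2 \<le> a * c"
  proof (cases "c = 0")
    case True
    \<comment> \<open>For \<open>c = 0\<close> the quadratic is affine in \<open>t\<close> with
      slope \<open>- 2 * b\<close>, and this \<open>t\<close> gives it the value -1, a
      contradiction.\<close>
    have "0 \<le> a - 2 * ((a + 1) / (2 * b)) * b" using q[of "(a + 1) / (2 * b)"] True by simp
    then show ?thesis using b by simp
  next
    case False
    have "0 \<le> a - 2 * (b / c) * b + (b / c)\<^sup>2 * c" by (rule q)
    also have "\<dots> = a - b\<^sup>2 / c" using False by (simp add: field_simps power2_eq_square)
    finally show ?thesis using c False by (simp add: field_simps)
  qed
  also have "\<dots> \<le> a * (norm T * b)" using a cb by (intro mult_left_mono)
  finally have "b \<le> norm T * a" using b by (simp add: power2_eq_square algebra_simps)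
  then show ?thesis by (simp add: a_def b_def)
qed (use nonneg_blinfunD[OF pos, of x] in simp)

lemma blinfun_compose_assoc: "(T o\<^sub>L U) o\<^sub>L W = T o\<^sub>L (U o\<^sub>L W)"
  by (rule blinfun_eqI) simp

lemma id_blinfun_compose: "id_blinfun o\<^sub>L T = T" "T o\<^sub>L id_blinfun = T"
  by (rule blinfun_eqI, simp)+

lemmas blinfun_compose_simps = id_blinfun_compose
  bounded_bilinear.add_left[OF bounded_bilinear_blinfun_compose]
  bounded_bilinear.add_right[OF bounded_bilinear_blinfun_compose]
  bounded_bilinear.diff_left[OF bounded_bilinear_blinfun_compose]
  bounded_bilinear.diff_right[OF bounded_bilinear_blinfun_compose]
  bounded_bilinear.scaleR_left[OF bounded_bilinear_blinfun_compose]
  bounded_bilinear.scaleR_right[OF bounded_bilinear_blinfun_compose]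

text \<open>The limit \<open>Y\<close> of \<open>Y\<^sub>n\<^sub>+\<^sub>1 = (X + Y\<^sub>n\<^sup>2) / 2\<close> with \<open>X = 1 - C\<close> satisfies \<open>(1 - Y)\<^sup>2 = C\<close>; the
  increments are dominated in norm by those of the same scalar recursion with \<open>X = 1\<close>.\<close>

lemma nonneg_blinfun_sqrt_contraction:
  fixes C :: "'b::{real_inner,banach} \<Rightarrow>\<^sub>L 'b"
  assumes sym: "symmetric_blinfun C" and pos: "nonneg_blinfun C" and C1: "norm C \<le> 1"
  obtains P where "symmetric_blinfun P" "nonneg_blinfun P" "P o\<^sub>L P = C"
    "\<And>K. K o\<^sub>L C = C o\<^sub>L K \<Longrightarrow> K o\<^sub>L P = P o\<^sub>L K"
proof -
  define X where "X = id_blinfun - C"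
  have Xs: "symmetric_blinfun X"
    using sym by (simp add: symmetric_blinfun_def X_def blinfun.diff_left inner_simps)
  \<comment> \<open>As \<open>C\<close> is nonnegative with norm at most 1, |Cx|^2 \<le> <Cx, x>,
    whence |x - Cx|^2 = |x|^2 - 2<Cx, x> + |Cx|^2 \<le> |x|^2.\<close>
  have X1: "norm X \<le> 1"
  proof (rule norm_blinfun_bound)
    fix x
    have "(norm (C x))\<^sup>2 \<le> norm C * inner (C x) x" by (rule nonneg_blinfun_norm_le[OF sym pos])
    also have "\<dots> \<le> 1 * inner (C x) x" using C1 nonneg_blinfunD[OF pos] by (intro mult_right_mono)
    finally have "(norm (C x))\<^sup>2 \<le> 2 * inner (C x) x" using nonneg_blinfunD[OF pos, of x] by simp
    moreover have "(norm (X x))\<^sup>2 = (norm x)\<^sup>2 - 2 * inner (C x) x + (norm (C x))\<^sup>2"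
      by (simp add: X_def power2_norm_eq_inner blinfun.diff_left inner_simps inner_commute)
    ultimately have "(norm (X x))\<^sup>2 \<le> (norm x)\<^sup>2" by simp
    then show "norm (X x) \<le> 1 * norm x" using power2_le_imp_le[of "norm (X x)" "norm x"] by simp
  qed simp
  define Y where "Y = rec_nat 0 (\<lambda>n Z. (1/2) *\<^sub>R (X + (Z o\<^sub>L Z)))"
  have Y0: "Y 0 = 0" and YS: "\<And>n. Y (Suc n) = (1/2) *\<^sub>R (X + (Y n o\<^sub>L Y n))" by (simp_all add: Y_def)
  define s :: "nat \<Rightarrow> real" where "s = rec_nat 0 (\<lambda>n z. (1 + z\<^sup>2) / 2)"
  have s0: "s 0 = 0" and sS: "\<And>n. s (Suc n) = (1 + (s n)\<^sup>2) / 2" by (simp_all add: s_def)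
  have s01: "0 \<le> s n \<and> s n \<le> 1" for n
  proof (induction n)
    case (Suc n)
    then have "(s n)\<^sup>2 \<le> 1" by (simp add: power_le_one)
    then show ?case by (simp add: sS)
  qed (simp add: s0)
  have smono: "s n \<le> s (Suc n)" for n
  proof -
    have "0 \<le> (1 - s n)\<^sup>2" by simp
    then show ?thesis by (simp add: sS power2_eq_square algebra_simps)
  qed
  have Yn: "norm (Y n) \<le> s n" for n
  proof (induction n)
    case (Suc n)
    have "norm (Y (Suc n)) \<le> (1/2) * (norm X + norm (Y n o\<^sub>L Y n))"
      by (simp add: YS norm_triangle_ineq)
    also have "\<dots> \<le> (1/2) * (1 + norm (Y n) * norm (Y n))"
      using X1 norm_blinfun_compose[of "Y n" "Y n"] by simp
    also have "\<dots> \<le> (1/2) * (1 + s n * s n)"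
      using Suc by (intro mult_left_mono add_left_mono mult_mono) (auto simp: s01)
    finally show ?case by (simp add: sS power2_eq_square)
  qed (simp add: Y0 s0)
  \<comment> \<open>Every iterate is a polynomial in \<open>X\<close>, so it commutes with whatever
    commutes with \<open>X\<close>; in particular the iterates commute with each other.\<close>
  have Ycomm: "K o\<^sub>L Y n = Y n o\<^sub>L K" if "K o\<^sub>L X = X o\<^sub>L K" for K n
  proof (induction n)
    case (Suc n)
    have "K o\<^sub>L (Y n o\<^sub>L Y n) = (Y n o\<^sub>L Y n) o\<^sub>L K" by (metis Suc blinfun_compose_assoc)
    then show ?case using that by (simp add: YS blinfun_compose_simps)
  qed (simp add: Y0)
  have YY: "Y m o\<^sub>L Y n = Y n o\<^sub>L Y m" for m n
    by (rule Ycomm) (rule Ycomm[symmetric], simp)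
  have Yd: "norm (Y (Suc n) - Y n) \<le> s (Suc n) - s n" for n
  proof (induction n)
    case 0
    have "norm (Y (Suc 0)) \<le> s (Suc 0)" by (rule Yn)
    then show ?case by (simp add: Y0 s0)
  next
    case (Suc n)
    have "Y (Suc (Suc n)) - Y (Suc n) = (1/2) *\<^sub>R ((Y (Suc n) o\<^sub>L Y (Suc n)) - (Y n o\<^sub>L Y n))"
      using YS[of n] YS[of "Suc n"] by (simp add: algebra_simps)
    \<comment> \<open>The difference of squares factorises because the iterates commute.\<close>
    also have "\<dots> = (1/2) *\<^sub>R ((Y (Suc n) - Y n) o\<^sub>L (Y (Suc n) + Y n))"
      using YY[of n "Suc n"] by (simp add: blinfun_compose_simps)
    finally have "norm (Y (Suc (Suc n)) - Y (Suc n))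
        \<le> (1/2) * (norm (Y (Suc n) - Y n) * norm (Y (Suc n) + Y n))"
      using norm_blinfun_compose[of "Y (Suc n) - Y n" "Y (Suc n) + Y n"] by simp
    also have "\<dots> \<le> (1/2) * ((s (Suc n) - s n) * (s (Suc n) + s n))"
      using Suc norm_triangle_mono[OF Yn[of "Suc n"] Yn[of n]] smono
      by (intro mult_left_mono mult_mono) auto
    also have "\<dots> = s (Suc (Suc n)) - s (Suc n)"
      using sS[of n] sS[of "Suc n"] by (simp add: power2_eq_square field_simps)
    finally show ?case .
  qed
  have Yd': "norm (Y (n + k) - Y n) \<le> s (n + k) - s n" for n k
  proof (induction k)
    case (Suc k)
    have "norm (Y (n + Suc k) - Y n) \<le> norm (Y (Suc (n + k)) - Y (n + k)) + norm (Y (n + k) - Y n)"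
      by (metis add_Suc_right norm_triangle_ineq diff_add_cancel add_diff_eq)
    then show ?case using Suc Yd[of "n + k"] by simp
  qed simp
  have "convergent s"
  proof (rule Bseq_mono_convergent)
    show "Bseq s" using s01 by (intro BseqI'[of _ 1]) auto
    show "\<forall>m n. m \<le> n \<longrightarrow> s m \<le> s n" using lift_Suc_mono_le[of s] smono by blast
  qed
  then have sC: "Cauchy s" by (rule convergent_Cauchy)
  have "Cauchy Y"
  proof (rule metric_CauchyI)
    fix e :: real assume "e > 0"
    then obtain M where M: "\<And>p q. p \<ge> M \<Longrightarrow> q \<ge> M \<Longrightarrow> dist (s p) (s q) < e"
      using metric_CauchyD[OF sC] by blast
    have *: "dist (Y p) (Y q) < e" if "p \<le> q" "p \<ge> M" for p q
      using Yd'[of p "q - p"] M[of q p] that by (simp add: dist_norm norm_minus_commute)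
    have "dist (Y p) (Y q) < e" if "p \<ge> M" "q \<ge> M" for p q
      using *[of p q] *[of q p] that by (cases "p \<le> q") (auto simp: dist_commute)
    then show "\<exists>M. \<forall>p\<ge>M. \<forall>q\<ge>M. dist (Y p) (Y q) < e" by blast
  qed
  then obtain L where L: "Y \<longlonglongrightarrow> L" using Cauchy_convergent convergent_def by blast
  have comp: "(\<lambda>n. f n o\<^sub>L g n) \<longlonglongrightarrow> (a o\<^sub>L b)" if "f \<longlonglongrightarrow> a" "g \<longlonglongrightarrow> b"
    for f g :: "nat \<Rightarrow> 'b \<Rightarrow>\<^sub>L 'b" and a b
    using that by (rule bounded_bilinear.tendsto[OF bounded_bilinear_blinfun_compose])
  have LL: "L = (1/2) *\<^sub>R (X + (L o\<^sub>L L))"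
  proof (rule LIMSEQ_unique)
    show "(\<lambda>n. Y (Suc n)) \<longlonglongrightarrow> L" using L by (rule LIMSEQ_Suc)
    show "(\<lambda>n. Y (Suc n)) \<longlonglongrightarrow> (1/2) *\<^sub>R (X + (L o\<^sub>L L))"
      unfolding YS by (intro tendsto_intros comp L)
  qed
  \<comment> \<open>This bound is what makes the root \<open>id_blinfun - L\<close>
    nonnegative.\<close>
  have L1: "norm L \<le> 1"
    by (rule tendsto_upperbound[OF tendsto_norm[OF L]])
      (use Yn s01 in \<open>auto intro!: always_eventually intro: order_trans\<close>)
  have Ysym: "symmetric_blinfun (Y n)" for n
  proof (induction n)
    case (Suc n)
    then show ?case using Xs
      by (simp add: YS symmetric_blinfun_def blinfun.add_left blinfun.scaleR_left inner_simps)
  qed (simp add: Y0 symmetric_blinfun_def)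
  have Lsym: "inner (L x) y = inner x (L y)" for x y
  proof (rule LIMSEQ_unique)
    have a: "(\<lambda>n. Y n z) \<longlonglongrightarrow> L z" for z
      using L by (rule bounded_linear.tendsto[OF blinfun.bounded_linear_left])
    show "(\<lambda>n. inner (Y n x) y) \<longlonglongrightarrow> inner (L x) y" by (intro tendsto_intros a)
    show "(\<lambda>n. inner (Y n x) y) \<longlonglongrightarrow> inner x (L y)"
      unfolding symmetric_blinfunD[OF Ysym] by (intro tendsto_intros a)
  qed
  show ?thesis
  proof (rule that[of "id_blinfun - L"])
    show "symmetric_blinfun (id_blinfun - L)"
      by (simp add: symmetric_blinfun_def blinfun.diff_left inner_simps Lsym)
    show "nonneg_blinfun (id_blinfun - L)"
      unfolding nonneg_blinfun_def
    proof
      fix x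
      have "inner (L x) x \<le> norm (L x) * norm x" by (rule norm_cauchy_schwarz)
      also have "\<dots> \<le> (1 * norm x) * norm x"
        using norm_blinfun[of L x] L1 mult_right_mono[OF L1 norm_ge_zero[of x]]
        by (intro mult_right_mono) auto
      finally show "0 \<le> inner ((id_blinfun - L) x) x"
        by (simp add: blinfun.diff_left inner_simps power2_norm_eq_inner[symmetric] power2_eq_square)
    qed
    have "2 *\<^sub>R L = X + (L o\<^sub>L L)" using arg_cong[OF LL, of "\<lambda>z. 2 *\<^sub>R z"] by simp
    then show "(id_blinfun - L) o\<^sub>L (id_blinfun - L) = C"
      by (simp add: blinfun_compose_simps X_def scaleR_2 algebra_simps)
    show "K o\<^sub>L (id_blinfun - L) = (id_blinfun - L) o\<^sub>L K" if "K o\<^sub>L C = C o\<^sub>L K" for K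
    proof -
      have KX: "K o\<^sub>L X = X o\<^sub>L K" using that by (simp add: X_def blinfun_compose_simps)
      have "K o\<^sub>L L = L o\<^sub>L K"
      proof (rule LIMSEQ_unique)
        show "(\<lambda>n. K o\<^sub>L Y n) \<longlonglongrightarrow> (K o\<^sub>L L)" by (intro comp tendsto_intros L)
        show "(\<lambda>n. K o\<^sub>L Y n) \<longlonglongrightarrow> (L o\<^sub>L K)" unfolding Ycomm[OF KX] by (intro comp tendsto_intros L)
      qed
      then show ?thesis by (simp add: blinfun_compose_simps)
    qed
  qed
qed

lemma nonneg_blinfun_sqrt:
  fixes C :: "'b::{real_inner,banach} \<Rightarrow>\<^sub>L 'b"
  assumes sym: "symmetric_blinfun C" and pos: "nonneg_blinfun C"
  obtains P where "symmetric_blinfun P" "nonneg_blinfun P" "P o\<^sub>L P = C"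
    "\<And>K. K o\<^sub>L C = C o\<^sub>L K \<Longrightarrow> K o\<^sub>L P = P o\<^sub>L K"
proof -
  define q where "q = norm C + 1"
  have q: "q > 0" by (simp add: q_def add_nonneg_pos)
  define C' where "C' = (1 / q) *\<^sub>R C"
  have "symmetric_blinfun C'" "nonneg_blinfun C'" "norm C' \<le> 1"
    using sym pos q by (auto simp: symmetric_blinfun_def nonneg_blinfun_def C'_def blinfun.scaleR_left)
      (simp add: q_def)
  from nonneg_blinfun_sqrt_contraction[OF this] obtain P where P:
    "symmetric_blinfun P" "nonneg_blinfun P" "P o\<^sub>L P = C'"
    "\<And>K. K o\<^sub>L C' = C' o\<^sub>L K \<Longrightarrow> K o\<^sub>L P = P o\<^sub>L K" by blast
  show ?thesis
  proof (rule that[of "sqrt q *\<^sub>R P"])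
    show "symmetric_blinfun (sqrt q *\<^sub>R P)" "nonneg_blinfun (sqrt q *\<^sub>R P)"
      using P(1,2) q by (auto simp: symmetric_blinfun_def nonneg_blinfun_def blinfun.scaleR_left)
    show "(sqrt q *\<^sub>R P) o\<^sub>L (sqrt q *\<^sub>R P) = C"
      using q P(3) by (simp add: blinfun_compose_simps C'_def)
    show "K o\<^sub>L (sqrt q *\<^sub>R P) = (sqrt q *\<^sub>R P) o\<^sub>L K" if "K o\<^sub>L C = C o\<^sub>L K" for K
      using P(4)[of K] that by (simp add: C'_def blinfun_compose_simps)
  qed
qed

lemma nonneg_blinfun_inner_zero:
  fixes T :: "'b::real_inner \<Rightarrow>\<^sub>L 'b"
  assumes "symmetric_blinfun T" "nonneg_blinfun T" "inner (T x) x = 0"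
  shows "T x = 0"
  using nonneg_blinfun_norm_le[OF assms(1,2), of x] assms(3) by simp

text \<open>For commuting nonnegative roots \<open>T\<close> and \<open>U\<close> put
  \<open>d = T x - U x\<close>. Then (T + U)d = (T^2 - U^2)x = 0, so <Td, d> and <Ud, d> are
  nonnegative with sum zero; hence Td = Ud = 0 and |d|^2 = <x, Td - Ud> = 0. Two arbitrary roots are
  each compared with the constructed one, which commutes with everything that commutes with its
  square.\<close>

lemma nonneg_blinfun_sqrt_unique:
  fixes P Q :: "'b::{real_inner,banach} \<Rightarrow>\<^sub>L 'b"
  assumes P: "symmetric_blinfun P" "nonneg_blinfun P" and Q: "symmetric_blinfun Q" "nonneg_blinfun Q"
    and PQ: "P o\<^sub>L P = Q o\<^sub>L Q"
  shows "P = Q"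
proof -
  have eq: "T = U" if T: "symmetric_blinfun T" "nonneg_blinfun T" and U: "symmetric_blinfun U" "nonneg_blinfun U"
    and TU: "T o\<^sub>L T = U o\<^sub>L U" and comm: "T o\<^sub>L U = U o\<^sub>L T" for T U :: "'b \<Rightarrow>\<^sub>L 'b"
  proof (rule blinfun_eqI)
    fix x
    define d where "d = T x - U x"
    have "T d + U d = (T o\<^sub>L T) x - (U o\<^sub>L U) x + ((U o\<^sub>L T) x - (T o\<^sub>L U) x)"
      by (simp add: d_def blinfun.diff_right)
    also have "\<dots> = 0" using TU comm by simp
    finally have *: "T d + U d = 0" .
    have "inner (T d) d + inner (U d) d = 0" by (simp add: * inner_add_left[symmetric])
    then have "inner (T d) d = 0" "inner (U d) d = 0"
      using nonneg_blinfunD[OF T(2), of d] nonneg_blinfunD[OF U(2), of d] by linarith+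
    then have Td: "T d = 0" "U d = 0" using nonneg_blinfun_inner_zero T U by blast+
    have "inner d d = inner x (T d - U d)"
      using symmetric_blinfunD[OF T(1), of x d] symmetric_blinfunD[OF U(1), of x d]
      by (subst d_def) (simp add: inner_simps)
    then show "T x = U x" using Td by (simp add: d_def)
  qed
  have C: "symmetric_blinfun (Q o\<^sub>L Q)" "nonneg_blinfun (Q o\<^sub>L Q)"
    by (simp_all add: symmetric_blinfun_def nonneg_blinfun_def symmetric_blinfunD[OF Q(1)]
        flip: power2_norm_eq_inner)
  from nonneg_blinfun_sqrt[OF C] obtain R where R: "symmetric_blinfun R" "nonneg_blinfun R"
    "R o\<^sub>L R = Q o\<^sub>L Q" "\<And>K. K o\<^sub>L (Q o\<^sub>L Q) = (Q o\<^sub>L Q) o\<^sub>L K \<Longrightarrow> K o\<^sub>L R = R o\<^sub>L K" by blast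
  have "P = R"
    by (rule eq[OF P R(1,2)]) (use PQ R(3) in simp, rule R(4), simp add: PQ[symmetric] blinfun_compose_assoc)
  moreover have "Q = R"
    by (rule eq[OF Q R(1,2)]) (use R(3) in simp, rule R(4), simp add: blinfun_compose_assoc)
  ultimately show ?thesis by simp
qed

section \<open>The absolute value and spectral gaps\<close>

lemma dom_map_comp_iff: "x \<in> dom (f \<circ>\<^sub>m g) \<longleftrightarrow> x \<in> dom g \<and> the (g x) \<in> dom f"
  by (auto simp: map_comp_def split: option.splits)

lemma map_comp_eq_Some: "x \<in> dom g \<Longrightarrow> (f \<circ>\<^sub>m g) x = f (the (g x))"
  by (auto simp: map_comp_def)

text \<open>With \<open>R = (A + k)\<^sup>-\<^sup>1\<close> and \<open>W = A R = 1 - k R\<close>, the root is \<open>M (A + k)\<close>, where \<open>M\<close> is the bounded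
  nonnegative square root of \<open>W\<^sup>2\<close>.\<close>

lemma nonneg_sqrt_exists:
  fixes A :: "'a::complex_hilbert \<rightharpoonup> 'a"
  assumes A: "self_adjoint A" and low: "bounded_below_by c A"
  obtains S where "self_adjoint S" "bounded_below_by 0 S" "S \<circ>\<^sub>m S = A \<circ>\<^sub>m A" "dom S = dom A"
proof -
  note LA = linear_operatorD[OF self_adjoint_linear[OF A]]
  \<comment> \<open>With this shift \<open>A + k\<close> is bounded below by 1, so its inverse
    \<open>R\<close> is a nonnegative contraction.\<close>
  define k where "k = 1 - c"
  have low1: "(norm x)\<^sup>2 \<le> inner (the (A x) + k *\<^sub>R x) x" if "x \<in> dom A" for x
    using low that by (auto simp: bounded_below_by_def Re_cinner inner_simps k_def power2_norm_eq_inner algebra_simps)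
  have "1 * norm x \<le> norm (the (A x) + k *\<^sub>R x)" if x: "x \<in> dom A" for x
  proof (cases "x = 0")
    case False
    have "norm x * norm x \<le> norm (the (A x) + k *\<^sub>R x) * norm x"
      using low1[OF x] norm_cauchy_schwarz[of "the (A x) + k *\<^sub>R x" x] by (simp add: power2_eq_square)
    then show ?thesis using False by simp
  qed simp
  then obtain R where R: "bounded_linear R" "\<And>y. R y \<in> dom A" "\<And>y. the (A (R y)) + k *\<^sub>R R y = y"
    "\<And>x. x \<in> dom A \<Longrightarrow> R (the (A x) + k *\<^sub>R x) = x"
    "\<And>x y. inner (R x) y = inner x (R y)" "\<And>c y. R (c *\<^sub>C y) = c *\<^sub>C R y"
    using self_adjoint_bounded_inverse[OF A zero_less_one, of k] by (metis (no_types))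
  define Rb where "Rb = Blinfun R"
  have Rb [simp]: "blinfun_apply Rb = R" by (simp add: Rb_def bounded_linear_Blinfun_apply R(1))
  have Rsym: "symmetric_blinfun Rb" using R(5) by (simp add: symmetric_blinfun_def)
  have "0 \<le> inner (R y) y" for y
    using low1[OF R(2), of y] by (simp add: R(3) inner_commute) (meson order_trans zero_le_power2)
  then have Rpos: "nonneg_blinfun Rb" by (simp add: nonneg_blinfun_def)
  define W where "W = id_blinfun - k *\<^sub>R Rb"
  have W: "W y = y - k *\<^sub>R R y" for y by (simp add: W_def blinfun.diff_left blinfun.scaleR_left)
  have Wsym: "symmetric_blinfun W" by (simp add: symmetric_blinfun_def W inner_simps R(5))
  have WW: "symmetric_blinfun (W o\<^sub>L W)" "nonneg_blinfun (W o\<^sub>L W)"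
    by (simp_all add: symmetric_blinfun_def nonneg_blinfun_def symmetric_blinfunD[OF Wsym]
        flip: power2_norm_eq_inner)
  obtain M where M: "symmetric_blinfun M" "nonneg_blinfun M" "M o\<^sub>L M = W o\<^sub>L W"
    "\<And>K. K o\<^sub>L (W o\<^sub>L W) = (W o\<^sub>L W) o\<^sub>L K \<Longrightarrow> K o\<^sub>L M = M o\<^sub>L K"
    using nonneg_blinfun_sqrt[OF WW] by blast
  \<comment> \<open>The root of the resolvent serves to prove nonnegativity of the operator
    \<open>S\<close>: since \<open>N\<close> commutes with \<open>M\<close>, <M u, R u> = <M N u, N
    u>.\<close>
  obtain N where N: "symmetric_blinfun N" "nonneg_blinfun N" "N o\<^sub>L N = Rb"
    "\<And>K. K o\<^sub>L Rb = Rb o\<^sub>L K \<Longrightarrow> K o\<^sub>L N = N o\<^sub>L K"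
    using nonneg_blinfun_sqrt[OF Rsym Rpos] by blast
  have RW: "Rb o\<^sub>L W = W o\<^sub>L Rb" by (simp add: W_def blinfun_compose_simps)
  have RWW: "Rb o\<^sub>L (W o\<^sub>L W) = (W o\<^sub>L W) o\<^sub>L Rb" by (metis RW blinfun_compose_assoc)
  have RM: "R (M y) = M (R y)" for y using arg_cong[OF M(4)[OF RWW], of "\<lambda>T. blinfun_apply T y"] by simp
  have RW': "R (W y) = W (R y)" for y using arg_cong[OF RW, of "\<lambda>T. blinfun_apply T y"] by simp
  have "N o\<^sub>L (W o\<^sub>L W) = (W o\<^sub>L W) o\<^sub>L N" by (rule N(4)[symmetric]) (simp add: RWW)
  then have NM: "N (M y) = M (N y)" for y using arg_cong[OF M(4), of N "\<lambda>T. blinfun_apply T y"] by simp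
  have MM: "M (M y) = W (W y)" for y using arg_cong[OF M(3), of "\<lambda>T. blinfun_apply T y"] by simp
  have NN: "N (N y) = R y" for y using arg_cong[OF N(3), of "\<lambda>T. blinfun_apply T y"] by simp
  \<comment> \<open>Multiplication by \<open>z\<close> commutes with \<open>W\<close> and its
    square, hence with the root \<open>M\<close>.\<close>
  have MC: "M (z *\<^sub>C y) = z *\<^sub>C M y" for z y
  proof -
    define J :: "'a \<Rightarrow>\<^sub>L 'a" where "J = Blinfun (\<lambda>x. z *\<^sub>C x)"
    have J [simp]: "blinfun_apply J = (\<lambda>x. z *\<^sub>C x)"
      by (simp add: J_def bounded_linear_Blinfun_apply bounded_linear_scaleC)
    have "W (z *\<^sub>C y) = z *\<^sub>C W y" for y
      using linear_diff[OF bounded_linear.linear[OF bounded_linear_scaleC], of z y "k *\<^sub>R R y"]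
        linear_scale[OF bounded_linear.linear[OF bounded_linear_scaleC], of z k "R y"]
      by (simp add: W R(6))
    then have "J o\<^sub>L (W o\<^sub>L W) = (W o\<^sub>L W) o\<^sub>L J" by (intro blinfun_eqI) simp
    from arg_cong[OF M(4)[OF this], of "\<lambda>T. blinfun_apply T y"] show ?thesis by simp
  qed
  define S where "S x = (if x \<in> dom A then Some (M (the (A x) + k *\<^sub>R x)) else None)" for x
  have domS: "dom S = dom A" by (auto simp: S_def split: if_splits)
  have SR: "S (R y) = Some (M y)" for y by (simp add: S_def R)
  have AR: "A (R y) = Some (W y)" for y
  proof -
    have "the (A (R y)) = W y" using R(3)[of y] by (simp add: W algebra_simps)
    then show ?thesis using R(2)[of y] by auto
  qed
  have ex: "\<exists>y. x = R y" if "x \<in> dom A" for x using R(4)[OF that] by metis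
  \<comment> \<open>The range of \<open>R\<close> is the domain of \<open>A\<close>. As
    \<open>W\<close> differs from the identity by a multiple of \<open>R\<close>, it cannot map a
    vector outside the domain into it. The same follows for \<open>M\<close> through
    \<open>M (M y) = W (W y)\<close>; this is the maximality needed for self-adjointness of
    \<open>S\<close> and for comparing the domains of the squares.\<close>
  have WR: "y \<in> dom A" if "W y = R z" for y z
  proof -
    have "y = R (z + k *\<^sub>R y)"
      using that by (simp add: W bounded_linear.linear[OF R(1)] linear_add linear_scale algebra_simps)
    then show ?thesis using R(2) by metis
  qed
  have MR: "y \<in> dom A" if "M y = R z" for y z
  proof -
    have "W (W y) = R (M z)" using that by (simp add: RM flip: MM)
    then have "W y \<in> dom A" by (rule WR)
    then show ?thesis using ex WR by metis
  qed
  have linS: "linear_operator S"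
    unfolding linear_operator_def
  proof (intro conjI ballI allI)
    fix x y assume "x \<in> dom S" "y \<in> dom S"
    then have xy: "x \<in> dom A" "y \<in> dom A" by (simp_all add: domS)
    show "S (x + y) = Some (the (S x) + the (S y))"
      using xy LA(1,2)[OF xy] by (simp add: S_def blinfun.add_right scaleR_add_right)
  next
    fix z x assume "x \<in> dom S"
    then have x: "x \<in> dom A" by (simp add: domS)
    show "S (z *\<^sub>C x) = Some (z *\<^sub>C the (S x))"
      using x LA(3,4)[OF x x, of z] linear_scale[OF bounded_linear.linear[OF bounded_linear_scaleC], of z k x]
      by (simp add: S_def MC[symmetric] scaleC_add_right)
  qed
  have "self_adjoint S"
  proof (rule self_adjointI[OF linS])
    show "closure (dom S) = UNIV" using A by (simp add: domS self_adjoint_def)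
  next
    fix x y assume "x \<in> dom S" "y \<in> dom S"
    then obtain u v where "x = R u" "y = R v" using ex domS by metis
    then show "inner (the (S x)) y = inner x (the (S y))"
      by (simp add: SR symmetric_blinfunD[OF M(1)] R(5) RM)
  next
    fix y z assume *: "inner (the (S x)) y = inner x z" if "x \<in> dom S" for x
    have "M y = R z"
    proof (rule dense_orthogonal_eq[OF closure_UNIV])
      fix u
      show "inner u (M y) = inner u (R z)"
        using *[of "R u"] by (simp add: SR domS R(2) R(5) symmetric_blinfunD[OF M(1)])
    qed
    then show "y \<in> dom S" using MR by (simp add: domS)
  qed
  moreover have "bounded_below_by 0 S"
    unfolding bounded_below_by_def
  proof
    fix x assume "x \<in> dom S"
    then obtain u where u: "x = R u" using ex domS by metis
    have "inner (M u) (R u) = inner (M (N u)) (N u)"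
      by (simp add: NN[symmetric] NM[symmetric] symmetric_blinfunD[OF N(1)])
    then show "0 * (norm x)\<^sup>2 \<le> Re (cinner (the (S x)) x)"
      using nonneg_blinfunD[OF M(2)] by (simp add: u SR Re_cinner)
  qed
  moreover have "S \<circ>\<^sub>m S = A \<circ>\<^sub>m A"
  proof
    fix x
    show "(S \<circ>\<^sub>m S) x = (A \<circ>\<^sub>m A) x"
    proof (cases "x \<in> dom A")
      case False
      then show ?thesis using domS by (metis dom_map_comp_iff domIff)
    next
      case True
      then obtain y where y: "x = R y" using ex by blast
      have 1: "(S \<circ>\<^sub>m S) x = S (M y)" "(A \<circ>\<^sub>m A) x = A (W y)" by (simp_all add: y SR AR map_comp_def)
      show ?thesis
      proof (cases "y \<in> dom A")
        case True
        then obtain w where w: "y = R w" using ex by blast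
        have "S (M y) = Some (M (M w))" "A (W y) = Some (W (W w))"
          by (simp_all add: w SR AR flip: RM RW')
        then show ?thesis by (simp add: 1 MM)
      next
        case False
        \<comment> \<open>In this case both compositions are undefined at
          \<open>x = R y\<close>.\<close>
        then have "M y \<notin> dom A" "W y \<notin> dom A" using MR WR ex by metis+
        then show ?thesis using domS by (metis 1 domIff)
      qed
    qed
  qed
  ultimately show ?thesis using that domS by blast
qed

text \<open>For \<open>B = S \<circ>\<^sub>m S\<close> with self-adjoint \<open>S\<close> this is
  the inverse of 1 + S^2. It is defined from the square only, so that two roots of the same operator
  share it.\<close>

definition square_resolvent :: "('a::complex_hilbert \<rightharpoonup> 'a) \<Rightarrow> 'a \<Rightarrow> 'a" where
  "square_resolvent B y = (SOME x. x \<in> dom B \<and> x + the (B x) = y)"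

text \<open>The map \<open>\<lambda>y. the (S (G y))\<close>, that is S(1 + S^2)^-1, is a bounded
  substitute for \<open>S\<close>, to which the theory of bounded roots applies. Its bound comes
  from |y|^2 = |Gy|^2 + 2|SGy|^2 + |SSGy|^2, the expansion of y = Gy + SSGy.\<close>

lemma square_resolvent:
  fixes S :: "'a::complex_hilbert \<rightharpoonup> 'a"
  assumes S: "self_adjoint S"
  defines "G \<equiv> square_resolvent (S \<circ>\<^sub>m S)"
  shows "G y \<in> dom S" "the (S (G y)) \<in> dom S" "G y + the (S (the (S (G y)))) = y"
    and "x \<in> dom S \<Longrightarrow> the (S x) \<in> dom S \<Longrightarrow> G (x + the (S (the (S x)))) = x"
    and "x \<in> dom S \<Longrightarrow> G (the (S x)) = the (S (G x))"
    and "bounded_linear (\<lambda>y. the (S (G y)))"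
    and "inner (the (S (G y))) z = inner y (the (S (G z)))"
    and "bounded_below_by 0 S \<Longrightarrow> 0 \<le> inner (the (S (G y))) y"
proof -
  note L = linear_operatorD[OF self_adjoint_linear[OF S]]
  define s where "s x = the (S x)" for x
  have ex: "\<exists>x. x \<in> dom (S \<circ>\<^sub>m S) \<and> x + the ((S \<circ>\<^sub>m S) x) = y" for y
    using self_adjoint_one_plus_square_surj[OF S, of y] by (auto simp: dom_map_comp_iff map_comp_eq_Some)
  have GG: "G y \<in> dom (S \<circ>\<^sub>m S) \<and> G y + the ((S \<circ>\<^sub>m S) (G y)) = y" for y
    unfolding G_def square_resolvent_def by (rule someI_ex[OF ex])
  have G: "G y \<in> dom S" "s (G y) \<in> dom S" "G y + s (s (G y)) = y" for y
    using GG[of y] by (auto simp: dom_map_comp_iff map_comp_eq_Some s_def)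
  have sym: "inner (s x) y = inner x (s y)" if "x \<in> dom S" "y \<in> dom S" for x y
    using self_adjoint_sym[OF S that] by (simp add: s_def)
  have lin: "s (x + y) = s x + s y" "s (x - y) = s x - s y" "s (r *\<^sub>R x) = r *\<^sub>R s x"
    if "x \<in> dom S" "y \<in> dom S" for x y r
    using L[OF that] by (simp_all add: s_def)
  have inj: "x = y" if x: "x \<in> dom S" "s x \<in> dom S" and y: "y \<in> dom S" "s y \<in> dom S"
    and eq: "x + s (s x) = y + s (s y)" for x y
  proof -
    define d where "d = x - y"
    have d: "d \<in> dom S" "s d \<in> dom S" "s (s d) = s (s x) - s (s y)"
      using L(7)[OF x(1) y(1)] L(7)[OF x(2) y(2)] lin(2)[OF x(1) y(1)] lin(2)[OF x(2) y(2)]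
      by (auto simp: d_def)
    have "d + s (s d) = 0" using eq unfolding d(3) by (simp add: d_def algebra_simps)
    then have "inner (d + s (s d)) d = 0" by simp
    then have "inner d d + inner (s d) (s d) = 0" using sym[OF d(2,1)] by (simp add: inner_simps)
    then have "inner d d = 0" using inner_ge_zero[of d] inner_ge_zero[of "s d"] by linarith
    then show ?thesis by (simp add: d_def)
  qed
  have Ginv: "G (x + s (s x)) = x" if "x \<in> dom S" "s x \<in> dom S" for x
    by (rule inj) (use G that in auto)
  have Gs: "G (s x) = s (G x)" if x: "x \<in> dom S" for x
  proof -
    have "s (s (G x)) = x - G x" using G(3)[of x] by (simp add: algebra_simps)
    then have 1: "s (s (G x)) \<in> dom S" using L(7)[OF x G(1)] by simp
    have "s (G x) + s (s (s (G x))) = s x"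
      using lin(1)[OF G(1)[of x] 1] G(3)[of x] by simp
    then show ?thesis using Ginv[OF G(2) 1] by simp
  qed
  have Gadd: "G (x + y) = G x + G y" for x y
  proof -
    have 1: "G x + G y \<in> dom S" "s (G x + G y) \<in> dom S" "s (s (G x + G y)) = s (s (G x)) + s (s (G y))"
      using L(1)[OF G(1,1)] L(1)[OF G(2,2)] lin(1)[OF G(1,1)] lin(1)[OF G(2,2)] by auto
    have "(G x + G y) + s (s (G x + G y)) = x + y"
      using G(3)[of x] G(3)[of y] 1(3) by (metis add.assoc add.left_commute)
    then show ?thesis using Ginv[OF 1(1,2)] by simp
  qed
  have Gscale: "G (r *\<^sub>R x) = r *\<^sub>R G x" for r x
  proof -
    have 1: "r *\<^sub>R G x \<in> dom S" "s (r *\<^sub>R G x) \<in> dom S" "s (s (r *\<^sub>R G x)) = r *\<^sub>R s (s (G x))"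
      using L(5)[OF G(1,1)] L(5)[OF G(2,2)] lin(3)[OF G(1,1)] lin(3)[OF G(2,2)] by auto
    have "(r *\<^sub>R G x) + s (s (r *\<^sub>R G x)) = r *\<^sub>R x"
      using G(3)[of x] 1(3) by (metis scaleR_add_right)
    then show ?thesis using Ginv[OF 1(1,2)] by simp
  qed
  have bound: "norm (s (G y)) \<le> norm y * 1" for y
  proof -
    have "inner y y = inner (G y + s (s (G y))) (G y + s (s (G y)))" by (simp add: G(3))
    also have "\<dots> = inner (G y) (G y) + 2 * inner (s (G y)) (s (G y)) + inner (s (s (G y))) (s (s (G y)))"
      using sym[OF G(2,1), of y y] by (simp add: inner_simps inner_commute)
    finally have "inner (s (G y)) (s (G y)) \<le> inner y y"
      using inner_ge_zero[of "G y"] inner_ge_zero[of "s (s (G y))"] inner_ge_zero[of "s (G y)"] by linarith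
    then show ?thesis by (simp add: norm_le)
  qed
  \<comment> \<open>After inserting z = Gz + SSGz, both summands are symmetric in \<open>y\<close>
    and \<open>z\<close>, and for \<open>y = z\<close> both are nonnegative when \<open>S\<close>
    is. Symmetry and positivity of the bounded operator follow at once.\<close>
  have symG: "inner (s (G y)) z = inner (s (G y)) (G z) + inner (s (s (G y))) (s (G z))" for y z
  proof -
    have "inner (s (G y)) z = inner (s (G y)) (G z + s (s (G z)))" by (simp add: G(3))
    then show ?thesis using sym[OF G(2,2), of y z] by (simp add: inner_simps)
  qed
  show "G y \<in> dom S" "the (S (G y)) \<in> dom S" "G y + the (S (the (S (G y)))) = y"
    using G by (auto simp: s_def)
  show "x \<in> dom S \<Longrightarrow> the (S x) \<in> dom S \<Longrightarrow> G (x + the (S (the (S x)))) = x"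
    using Ginv by (simp add: s_def)
  show "x \<in> dom S \<Longrightarrow> G (the (S x)) = the (S (G x))" using Gs by (simp add: s_def)
  show "bounded_linear (\<lambda>y. the (S (G y)))"
    by (rule bounded_linear_intro[where K = 1])
      (use bound lin(1,3)[OF G(1,1)] in \<open>auto simp: Gadd Gscale s_def\<close>)
  have "inner (s (G y)) z = inner y (s (G z))"
    using symG[of y z] symG[of z y] sym[OF G(1,1), of y z] sym[OF G(2,2), of y z] by (simp add: inner_commute)
  then show "inner (the (S (G y))) z = inner y (the (S (G z)))" by (simp add: s_def)
  show "0 \<le> inner (the (S (G y))) y" if "bounded_below_by 0 S"
    using that symG[of y y] G[of y] by (auto simp: bounded_below_by_def Re_cinner s_def)
qed

text \<open>Both \<open>S\<^sub>i (1 + S\<^sub>i\<^sup>2)\<^sup>-\<^sup>1\<close> are bounded nonnegative square roots of the same operator, hence equal; the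
  \<open>S\<^sub>i\<close> are then recovered from \<open>y = G y + S (S (G y))\<close>.\<close>

lemma nonneg_sqrt_unique:
  fixes S1 S2 :: "'a::complex_hilbert \<rightharpoonup> 'a"
  assumes S1: "self_adjoint S1" "bounded_below_by 0 S1" and S2: "self_adjoint S2" "bounded_below_by 0 S2"
    and eq: "S1 \<circ>\<^sub>m S1 = S2 \<circ>\<^sub>m S2"
  shows "S1 = S2"
proof -
  define G where "G = square_resolvent (S1 \<circ>\<^sub>m S1)"
  note R1 = square_resolvent[OF S1(1), folded G_def]
  note R2 = square_resolvent[OF S2(1), folded eq, folded G_def]
  define T1 where "T1 = Blinfun (\<lambda>y. the (S1 (G y)))"
  define T2 where "T2 = Blinfun (\<lambda>y. the (S2 (G y)))"
  have T1: "T1 y = the (S1 (G y))" and T2: "T2 y = the (S2 (G y))" for y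
    using R1(6) R2(6) by (simp_all add: T1_def T2_def bounded_linear_Blinfun_apply)
  \<comment> \<open>Since \<open>G\<close> commutes with \<open>S1\<close>, the square of
    \<open>T1\<close> is S1^2 G^2, which depends on the square of \<open>S1\<close> only.\<close>
  have sq1: "T1 (T1 y) = the ((S1 \<circ>\<^sub>m S1) (G (G y)))" for y
    using R1(5)[OF R1(1), of y] by (simp add: T1 map_comp_eq_Some[OF R1(1)])
  have sq2: "T2 (T2 y) = the ((S2 \<circ>\<^sub>m S2) (G (G y)))" for y
    using R2(5)[OF R2(1), of y] by (simp add: T2 map_comp_eq_Some[OF R2(1)])
  have "T1 = T2"
  proof (rule nonneg_blinfun_sqrt_unique)
    show "symmetric_blinfun T1" "symmetric_blinfun T2" using R1(7) R2(7) by (auto simp: symmetric_blinfun_def T1 T2)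
    show "nonneg_blinfun T1" "nonneg_blinfun T2"
      using R1(8)[OF S1(2)] R2(8)[OF S2(2)] by (auto simp: nonneg_blinfun_def T1 T2)
    show "T1 o\<^sub>L T1 = T2 o\<^sub>L T2" by (rule blinfun_eqI) (simp add: sq1 sq2 eq)
  qed
  then have T: "the (S1 (G y)) = the (S2 (G y))" for y by (metis T1 T2)
  \<comment> \<open>Write y = Gy + UUGy. Since UGy = SGy = G(Sy), this is y = Gy + UG(Sy), a sum of
    two vectors in the domain of \<open>U\<close>; applying \<open>U\<close> gives Uy = G(Sy) +
    UUG(Sy) = Sy. The statement is used in both directions.\<close>
  have sub: "U y = Some (the (S y))"
    if S: "self_adjoint S" "\<And>y. G y \<in> dom S" "\<And>y. G y \<in> dom S \<and> the (S (G y)) \<in> dom S"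
      "\<And>x. x \<in> dom S \<Longrightarrow> G (the (S x)) = the (S (G x))"
      "\<And>y. G y + the (S (the (S (G y)))) = y"
      and U: "self_adjoint U" "\<And>y. G y \<in> dom U \<and> the (U (G y)) \<in> dom U"
      "\<And>y. G y + the (U (the (U (G y)))) = y"
      and SU: "\<And>y. the (S (G y)) = the (U (G y))" and y: "y \<in> dom S" for S U :: "'a \<rightharpoonup> 'a" and y
  proof -
    note L = linear_operatorD[OF self_adjoint_linear[OF U(1)]]
    let ?w = "the (S y)"
    have w: "the (U (G y)) = G ?w" using S(4)[OF y] SU by simp
    have 1: "G y \<in> dom U" "the (U (G ?w)) \<in> dom U" using U(2) by auto
    have y': "y = G y + the (U (G ?w))" using U(3)[of y] w by simp
    have 2: "the (U y) = the (U (G y)) + the (U (the (U (G ?w))))" using L(2)[OF 1] y' by simp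
    also have "\<dots> = ?w" using U(3)[of ?w] w by simp
    finally show ?thesis using L(1)[OF 1] y' by (metis domD option.sel)
  qed
  have 12: "S2 y = Some (the (S1 y))" if "y \<in> dom S1" for y
    by (rule sub[OF S1(1) _ _ _ _ S2(1)]) (use R1(1-3) R1(5) R2(1-3) T that in auto)
  have 21: "S1 y = Some (the (S2 y))" if "y \<in> dom S2" for y
    by (rule sub[OF S2(1) _ _ _ _ S1(1)]) (use R1(1-3) R2(5) R2(1-3) T that in auto)
  show ?thesis
  proof
    fix y
    show "S1 y = S2 y"
    proof (cases "y \<in> dom S1")
      case True
      then show ?thesis using 12[OF True] by (metis domD option.sel)
    next
      case False
      then have "y \<notin> dom S2" using 21 by (metis domIff option.discI)
      then show ?thesis using False by (metis domIff)
    qed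
  qed
qed

text \<open>Existence and uniqueness of the nonnegative root of A^2 resolve the definite description
  in \<open>sqrt_op\<close>. This turns the condition on the domain of |A| in the function space
  into one on the domain of \<open>A\<close>.\<close>

lemma dom_abs_op:
  fixes A :: "'a::complex_hilbert \<rightharpoonup> 'a"
  assumes A: "self_adjoint A" and low: "lower_semibounded A"
  shows "dom (abs_op A) = dom A"
proof -
  obtain c where "bounded_below_by c A" using low by (auto simp: lower_semibounded_def)
  then obtain S where S: "self_adjoint S" "bounded_below_by 0 S" "S \<circ>\<^sub>m S = A \<circ>\<^sub>m A" "dom S = dom A"
    using nonneg_sqrt_exists[OF A] by blast
  have "adjoint_op A = A" using A by (simp add: self_adjoint_def)
  moreover have "(THE S. self_adjoint S \<and> bounded_below_by 0 S \<and> S \<circ>\<^sub>m S = A \<circ>\<^sub>m A) = S"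
  proof (rule the_equality)
    fix T assume "self_adjoint T \<and> bounded_below_by 0 T \<and> T \<circ>\<^sub>m T = A \<circ>\<^sub>m A"
    then show "T = S" using S(1-3) nonneg_sqrt_unique[of T S] by metis
  qed (intro conjI S(1-3))
  ultimately show ?thesis using S(4) by (simp add: abs_op_def sqrt_op_def)
qed

text \<open>Let \<open>\<rho>\<close> be the norm of \<open>R = (A - m)\<^sup>-\<^sup>1\<close>.  If \<open>1/\<rho> < d\<close>, both \<open>m \<plusminus> 1/\<rho>\<close> lie in the gap, so
  \<open>R\<^sup>2 - \<rho>\<^sup>2\<close> is bounded below, contradicting that \<open>R\<close> is symmetric with norm \<open>\<rho>\<close>.\<close>

lemma spectral_gap_lower_bound:
  fixes A :: "'a::complex_hilbert \<rightharpoonup> 'a"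
  assumes A: "self_adjoint A" and d: "d > 0"
    and gap: "complex_of_real ` {m - d<..<m + d} \<inter> spectrum_op A = {}" and x: "x \<in> dom A"
  shows "d * norm x \<le> norm (the (A x) - m *\<^sub>R x)"
proof -
  have res: "\<exists>M>0. \<forall>x\<in>dom A. norm x \<le> M * norm (the (A x) - t *\<^sub>R x)" if t: "t \<in> {m - d<..<m + d}" for t
  proof -
    have "complex_of_real t \<notin> spectrum_op A" using gap t by blast
    then obtain M where M: "\<And>x. x \<in> dom A \<Longrightarrow> norm x \<le> M * norm (the (A x) - t *\<^sub>R x)"
      by (auto simp: spectrum_op_def scaleC_of_real)
    have "norm x \<le> max M 1 * norm (the (A x) - t *\<^sub>R x)" if "x \<in> dom A" for x
      by (rule order_trans[OF M[OF that]]) (intro mult_right_mono, auto)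
    then show ?thesis by (intro exI[of _ "max M 1"]) auto
  qed
  obtain M0 where M0: "M0 > 0" "\<And>x. x \<in> dom A \<Longrightarrow> norm x \<le> M0 * norm (the (A x) - m *\<^sub>R x)"
    using res[of m] d by auto
  have "1 / M0 > 0" using M0 by simp
  moreover have "1 / M0 * norm x \<le> norm (the (A x) + (- m) *\<^sub>R x)" if "x \<in> dom A" for x
    using M0(2)[OF that] M0(1) by (simp add: field_simps)
  ultimately obtain R where R: "bounded_linear R" "\<And>y. R y \<in> dom A" "\<And>y. the (A (R y)) + (- m) *\<^sub>R R y = y"
    "\<And>x. x \<in> dom A \<Longrightarrow> R (the (A x) + (- m) *\<^sub>R x) = x" "\<And>x y. inner (R x) y = inner x (R y)"
    using self_adjoint_bounded_inverse[OF A, of "1 / M0" "- m"] by (metis (no_types))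
  define Rb where "Rb = Blinfun R"
  have Rb [simp]: "blinfun_apply Rb = R" by (simp add: Rb_def bounded_linear_Blinfun_apply R(1))
  define \<rho> where "\<rho> = norm Rb"
  have R\<rho>: "norm (R y) \<le> \<rho> * norm y" for y using norm_blinfun[of Rb y] by (simp add: \<rho>_def)
  have "\<rho> * d \<le> 1"
  proof (rule ccontr)
    assume "\<not> \<rho> * d \<le> 1"
    then have \<rho>d: "1 < \<rho> * d" by simp
    then have \<rho>: "\<rho> > 0" "1 / \<rho> < d"
    proof -
      show "\<rho> > 0" using \<rho>d d by (metis norm_ge_zero \<rho>_def less_le mult_zero_left not_one_less_zero)
      then show "1 / \<rho> < d" using \<rho>d by (simp add: field_simps)
    qed
    have "- d < 1 / \<rho>" using \<rho>(1) d by (meson divide_pos_pos less_trans neg_less_0_iff_less zero_less_one)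
    note \<rho> = \<rho> this
    obtain M1 where M1: "M1 > 0" "\<And>x. x \<in> dom A \<Longrightarrow> norm x \<le> M1 * norm (the (A x) - (m + 1 / \<rho>) *\<^sub>R x)"
      using res[of "m + 1 / \<rho>"] \<rho> by auto
    obtain M2 where M2: "M2 > 0" "\<And>x. x \<in> dom A \<Longrightarrow> norm x \<le> M2 * norm (the (A x) - (m - 1 / \<rho>) *\<^sub>R x)"
      using res[of "m - 1 / \<rho>"] \<rho> by auto
    have AR: "the (A (R y)) = y + m *\<^sub>R R y" for y using R(3)[of y] by (simp add: algebra_simps)
    \<comment> \<open>Applied to \<open>R y\<close>, the operators A - (m + 1/\<rho>) and A - (m -
      1/\<rho>) give y - Ry/\<rho> and y + Ry/\<rho>. Their product is \<open>Q\<close>, so the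
      bounds at both points combine to a bound for \<open>Q\<close>.\<close>
    have B1: "norm (R y) \<le> M1 * norm (y - (1/\<rho>) *\<^sub>R R y)" for y
      using M1(2)[OF R(2), of y] by (simp add: AR algebra_simps)
    have B2: "norm (R y) \<le> M2 * norm (y + (1/\<rho>) *\<^sub>R R y)" for y
      using M2(2)[OF R(2), of y] by (simp add: AR algebra_simps)
    have Rlin: "R (a + b) = R a + R b" "R (r *\<^sub>R a) = r *\<^sub>R R a" for a b r
      using bounded_linear.linear[OF R(1)] by (simp_all add: linear_add linear_scale)
    define Q where "Q v = v - (1/\<rho>\<^sup>2) *\<^sub>R R (R v)" for v
    have B3: "norm (R (R v)) \<le> M1 * M2 * norm (Q v)" for v
    proof -
      have "norm (R (R v)) \<le> M2 * norm (R (v + (1/\<rho>) *\<^sub>R R v))"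
        using B2[of "R v"] by (simp add: Rlin)
      also have "\<dots> \<le> M2 * (M1 * norm (v + (1/\<rho>) *\<^sub>R R v - (1/\<rho>) *\<^sub>R R (v + (1/\<rho>) *\<^sub>R R v)))"
        using M2(1) B1 by (intro mult_left_mono) auto
      also have "v + (1/\<rho>) *\<^sub>R R v - (1/\<rho>) *\<^sub>R R (v + (1/\<rho>) *\<^sub>R R v) = Q v"
        by (simp add: Q_def Rlin algebra_simps power2_eq_square)
      finally show ?thesis by (simp add: mult_ac)
    qed
    define K where "K = \<rho>\<^sup>2 + M1 * M2"
    have K: "K > 0" using \<rho> M1(1) M2(1) by (simp add: K_def add_pos_pos)
    \<comment> \<open>\<open>Q\<close> is bounded below by a positive constant. The estimate
      \<open>B5\<close> bounds \<open>Q\<close> from above and is small on vectors nearly attaining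
      the norm of \<open>R\<close>; the two are incompatible.\<close>
    have B4: "\<rho>\<^sup>2 * norm v \<le> K * norm (Q v)" for v
    proof -
      have "norm v \<le> norm (Q v) + norm ((1/\<rho>\<^sup>2) *\<^sub>R R (R v))"
        unfolding Q_def by (metis diff_add_cancel norm_triangle_ineq)
      then have "\<rho>\<^sup>2 * norm v \<le> \<rho>\<^sup>2 * norm (Q v) + norm (R (R v))" using \<rho> by (simp add: field_simps)
      then show ?thesis using B3[of v] by (simp add: K_def algebra_simps)
    qed
    have B5: "(norm (Q v))\<^sup>2 \<le> 2 * (norm v)\<^sup>2 - 2 / \<rho>\<^sup>2 * (norm (R v))\<^sup>2" for v
    proof -
      have "norm (R (R v)) \<le> \<rho> * (\<rho> * norm v)" using R\<rho>[of "R v"] R\<rho>[of v] \<rho>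
        by (meson less_imp_le mult_left_mono order_trans)
      then have "(norm (R (R v)))\<^sup>2 \<le> (\<rho>\<^sup>2 * norm v)\<^sup>2" by (intro power_mono) (auto simp: power2_eq_square mult.assoc)
      then have 1: "(norm (R (R v)))\<^sup>2 / \<rho>^4 \<le> (norm v)\<^sup>2" using \<rho>
        by (simp add: field_simps power_mult_distrib power_mult[symmetric])
      have "(norm (Q v))\<^sup>2 = (norm v)\<^sup>2 - 2 / \<rho>\<^sup>2 * inner v (R (R v)) + (norm (R (R v)))\<^sup>2 / \<rho>^4"
        by (simp only: Q_def power2_norm_eq_inner)
          (simp add: inner_simps inner_commute power2_eq_square power4_eq_xxxx algebra_simps)
      also have "inner v (R (R v)) = (norm (R v))\<^sup>2" by (simp add: R(5)[symmetric] power2_norm_eq_inner)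
      finally show ?thesis using 1 by simp
    qed
    \<comment> \<open>Inserting \<open>B5\<close> into the square of \<open>B4\<close> and
      multiplying by \<rho>^2 leaves exactly the surplus \<open>4 * e\<close>, which is distributed
      over the factor 2 in front of |Rv|^2.\<close>
    define e where "e = \<rho>\<^sup>2 * (\<rho>^4 / K\<^sup>2) / 4"
    have e: "e > 0" using \<rho> K by (simp add: e_def)
    have "(norm (R v))\<^sup>2 \<le> (\<rho>\<^sup>2 - 2 * e) * (norm v)\<^sup>2" for v
    proof -
      have "(\<rho>\<^sup>2 * norm v)\<^sup>2 \<le> (K * norm (Q v))\<^sup>2" using B4[of v] by (intro power_mono) auto
      then have "\<rho>^4 * (norm v)\<^sup>2 \<le> K\<^sup>2 * (norm (Q v))\<^sup>2"
        by (simp add: power_mult_distrib power_mult[symmetric])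
      also have "\<dots> \<le> K\<^sup>2 * (2 * (norm v)\<^sup>2 - 2 / \<rho>\<^sup>2 * (norm (R v))\<^sup>2)"
        using B5[of v] by (intro mult_left_mono) auto
      finally have "\<rho>^4 / K\<^sup>2 * (norm v)\<^sup>2 \<le> 2 * (norm v)\<^sup>2 - 2 / \<rho>\<^sup>2 * (norm (R v))\<^sup>2"
        using K by (simp add: field_simps)
      then have "\<rho>\<^sup>2 * (\<rho>^4 / K\<^sup>2 * (norm v)\<^sup>2) \<le> \<rho>\<^sup>2 * (2 * (norm v)\<^sup>2 - 2 / \<rho>\<^sup>2 * (norm (R v))\<^sup>2)"
        by (intro mult_left_mono) auto
      also have "\<dots> = 2 * \<rho>\<^sup>2 * (norm v)\<^sup>2 - 2 * (norm (R v))\<^sup>2" using \<rho> by (simp add: field_simps)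
      finally show ?thesis by (simp add: e_def algebra_simps)
    qed
    \<comment> \<open>The maximum with 0 makes the square root legitimate; the resulting operator
      bound is strictly below \<rho>.\<close>
    then have "(norm (R v))\<^sup>2 \<le> max 0 (\<rho>\<^sup>2 - 2 * e) * (norm v)\<^sup>2" for v
      by (rule order_trans) (intro mult_right_mono, auto)
    then have "norm (R v) \<le> sqrt (max 0 (\<rho>\<^sup>2 - 2 * e)) * norm v" for v
      using real_le_rsqrt[of "norm (R v)" "max 0 (\<rho>\<^sup>2 - 2 * e) * (norm v)\<^sup>2"] by (simp add: real_sqrt_mult)
    then have "\<rho> \<le> sqrt (max 0 (\<rho>\<^sup>2 - 2 * e))" unfolding \<rho>_def by (intro norm_blinfun_bound) auto
    from power_mono[OF this, of 2] have "\<rho>\<^sup>2 \<le> max 0 (\<rho>\<^sup>2 - 2 * e)" using \<rho> by simp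
    then show False using e \<rho> by (auto simp: max_def split: if_splits)
  qed
  moreover have "norm x \<le> \<rho> * norm (the (A x) - m *\<^sub>R x)"
    using R\<rho>[of "the (A x) + (- m) *\<^sub>R x"] R(4)[OF x] by simp
  ultimately have "d * norm x \<le> (\<rho> * d) * norm (the (A x) - m *\<^sub>R x)"
    using d by (simp add: mult.assoc mult.left_commute)
  also have "\<dots> \<le> 1 * norm (the (A x) - m *\<^sub>R x)" using \<open>\<rho> * d \<le> 1\<close> by (intro mult_right_mono) auto
  finally show ?thesis by simp
qed

section \<open>Vector-valued integrable functions\<close>

text \<open>This stands in for Bochner integrability, which the library only offers for second countable
  ranges; it implies Henstock-Kurzweil integrability on bounded intervals.\<close>

definition L1_approx :: "(real \<Rightarrow> 'b::real_normed_vector) \<Rightarrow> bool" where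
  "L1_approx f \<longleftrightarrow> (\<forall>\<epsilon>>0. \<exists>g h. continuous_on UNIV g \<and> h \<in> borel_measurable borel \<and> (\<forall>t. 0 \<le> h t) \<and>
     (AE t in lebesgue. norm (f t - g t) \<le> h t) \<and> (\<integral>\<^sup>+t. ennreal (h t) \<partial>lborel) < ennreal \<epsilon>)"

lemma L1_approxE:
  assumes "L1_approx f" "\<epsilon> > 0"
  obtains g h where "continuous_on UNIV g" "h \<in> borel_measurable borel" "\<And>t. 0 \<le> h t"
    "AE t in lebesgue. norm (f t - g t) \<le> h t" "(\<integral>\<^sup>+t. ennreal (h t) \<partial>lborel) < ennreal \<epsilon>"
  using assms unfolding L1_approx_def by meson

text \<open>Regularity squeezes \<open>E\<close> between a closed and an open set, and a Urysohn
  function interpolates. The error is dominated by the indicator of their difference, which is Borel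
  even though \<open>E\<close> is only Lebesgue measurable.\<close>

lemma indicator_approx_continuous:
  fixes E :: "real set"
  assumes E: "E \<in> sets lebesgue" and \<delta>: "\<delta> > 0"
  obtains g h :: "real \<Rightarrow> real" where "continuous_on UNIV g" "h \<in> borel_measurable borel" "\<And>t. 0 \<le> h t"
    "\<And>t. \<bar>indicator E t - g t\<bar> \<le> h t" "(\<integral>\<^sup>+t. ennreal (h t) \<partial>lborel) < ennreal \<delta>"
proof -
  obtain U where U: "open U" "E \<subseteq> U" "(U - E) \<in> lmeasurable" "emeasure lebesgue (U - E) < ennreal (\<delta>/2)"
    using sets_lebesgue_outer_open[OF E, of "\<delta>/2"] \<delta> by auto
  obtain T where T: "closed T" "T \<subseteq> E" "(E - T) \<in> lmeasurable" "emeasure lebesgue (E - T) < ennreal (\<delta>/2)"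
    using sets_lebesgue_inner_closed[OF E, of "\<delta>/2"] \<delta> by auto
  have "T \<inter> (- U) = {}" using U T by auto
  then obtain g :: "real \<Rightarrow> real" where g: "continuous_on UNIV g" "\<And>x. g x \<in> closed_segment 1 0"
    "\<And>x. x \<in> T \<Longrightarrow> g x = 1" "\<And>x. x \<in> - U \<Longrightarrow> g x = 0"
    using Urysohn_local[of UNIV T "- U" 1 0] U(1) T(1) by (auto simp: closed_Compl)
  have g01: "0 \<le> g t \<and> g t \<le> 1" for t using g(2)[of t] by (auto simp: closed_segment_eq_real_ivl)
  have meas: "U - T \<in> sets borel" using U T by auto
  show ?thesis
  proof (rule that[of g "indicator (U - T)"])
    show "\<bar>indicator E t - g t\<bar> \<le> indicator (U - T) t" for t
      using g(3)[of t] g(4)[of t] g01[of t] U(2) T(2) by (auto simp: indicator_def)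
    have "(\<integral>\<^sup>+t. ennreal (indicator (U - T) t) \<partial>lborel) = emeasure lborel (U - T)"
      using meas by (simp add: ennreal_indicator)
    also have "\<dots> = emeasure lebesgue (U - T)" using meas by simp
    also have "\<dots> = emeasure lebesgue ((U - E) \<union> (E - T))" using U(2) T(2) by (intro arg_cong[where f = "emeasure lebesgue"]) auto
    also have "\<dots> \<le> emeasure lebesgue (U - E) + emeasure lebesgue (E - T)"
      using U(3) T(3) by (intro emeasure_subadditive) (auto simp: fmeasurableD)
    also have "\<dots> < ennreal (\<delta>/2) + ennreal (\<delta>/2)" using U(4) T(4) by (rule add_strict_mono)
    also have "\<dots> = ennreal \<delta>" using \<delta> by (simp flip: ennreal_plus)
    finally show "(\<integral>\<^sup>+t. ennreal (indicator (U - T) t) \<partial>lborel) < ennreal \<delta>" .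
  qed (use g meas in auto)
qed

text \<open>In a nonseparable space the difference of Borel functions need not be Borel. Here it is
  handled on the finitely many pieces where \<open>r\<close> is constant.\<close>

lemma borel_measurable_norm_diff_simple:
  fixes f r :: "real \<Rightarrow> 'b::real_normed_vector"
  assumes f: "f \<in> borel_measurable M" and r: "simple_function M r"
  shows "(\<lambda>t. norm (f t - r t)) \<in> borel_measurable M"
proof -
  have "(\<lambda>t. norm (f t - x)) \<in> borel_measurable M" for x
  proof -
    have "(\<lambda>y. norm (y - x)) \<in> borel_measurable borel"
      by (intro borel_measurable_continuous_onI continuous_intros)
    from measurable_compose[OF f this] show ?thesis .
  qed
  moreover have "r \<in> measurable M (count_space (r ` space M))"
    using r measurable_simple_function[OF r] by (auto simp: measurable_count_space_eq2 simple_function_def)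
  moreover have "countable (r ` space M)" using r by (simp add: simple_function_def countable_finite)
  ultimately show ?thesis
    using measurable_compose_countable'[of "r ` space M" "\<lambda>x t. norm (f t - x)" M borel r] by simp
qed

lemma simple_function_approx_continuous:
  fixes r :: "real \<Rightarrow> 'b::real_normed_vector"
  assumes r: "simple_function lebesgue r" and \<delta>: "\<delta> > 0"
  obtains g h where "continuous_on UNIV g" "h \<in> borel_measurable borel" "\<And>t. 0 \<le> h t"
    "\<And>t. norm (r t - g t) \<le> h t" "(\<integral>\<^sup>+t. ennreal (h t) \<partial>lborel) < ennreal \<delta>"
proof -
  define X where "X = range r"
  have fin: "finite X" using r by (simp add: simple_function_def X_def)
  have sets: "r -` {x} \<in> sets lebesgue" for x
    using simple_functionD(2)[OF r, of "{x}"] by simp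
  \<comment> \<open>Each value of \<open>r\<close> receives the error \<open>\<delta> / c\<close>,
    weighted with its norm. The summand 1 keeps \<open>c\<close> positive and makes the total
    strictly smaller than \<delta>.\<close>
  define c where "c = (\<Sum>x\<in>X. norm x) + 1"
  have c: "c > 0" unfolding c_def by (intro add_nonneg_pos sum_nonneg) auto
  have "\<delta> / c > 0" using c \<delta> by simp
  then have "\<exists>g h. continuous_on UNIV g \<and> h \<in> borel_measurable borel \<and> (\<forall>t. 0 \<le> h t) \<and>
    (\<forall>t. \<bar>indicator (r -` {x}) t - g t\<bar> \<le> h t) \<and> (\<integral>\<^sup>+t. ennreal (h t) \<partial>lborel) < ennreal (\<delta> / c)" for x
    using indicator_approx_continuous[OF sets] by metis
  then obtain G H :: "'b \<Rightarrow> real \<Rightarrow> real" where GH: "\<And>x. continuous_on UNIV (G x)" "\<And>x. H x \<in> borel_measurable borel"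
    "\<And>x t. 0 \<le> H x t" "\<And>x t. \<bar>indicator (r -` {x}) t - G x t\<bar> \<le> H x t"
    "\<And>x. (\<integral>\<^sup>+t. ennreal (H x t) \<partial>lborel) < ennreal (\<delta> / c)" by metis
  note [measurable] = GH(2)
  have rs: "r t = (\<Sum>x\<in>X. indicator (r -` {x}) t *\<^sub>R x)" for t
  proof -
    have "(\<Sum>x\<in>X. indicator (r -` {x}) t *\<^sub>R x) = (\<Sum>x\<in>X. if x = r t then x else 0)"
      by (intro sum.cong) (auto simp: indicator_def)
    also have "\<dots> = r t" using fin by (simp add: X_def)
    finally show ?thesis by simp
  qed
  show ?thesis
  proof (rule that[of "\<lambda>t. \<Sum>x\<in>X. G x t *\<^sub>R x" "\<lambda>t. \<Sum>x\<in>X. H x t * norm x"])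
    show "continuous_on UNIV (\<lambda>t. \<Sum>x\<in>X. G x t *\<^sub>R x)" using GH(1) by (intro continuous_intros)
    show "0 \<le> (\<Sum>x\<in>X. H x t * norm x)" for t using GH(3) by (intro sum_nonneg mult_nonneg_nonneg) auto
    show "norm (r t - (\<Sum>x\<in>X. G x t *\<^sub>R x)) \<le> (\<Sum>x\<in>X. H x t * norm x)" for t
    proof -
      have "r t - (\<Sum>x\<in>X. G x t *\<^sub>R x) = (\<Sum>x\<in>X. (indicator (r -` {x}) t - G x t) *\<^sub>R x)"
        by (subst rs) (simp add: sum_subtractf algebra_simps)
      also have "norm \<dots> \<le> (\<Sum>x\<in>X. norm ((indicator (r -` {x}) t - G x t) *\<^sub>R x))" by (rule norm_sum)
      also have "\<dots> \<le> (\<Sum>x\<in>X. H x t * norm x)"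
        using GH(4) by (intro sum_mono) (auto intro!: mult_right_mono)
      finally show ?thesis .
    qed
    have "(\<integral>\<^sup>+t. ennreal (\<Sum>x\<in>X. H x t * norm x) \<partial>lborel) = (\<integral>\<^sup>+t. (\<Sum>x\<in>X. ennreal (H x t) * ennreal (norm x)) \<partial>lborel)"
      using GH(3) by (simp add: ennreal_mult'' flip: sum_ennreal)
    also have "\<dots> = (\<Sum>x\<in>X. (\<integral>\<^sup>+t. ennreal (H x t) \<partial>lborel) * ennreal (norm x))"
      by (subst nn_integral_sum) (auto simp: nn_integral_multc)
    also have "\<dots> \<le> (\<Sum>x\<in>X. ennreal (\<delta> / c) * ennreal (norm x))"
      using GH(5) by (intro sum_mono mult_right_mono) (auto intro: less_imp_le)
    also have "\<dots> = ennreal (\<delta> / c * (\<Sum>x\<in>X. norm x))"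
    proof -
      have "ennreal (\<delta> / c) * ennreal (norm x) = ennreal (\<delta> / c * norm x)" for x :: 'b
        using c \<delta> by (intro ennreal_mult[symmetric]) auto
      then show ?thesis using c \<delta> by (simp add: sum_distrib_left)
    qed
    also have "\<dots> < ennreal \<delta>"
      using c \<delta> by (intro ennreal_lessI) (auto simp: field_simps c_def)
    finally show "(\<integral>\<^sup>+t. ennreal (\<Sum>x\<in>X. H x t * norm x) \<partial>lborel) < ennreal \<delta>" .
  qed measurable
qed

text \<open>Measurability of limits of metric-valued functions requires convergence at every point.
  For this reason the function is replaced by 0 on the exceptional null set and outside the
  half-line.\<close>

lemma strongly_measurable_pointwise_limit:
  fixes f :: "real \<Rightarrow> 'b::real_normed_vector"
  assumes f: "strongly_measurable f"
  obtains N s where "N \<in> null_sets lebesgue" "\<And>n::nat. simple_function lebesgue (s n)"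
    "\<And>t. (\<lambda>n. s n t) \<longlonglongrightarrow> (if t > 0 \<and> t \<notin> N then f t else 0)"
proof -
  obtain s where s: "\<And>n::nat. simple_function half_line (s n)" "AE t in half_line. (\<lambda>n. s n t) \<longlonglongrightarrow> f t"
    using f by (auto simp: strongly_measurable_def)
  have "AE t in lebesgue. t \<in> {0<..} \<longrightarrow> (\<lambda>n. s n t) \<longlonglongrightarrow> f t"
    using s(2) by (subst (asm) AE_restrict_space_iff) auto
  then obtain N where N: "N \<in> null_sets lebesgue" "\<And>t. t > 0 \<Longrightarrow> t \<notin> N \<Longrightarrow> (\<lambda>n. s n t) \<longlonglongrightarrow> f t"
    unfolding completion.AE_iff_null_sets by auto
  define K where "K = {0<..} - N"
  have K: "K \<in> sets lebesgue" using N(1) by (auto simp: K_def)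
  define s' where "s' n t = (if t \<in> K then s n t else 0)" for n t
  have "simple_function lebesgue (s' n)" for n
    unfolding simple_function_def
  proof (intro conjI ballI)
    have "s' n ` space lebesgue \<subseteq> insert 0 (s n ` {0<..})" by (auto simp: s'_def K_def)
    moreover have "finite (s n ` {0<..})" using s(1)[of n] by (simp add: simple_function_def space_restrict_space)
    ultimately show "finite (s' n ` space lebesgue)" using finite_subset by blast
  next
    fix x
    have "s n -` {x} \<inter> {0<..} \<in> sets half_line"
      using simple_functionD(2)[OF s(1)[of n], of "{x}"] by (simp add: space_restrict_space)
    then have *: "s n -` {x} \<inter> {0<..} \<in> sets lebesgue" by (subst (asm) sets_restrict_space_iff) auto
    have "s' n -` {x} \<inter> space lebesgue = (s n -` {x} \<inter> {0<..}) \<inter> K \<union> (if x = 0 then - K else {})"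
      by (auto simp: s'_def K_def split: if_splits)
    then show "s' n -` {x} \<inter> space lebesgue \<in> sets lebesgue" using * K by (auto intro: Compl_in_sets_lebesgue[THEN iffD2])
  qed
  moreover have "(\<lambda>n. s' n t) \<longlonglongrightarrow> (if t > 0 \<and> t \<notin> N then f t else 0)" for t
    using N(2)[of t] by (cases "t > 0 \<and> t \<notin> N") (auto simp: s'_def K_def)
  ultimately show ?thesis using that N(1) by blast
qed

lemma strongly_measurable_norm:
  assumes "strongly_measurable f"
  shows "(\<lambda>t. indicator {0<..} t * norm (f t)) \<in> borel_measurable lebesgue"
proof -
  obtain N s where N: "N \<in> null_sets lebesgue" and s: "\<And>n::nat. simple_function lebesgue (s n)"
    "\<And>t. (\<lambda>n. s n t) \<longlonglongrightarrow> (if t > 0 \<and> t \<notin> N then f t else 0)"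
    using strongly_measurable_pointwise_limit[OF assms] by blast
  have "(\<lambda>t. norm (if t > 0 \<and> t \<notin> N then f t else 0)) \<in> borel_measurable lebesgue"
  proof (rule borel_measurable_LIMSEQ_metric)
    show "(\<lambda>t. norm (s n t)) \<in> borel_measurable lebesgue" for n
      using simple_function_compose1[OF s(1), of norm] borel_measurable_simple_function by blast
    show "(\<lambda>n. norm (s n t)) \<longlonglongrightarrow> norm (if t > 0 \<and> t \<notin> N then f t else 0)" for t
      by (rule tendsto_norm[OF s(2)])
  qed
  then show ?thesis
    by (rule borel_measurable_AE) (use AE_not_in[OF N] in \<open>auto elim!: eventually_mono\<close>)
qed

text \<open>The approximating simple functions are cut off where their norm exceeds twice that of
  the limit. Then 3|f| dominates the errors, dominated convergence gives convergence in L1, and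
  simple functions are replaced by continuous ones.\<close>

lemma strongly_measurable_L1_approx:
  fixes f :: "real \<Rightarrow> 'b::real_normed_vector"
  assumes f: "strongly_measurable f" and a: "0 < a"
    and int: "(\<integral>\<^sup>+t. ennreal (norm (f t)) * indicator {a..b} t \<partial>lebesgue) < \<infinity>"
  shows "L1_approx (\<lambda>t. indicator {a..b} t *\<^sub>R f t)"
  unfolding L1_approx_def
proof (intro allI impI)
  fix \<epsilon> :: real assume \<epsilon>: "\<epsilon> > 0"
  obtain N s where N: "N \<in> null_sets lebesgue" and s: "\<And>n::nat. simple_function lebesgue (s n)"
    "\<And>t. (\<lambda>n. s n t) \<longlonglongrightarrow> (if t > 0 \<and> t \<notin> N then f t else 0)"
    using strongly_measurable_pointwise_limit[OF f] by blast
  define f' where "f' t = indicator {a..b} t *\<^sub>R (if t > 0 \<and> t \<notin> N then f t else 0)" for t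
  define s' where "s' n t = indicator {a..b} t *\<^sub>R s n t" for n t
  have ind: "simple_function lebesgue (indicator {a..b} :: real \<Rightarrow> real)"
    by (rule simple_function_indicator) auto
  have s'1: "simple_function lebesgue (s' n)" for n
    unfolding s'_def using simple_function_compose2[OF ind s(1), of "(*\<^sub>R)"] by simp
  have s'2: "(\<lambda>n. s' n t) \<longlonglongrightarrow> f' t" for t unfolding s'_def f'_def by (intro tendsto_intros s(2))
  have f'[measurable]: "f' \<in> borel_measurable lebesgue"
    by (rule borel_measurable_LIMSEQ_metric[OF borel_measurable_simple_function[OF s'1] s'2])
  have nf': "(\<lambda>t. norm (f' t)) \<in> borel_measurable lebesgue"
    by (rule measurable_compose[OF f']) (intro borel_measurable_continuous_onI continuous_intros)
  \<comment> \<open>The factor 2 leaves room: where the limit is nonzero, the cutoff is eventually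
    inactive, and where it is zero all \<open>r n\<close> vanish.\<close>
  define r where "r n t = (if norm (s' n t) \<le> 2 * norm (f' t) then s' n t else 0)" for n t
  have r1: "simple_function lebesgue (r n)" for n
    unfolding simple_function_def
  proof (intro conjI ballI)
    have "r n ` space lebesgue \<subseteq> insert 0 (s' n ` space lebesgue)" by (auto simp: r_def)
    moreover have "finite (s' n ` space lebesgue)" using s'1[of n] by (simp add: simple_function_def)
    ultimately show "finite (r n ` space lebesgue)" using finite_subset by blast
  next
    fix x :: 'b
    let ?T = "{t. norm (s' n t) \<le> 2 * norm (f' t)}"
    have ns: "(\<lambda>t. norm (s' n t)) \<in> borel_measurable lebesgue"
      using simple_function_compose1[OF s'1, of norm] borel_measurable_simple_function by blast
    have 2: "(\<lambda>t. 2 * norm (f' t)) \<in> borel_measurable lebesgue" using nf' by simp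
    have S: "?T \<in> sets lebesgue" using borel_measurable_le[OF ns 2] by simp
    have E: "s' n -` {x} \<in> sets lebesgue" using simple_functionD(2)[OF s'1[of n], of "{x}"] by simp
    have "r n -` {x} \<inter> space lebesgue = s' n -` {x} \<inter> ?T \<union> (if x = 0 then - ?T else {})"
      by (auto simp: r_def split: if_splits)
    then show "r n -` {x} \<inter> space lebesgue \<in> sets lebesgue" using S E
      by (auto intro: Compl_in_sets_lebesgue[THEN iffD2])
  qed
  have r2: "(\<lambda>n. r n t) \<longlonglongrightarrow> f' t" for t
  proof (cases "f' t = 0")
    case True
    then have "r n t = 0" for n by (auto simp: r_def)
    then show ?thesis using True by simp
  next
    case False
    have "(\<lambda>n. norm (s' n t)) \<longlonglongrightarrow> norm (f' t)" by (rule tendsto_norm[OF s'2])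
    then have "\<forall>\<^sub>F n in sequentially. norm (s' n t) < 2 * norm (f' t)"
      by (rule order_tendstoD) (use False in simp)
    then have "\<forall>\<^sub>F n in sequentially. s' n t = r n t" by eventually_elim (simp add: r_def)
    from Lim_transform_eventually[OF s'2 this] show ?thesis .
  qed
  have meas: "(\<lambda>t. norm (f' t - r n t)) \<in> borel_measurable lebesgue" for n
    by (rule borel_measurable_norm_diff_simple[OF f' r1])
  have "(\<lambda>n. \<integral>\<^sup>+t. ennreal (norm (0 - norm (f' t - r n t))) \<partial>lebesgue) \<longlonglongrightarrow> 0"
  proof (rule nn_integral_dominated_convergence_norm[where w = "\<lambda>t. 3 * norm (f' t)"])
    have "norm (f' t - r n t) \<le> 3 * norm (f' t)" for n t
    proof -
      have "norm (r n t) \<le> 2 * norm (f' t)" unfolding r_def by (cases "norm (s' n t) \<le> 2 * norm (f' t)") auto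
      then show ?thesis using norm_triangle_ineq4[of "f' t" "r n t"] by linarith
    qed
    then show "AE t in lebesgue. norm (norm (f' t - r n t)) \<le> 3 * norm (f' t)" for n by simp
    have "(\<integral>\<^sup>+t. ennreal (3 * norm (f' t)) \<partial>lebesgue) = 3 * (\<integral>\<^sup>+t. ennreal (norm (f' t)) \<partial>lebesgue)"
      using nf' by (simp add: ennreal_mult' nn_integral_cmult)
    also have "(\<integral>\<^sup>+t. ennreal (norm (f' t)) \<partial>lebesgue) \<le> (\<integral>\<^sup>+t. ennreal (norm (f t)) * indicator {a..b} t \<partial>lebesgue)"
      by (intro nn_integral_mono) (auto simp: f'_def indicator_def)
    finally show "(\<integral>\<^sup>+t. ennreal (3 * norm (f' t)) \<partial>lebesgue) < \<infinity>"
      using int by (auto simp: ennreal_mult_less_top mult_left_mono order.strict_trans1)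
    show "AE t in lebesgue. (\<lambda>n. norm (f' t - r n t)) \<longlonglongrightarrow> 0"
    proof (intro AE_I2)
      fix t
      have "(\<lambda>n. norm (f' t - r n t)) \<longlonglongrightarrow> norm (f' t - f' t)" by (intro tendsto_intros r2)
      then show "(\<lambda>n. norm (f' t - r n t)) \<longlonglongrightarrow> 0" by simp
    qed
  qed (use meas nf' in auto)
  then have "(\<lambda>n. \<integral>\<^sup>+t. ennreal (norm (f' t - r n t)) \<partial>lebesgue) \<longlonglongrightarrow> 0" by simp
  then have "\<forall>\<^sub>F n in sequentially. (\<integral>\<^sup>+t. ennreal (norm (f' t - r n t)) \<partial>lebesgue) < ennreal (\<epsilon>/2)"
    by (rule order_tendstoD) (use \<epsilon> in simp)
  then obtain n where n: "(\<integral>\<^sup>+t. ennreal (norm (f' t - r n t)) \<partial>lebesgue) < ennreal (\<epsilon>/2)"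
    by (auto simp: eventually_sequentially)
  \<comment> \<open>The error is only Lebesgue measurable; a Borel representative is needed for the
    majorant, and the absolute value makes it nonnegative everywhere.\<close>
  obtain k0 where k0: "k0 \<in> borel_measurable lborel" "AE t in lborel. norm (f' t - r n t) = k0 t"
    using completion_ex_borel_measurable_real[OF meas[of n]] by blast
  define k where "k t = \<bar>k0 t\<bar>" for t
  have k1: "k \<in> borel_measurable borel" unfolding k_def[abs_def] using k0(1) by simp
  have k2: "AE t in lborel. norm (f' t - r n t) = k t"
    using k0(2) by eventually_elim (metis abs_norm_cancel k_def)
  have k: "k \<in> borel_measurable borel" "AE t in lborel. norm (f' t - r n t) = k t" "\<And>t. 0 \<le> k t"
    using k1 k2 by (simp_all add: k_def)
  have k': "AE t in lebesgue. norm (f' t - r n t) = k t" using k(2) by (rule AE_completion)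
  have "(\<integral>\<^sup>+t. ennreal (k t) \<partial>lborel) = (\<integral>\<^sup>+t. ennreal (norm (f' t - r n t)) \<partial>lborel)"
    by (rule nn_integral_cong_AE) (use k(2) in \<open>auto elim!: eventually_mono\<close>)
  also have "\<dots> = (\<integral>\<^sup>+t. ennreal (norm (f' t - r n t)) \<partial>lebesgue)" by (simp add: nn_integral_completion)
  finally have kint: "(\<integral>\<^sup>+t. ennreal (k t) \<partial>lborel) < ennreal (\<epsilon>/2)" using n by simp
  obtain g h where gh: "continuous_on UNIV g" "h \<in> borel_measurable borel" "\<And>t. 0 \<le> h t"
    "\<And>t. norm (r n t - g t) \<le> h t" "(\<integral>\<^sup>+t. ennreal (h t) \<partial>lborel) < ennreal (\<epsilon>/2)"
    using simple_function_approx_continuous[OF r1[of n], of "\<epsilon>/2"] \<epsilon> by auto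
  note [measurable] = k(1) gh(2)
  show "\<exists>g h. continuous_on UNIV g \<and> h \<in> borel_measurable borel \<and> (\<forall>t. 0 \<le> h t) \<and>
     (AE t in lebesgue. norm (indicator {a..b} t *\<^sub>R f t - g t) \<le> h t) \<and> (\<integral>\<^sup>+t. ennreal (h t) \<partial>lborel) < ennreal \<epsilon>"
  proof (intro exI[of _ g] exI[of _ "\<lambda>t. k t + h t"] conjI allI)
    show "AE t in lebesgue. norm (indicator {a..b} t *\<^sub>R f t - g t) \<le> k t + h t"
      using AE_not_in[OF N] k'
    proof eventually_elim
      case (elim t)
      have "indicator {a..b} t *\<^sub>R f t = f' t" using elim(1) a by (auto simp: f'_def indicator_def)
      moreover have "norm (f' t - g t) \<le> norm (f' t - r n t) + norm (r n t - g t)"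
        by (metis norm_triangle_ineq diff_add_cancel add_diff_eq)
      ultimately show ?case using gh(4)[of t] elim(2) by simp
    qed
    have "(\<integral>\<^sup>+t. ennreal (k t + h t) \<partial>lborel) = (\<integral>\<^sup>+t. ennreal (k t) \<partial>lborel) + (\<integral>\<^sup>+t. ennreal (h t) \<partial>lborel)"
      using k(3) gh(3) by (simp add: nn_integral_add)
    also have "\<dots> < ennreal (\<epsilon>/2) + ennreal (\<epsilon>/2)" by (rule add_strict_mono[OF kint gh(5)])
    also have "\<dots> = ennreal \<epsilon>" using \<epsilon> by (simp flip: ennreal_plus)
    finally show "(\<integral>\<^sup>+t. ennreal (k t + h t) \<partial>lborel) < ennreal \<epsilon>" .
  qed (use k(3) gh in \<open>auto intro: add_nonneg_nonneg\<close>)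
qed

lemma L1_approx_scale:
  fixes f :: "real \<Rightarrow> 'b::real_normed_vector" and \<theta> :: "real \<Rightarrow> real"
  assumes f: "L1_approx f" and \<theta>: "continuous_on UNIV \<theta>" "\<And>t. \<bar>\<theta> t\<bar> \<le> M"
  shows "L1_approx (\<lambda>t. \<theta> t *\<^sub>R f t)"
  unfolding L1_approx_def
proof (intro allI impI)
  fix \<epsilon> :: real assume \<epsilon>: "\<epsilon> > 0"
  have M: "M \<ge> 0" using \<theta>(2)[of 0] by linarith
  have "\<epsilon> / (M + 1) > 0" using M \<epsilon> by simp
  then obtain g h where gh: "continuous_on UNIV g" "h \<in> borel_measurable borel" "\<And>t. 0 \<le> h t"
    "AE t in lebesgue. norm (f t - g t) \<le> h t" "(\<integral>\<^sup>+t. ennreal (h t) \<partial>lborel) < ennreal (\<epsilon> / (M + 1))"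
    using L1_approxE[OF f] by blast
  note [measurable] = gh(2)
  show "\<exists>g h. continuous_on UNIV g \<and> h \<in> borel_measurable borel \<and> (\<forall>t. 0 \<le> h t) \<and>
     (AE t in lebesgue. norm (\<theta> t *\<^sub>R f t - g t) \<le> h t) \<and> (\<integral>\<^sup>+t. ennreal (h t) \<partial>lborel) < ennreal \<epsilon>"
  proof (intro exI[of _ "\<lambda>t. \<theta> t *\<^sub>R g t"] exI[of _ "\<lambda>t. (M + 1) * h t"] conjI allI)
    show "continuous_on UNIV (\<lambda>t. \<theta> t *\<^sub>R g t)" using \<theta>(1) gh(1) by (intro continuous_intros)
    show "AE t in lebesgue. norm (\<theta> t *\<^sub>R f t - \<theta> t *\<^sub>R g t) \<le> (M + 1) * h t"
      using gh(4)
    proof eventually_elim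
      case (elim t)
      have "norm (\<theta> t *\<^sub>R f t - \<theta> t *\<^sub>R g t) = \<bar>\<theta> t\<bar> * norm (f t - g t)" by (simp flip: scaleR_diff_right)
      also have "\<dots> \<le> (M + 1) * h t" using \<theta>(2)[of t] elim M by (intro mult_mono) auto
      finally show ?case .
    qed
    have "(\<integral>\<^sup>+t. ennreal ((M + 1) * h t) \<partial>lborel) = ennreal (M + 1) * (\<integral>\<^sup>+t. ennreal (h t) \<partial>lborel)"
      using M gh(3) by (simp add: ennreal_mult nn_integral_cmult)
    also have "\<dots> < ennreal (M + 1) * ennreal (\<epsilon> / (M + 1))"
      using gh(5) M by (intro ennreal_mult_strict_left_mono) (auto simp: add_nonneg_pos simp del: ennreal_plus)
    also have "\<dots> = ennreal \<epsilon>" using M \<epsilon> by (simp flip: ennreal_mult del: ennreal_plus)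
    finally show "(\<integral>\<^sup>+t. ennreal ((M + 1) * h t) \<partial>lborel) < ennreal \<epsilon>" .
  qed (use M gh in auto)
qed

text \<open>Cauchy criterion for gauge integrals: Riemann sums of \<open>f\<close> differ from those
  of the continuous \<open>g\<close> by at most a Riemann sum of the majorant, which is below e/3
  for fine divisions. Together with e/6 for \<open>g\<close> this is e/2 for each of two
  divisions.\<close>

lemma L1_approx_integrable:
  fixes f :: "real \<Rightarrow> 'b::banach"
  assumes f: "L1_approx f"
  shows "f integrable_on {a..b}"
proof -
  have "f integrable_on cbox a b"
    unfolding integrable_Cauchy
  proof (intro allI impI)
    fix e :: real assume e: "e > 0"
    obtain g h where gh: "continuous_on UNIV g" "h \<in> borel_measurable borel" "\<And>t. 0 \<le> h t"
      "AE t in lebesgue. norm (f t - g t) \<le> h t" "(\<integral>\<^sup>+t. ennreal (h t) \<partial>lborel) < ennreal (e/6)"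
      using L1_approxE[OF f, of "e/6"] e by auto
    obtain N where N: "N \<in> null_sets lebesgue" "\<And>t. t \<notin> N \<Longrightarrow> norm (f t - g t) \<le> h t"
      using gh(4) unfolding completion.AE_iff_null_sets by auto
    have h1: "h integrable_on UNIV" using nn_integral_integrable_on[OF gh(2,3)] gh(5)
      by (metis ennreal_less_top infinity_ennreal_def less_trans)
    have "ennreal (integral UNIV h) < ennreal (e/6)"
      using nn_integral_lborel_eq_integral[OF gh(2,3)] gh(5) by (metis ennreal_less_top infinity_ennreal_def less_trans)
    then have h2: "integral UNIV h < e/6"
      by (simp add: ennreal_less_iff[OF integral_nonneg[OF h1]] gh(3))
    \<comment> \<open>Riemann sums also see tags in the null set where the majorant fails, so it is
      raised there. A change on a null set does not affect its integral.\<close>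
    define h' where "h' t = (if t \<in> N then norm (f t - g t) else h t)" for t
    have h'f: "norm (f t - g t) \<le> h' t" for t using N(2) by (simp add: h'_def)
    have "h integrable_on cbox a b" using h1 integrable_on_subcbox by blast
    moreover have "integral (cbox a b) h \<le> integral UNIV h"
      using calculation h1 gh(3) by (intro integral_subset_le) auto
    moreover have "negligible N" using N(1) by (simp add: negligible_iff_null_sets)
    ultimately obtain I where I: "(h' has_integral I) (cbox a b)" "I < e/6"
    proof -
      assume *: "\<And>I. (h' has_integral I) (cbox a b) \<Longrightarrow> I < e/6 \<Longrightarrow> thesis"
        and h: "h integrable_on cbox a b" "integral (cbox a b) h \<le> integral UNIV h" and N: "negligible N"
      have "(h' has_integral integral (cbox a b) h) (cbox a b)"
        by (rule has_integral_spike[OF N _ integrable_integral[OF h(1)]]) (auto simp: h'_def)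
      then show thesis using * h(2) h2 by simp
    qed
    obtain J where J: "(g has_integral J) (cbox a b)"
      using integrable_continuous[OF continuous_on_subset[OF gh(1)], of a b] by auto
    have e6: "e/6 > 0" using e by simp
    obtain \<gamma>1 where \<gamma>1: "gauge \<gamma>1" "\<And>\<D>. \<D> tagged_division_of cbox a b \<Longrightarrow> \<gamma>1 fine \<D> \<Longrightarrow>
        norm ((\<Sum>(x,K)\<in>\<D>. measure lborel K *\<^sub>R h' x) - I) < e/6"
      using has_integralD[OF I(1) e6] by blast
    obtain \<gamma>2 where \<gamma>2: "gauge \<gamma>2" "\<And>\<D>. \<D> tagged_division_of cbox a b \<Longrightarrow> \<gamma>2 fine \<D> \<Longrightarrow>
        norm ((\<Sum>(x,K)\<in>\<D>. measure lborel K *\<^sub>R g x) - J) < e/6"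
      using has_integralD[OF J e6] by blast
    have key: "norm ((\<Sum>(x,K)\<in>\<D>. measure lborel K *\<^sub>R f x) - J) < e/2"
      if D: "\<D> tagged_division_of cbox a b" "\<gamma>1 fine \<D>" "\<gamma>2 fine \<D>" for \<D>
    proof -
      have "(\<Sum>(x,K)\<in>\<D>. measure lborel K *\<^sub>R f x) - (\<Sum>(x,K)\<in>\<D>. measure lborel K *\<^sub>R g x)
          = (\<Sum>(x,K)\<in>\<D>. measure lborel K *\<^sub>R (f x - g x))"
        by (simp add: case_prod_unfold scaleR_diff_right sum_subtractf)
      also have "norm \<dots> \<le> (\<Sum>(x,K)\<in>\<D>. measure lborel K *\<^sub>R h' x)"
        by (rule sum_norm_le) (auto intro!: mult_left_mono h'f)
      also have "\<dots> < e/6 + e/6"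
        using \<gamma>1(2)[OF D(1,2)] I(2) unfolding real_norm_def by linarith
      finally have "norm ((\<Sum>(x,K)\<in>\<D>. measure lborel K *\<^sub>R f x) - (\<Sum>(x,K)\<in>\<D>. measure lborel K *\<^sub>R g x)) < e/6 + e/6" .
      then show ?thesis using \<gamma>2(2)[OF D(1,3)]
        norm_triangle_ineq[of "(\<Sum>(x,K)\<in>\<D>. measure lborel K *\<^sub>R f x) - (\<Sum>(x,K)\<in>\<D>. measure lborel K *\<^sub>R g x)"
          "(\<Sum>(x,K)\<in>\<D>. measure lborel K *\<^sub>R g x) - J"] by simp
    qed
    show "\<exists>\<gamma>. gauge \<gamma> \<and> (\<forall>\<D>1 \<D>2. \<D>1 tagged_division_of cbox a b \<and> \<gamma> fine \<D>1 \<and>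
        \<D>2 tagged_division_of cbox a b \<and> \<gamma> fine \<D>2 \<longrightarrow>
        norm ((\<Sum>(x,K)\<in>\<D>1. measure lborel K *\<^sub>R f x) - (\<Sum>(x,K)\<in>\<D>2. measure lborel K *\<^sub>R f x)) < e)"
    proof (intro exI[of _ "\<lambda>x. \<gamma>1 x \<inter> \<gamma>2 x"] conjI allI impI)
      show "gauge (\<lambda>x. \<gamma>1 x \<inter> \<gamma>2 x)" by (rule gauge_Int[OF \<gamma>1(1) \<gamma>2(1)])
    next
      fix \<D>1 \<D>2
      assume "\<D>1 tagged_division_of cbox a b \<and> (\<lambda>x. \<gamma>1 x \<inter> \<gamma>2 x) fine \<D>1 \<and>
        \<D>2 tagged_division_of cbox a b \<and> (\<lambda>x. \<gamma>1 x \<inter> \<gamma>2 x) fine \<D>2"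
      then have "norm ((\<Sum>(x,K)\<in>\<D>1. measure lborel K *\<^sub>R f x) - J) < e/2" "norm ((\<Sum>(x,K)\<in>\<D>2. measure lborel K *\<^sub>R f x) - J) < e/2"
        using key by (auto simp: fine_Int)
      then show "norm ((\<Sum>(x,K)\<in>\<D>1. measure lborel K *\<^sub>R f x) - (\<Sum>(x,K)\<in>\<D>2. measure lborel K *\<^sub>R f x)) < e"
        using norm_triangle_ineq4[of "(\<Sum>(x,K)\<in>\<D>1. measure lborel K *\<^sub>R f x) - J" "(\<Sum>(x,K)\<in>\<D>2. measure lborel K *\<^sub>R f x) - J"] by simp
    qed
  qed
  then show ?thesis by simp
qed

section \<open>A smooth bump function\<close>

text \<open>The polynomial and the exponent are carried along because this family is closed under
  differentiation; smoothness of the standard bump, \<open>p = 1\<close> and \<open>m = 0\<close>,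
  is then an induction.\<close>

definition bump_fun :: "real poly \<Rightarrow> nat \<Rightarrow> real \<Rightarrow> real" where
  "bump_fun p m x = (if 0 < x \<and> x < 1 then poly p x / (x * (1 - x)) ^ m * exp (- 1 / (x * (1 - x))) else 0)"

text \<open>A single term of the exponential series, of order \<open>m + 2\<close>, is enough. The
  two powers beyond \<open>m\<close> leave the factor w^2, which forces derivative zero at the ends
  of the support.\<close>

lemma exp_neg_inverse_bound:
  fixes w :: real assumes w: "w > 0"
  shows "exp (- 1 / w) / w ^ m \<le> fact (m + 2) * w\<^sup>2"
proof -
  define F :: real where "F = fact (m + 2)"
  define E where "E = exp (1 / w)"
  define v where "v = w ^ (m + 2)"
  have pos: "F > 0" "E > 0" "v > 0" using w by (simp_all add: F_def E_def v_def)
  have "(\<Sum>k\<in>{m+2}. (1 / w) ^ k /\<^sub>R fact k) \<le> exp (1 / w)"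
    unfolding exp_def using w by (intro sum_le_suminf summable_exp_generic) auto
  then have "1 / v / F \<le> E"
    by (simp add: F_def E_def v_def power_inverse divide_inverse mult.commute del: fact_Suc power_Suc)
  then have "1 / E \<le> F * v" using pos by (simp add: field_simps)
  then have "exp (- 1 / w) \<le> F * v" by (simp add: E_def exp_minus divide_inverse)
  then have "exp (- 1 / w) / w ^ m \<le> F * v / w ^ m" using w by (intro divide_right_mono) auto
  also have "\<dots> = F * w\<^sup>2" using w by (simp add: v_def power_add power2_eq_square)
  finally show ?thesis by (simp add: F_def)
qed

lemma bump_fun_bound: "\<exists>C\<ge>0. \<forall>x. \<bar>bump_fun p m x\<bar> \<le> C * (x * (1 - x))\<^sup>2"
proof -
  have "bounded (poly p ` {0..1})"
    by (intro compact_imp_bounded compact_continuous_image continuous_intros) auto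
  then obtain C where "\<forall>y\<in>poly p ` {0..1}. norm y \<le> C" using bounded_iff by blast
  then have C: "\<And>x. x \<in> {0..1} \<Longrightarrow> \<bar>poly p x\<bar> \<le> C" by auto
  have C0: "C \<ge> 0" using C[of 0] by simp
  have "\<bar>bump_fun p m x\<bar> \<le> C * fact (m + 2) * (x * (1 - x))\<^sup>2" for x
  proof (cases "0 < x \<and> x < 1")
    case True
    then have w: "x * (1 - x) > 0" by simp
    have "\<bar>bump_fun p m x\<bar> = \<bar>poly p x\<bar> * (exp (- 1 / (x * (1 - x))) / (x * (1 - x)) ^ m)"
      using True w by (simp add: bump_fun_def abs_mult)
    also have "\<dots> \<le> C * (fact (m + 2) * (x * (1 - x))\<^sup>2)"
      using True w C[of x] by (intro mult_mono exp_neg_inverse_bound) auto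
    finally show ?thesis by (simp add: mult.assoc)
  next
    case False
    then have "bump_fun p m x = 0" by (auto simp: bump_fun_def)
    then show ?thesis using C0 by simp
  qed
  then show ?thesis using C0 by (intro exI[of _ "C * fact (m + 2)"]) auto
qed

text \<open>The numerator of the derivative over the denominator of exponent \<open>m + 2\<close>:
  \<open>[:0, 1, -1:]\<close> is x(1 - x) and \<open>[:1, -2:]\<close> is its derivative.\<close>

definition bump_deriv_poly :: "real poly \<Rightarrow> nat \<Rightarrow> real poly" where
  "bump_deriv_poly p m = pderiv p * [:0, 1, -1:]\<^sup>2 - of_nat m * p * [:1, -2:] * [:0, 1, -1:] + p * [:1, -2:]"

lemma bump_fun_has_derivative:
  "(bump_fun p m has_real_derivative bump_fun (bump_deriv_poly p m) (m + 2) x) (at x)"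
proof -
  consider "0 < x \<and> x < 1" | "x < 0 \<or> x > 1" | "x = 0 \<or> x = 1" by linarith
  then show ?thesis
  proof cases
    case 1
    define w where "w = x * (1 - x)"
    have w: "w > 0" using 1 by (simp add: w_def)
    let ?f = "\<lambda>x. poly p x / (x * (1 - x)) ^ m * exp (- 1 / (x * (1 - x)))"
    have wne: "x * (1 - x) \<noteq> 0" "(x * (1 - x)) ^ m \<noteq> 0" using 1 by auto
    have d1: "((\<lambda>x. x * (1 - x)) has_real_derivative (1 - 2 * x)) (at x)"
      by (auto intro!: derivative_eq_intros)
    have d2: "((\<lambda>x. (x * (1 - x)) ^ m) has_real_derivative (of_nat m * (1 - 2 * x) * w ^ (m - 1))) (at x)"
      using DERIV_power[OF d1, of m] by (simp add: w_def mult_ac)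
    have d3: "((\<lambda>x. exp (- 1 / (x * (1 - x)))) has_real_derivative (exp (- 1 / w) * ((1 - 2 * x) / w\<^sup>2))) (at x)"
      using DERIV_fun_exp[OF DERIV_divide[OF DERIV_const d1 wne(1), of "- 1"]]
      by (simp add: w_def power2_eq_square)
    have d4: "(?f has_real_derivative
        ((poly (pderiv p) x * w ^ m - poly p x * (of_nat m * (1 - 2 * x) * w ^ (m - 1))) / (w ^ m * w ^ m)) * exp (- 1 / w)
        + (exp (- 1 / w) * ((1 - 2 * x) / w\<^sup>2)) * (poly p x / w ^ m)) (at x)"
      using DERIV_mult[OF DERIV_divide[OF poly_DERIV d2 wne(2)] d3] by (simp add: w_def)
    have "((poly (pderiv p) x * w ^ m - poly p x * (of_nat m * (1 - 2 * x) * w ^ (m - 1))) / (w ^ m * w ^ m)) * exp (- 1 / w)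
        + (exp (- 1 / w) * ((1 - 2 * x) / w\<^sup>2)) * (poly p x / w ^ m)
        = (poly (pderiv p) x * w\<^sup>2 - of_nat m * poly p x * (1 - 2 * x) * w + poly p x * (1 - 2 * x)) / w ^ (m + 2) * exp (- 1 / w)"
      using w by (cases m) (simp_all add: field_simps power2_eq_square power_add)
    also have "\<dots> = bump_fun (bump_deriv_poly p m) (m + 2) x"
      using 1 by (simp add: bump_fun_def bump_deriv_poly_def w_def algebra_simps power2_eq_square)
    finally have "(?f has_real_derivative bump_fun (bump_deriv_poly p m) (m + 2) x) (at x)" using d4 by simp
    then show ?thesis
      by (rule has_field_derivative_transform_within_open[of _ _ _ "{0<..<1}"]) (use 1 in \<open>auto simp: bump_fun_def\<close>)
  next
    case 2
    have "((\<lambda>_. 0) has_real_derivative 0) (at x)" by simp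
    then have "(bump_fun p m has_real_derivative 0) (at x)"
      by (rule has_field_derivative_transform_within_open[of _ _ _ "- {0..1}"]) (use 2 in \<open>auto simp: bump_fun_def\<close>)
    moreover have "bump_fun (bump_deriv_poly p m) (m + 2) x = 0" using 2 by (auto simp: bump_fun_def)
    ultimately show ?thesis by simp
  next
    case 3
    \<comment> \<open>At the two endpoints the difference quotient is squeezed to zero by the
      quadratic bound.\<close>
    obtain C where C: "C \<ge> 0" "\<And>x. \<bar>bump_fun p m x\<bar> \<le> C * (x * (1 - x))\<^sup>2" using bump_fun_bound by blast
    have fx: "bump_fun p m x = 0" using 3 by (auto simp: bump_fun_def)
    have "((\<lambda>y. (bump_fun p m y - bump_fun p m x) / (y - x)) \<longlongrightarrow> 0) (at x)"
    proof (rule Lim_null_comparison)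
      show "\<forall>\<^sub>F y in at x. norm ((bump_fun p m y - bump_fun p m x) / (y - x)) \<le> C * (y * (1 - y))\<^sup>2 / \<bar>y - x\<bar>"
        using C(2) by (auto simp: fx intro!: always_eventually divide_right_mono)
      have "((\<lambda>y. C * \<bar>y - x\<bar> * (if x = 0 then 1 - y else y)\<^sup>2) \<longlongrightarrow> C * \<bar>x - x\<bar> * (if x = 0 then 1 - x else x)\<^sup>2) (at x)"
        by (cases "x = 0") (auto intro!: tendsto_eq_intros)
      then have "((\<lambda>y. C * \<bar>y - x\<bar> * (if x = 0 then 1 - y else y)\<^sup>2) \<longlongrightarrow> 0) (at x)" by simp
      moreover have "\<forall>\<^sub>F y in at x. C * \<bar>y - x\<bar> * (if x = 0 then 1 - y else y)\<^sup>2 = C * (y * (1 - y))\<^sup>2 / \<bar>y - x\<bar>"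
        unfolding eventually_at_filter
      proof (intro always_eventually allI impI)
        fix y assume y: "y \<noteq> x"
        have "(y - x)\<^sup>2 = \<bar>y - x\<bar> * \<bar>y - x\<bar>" by (simp add: power2_eq_square)
        moreover have "(y * (1 - y))\<^sup>2 = (y - x)\<^sup>2 * (if x = 0 then 1 - y else y)\<^sup>2"
          using 3 by (auto simp: power_mult_distrib power2_commute)
        ultimately show "C * \<bar>y - x\<bar> * (if x = 0 then 1 - y else y)\<^sup>2 = C * (y * (1 - y))\<^sup>2 / \<bar>y - x\<bar>"
          using y by (simp add: field_simps)
      qed
      ultimately show "((\<lambda>y. C * (y * (1 - y))\<^sup>2 / \<bar>y - x\<bar>) \<longlongrightarrow> 0) (at x)"
        using tendsto_cong by fast
    qed
    then have "(bump_fun p m has_real_derivative 0) (at x)" by (simp add: has_field_derivative_iff)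
    moreover have "bump_fun (bump_deriv_poly p m) (m + 2) x = 0" using 3 by (auto simp: bump_fun_def)
    ultimately show ?thesis by simp
  qed
qed

lemma higher_deriv_bump_fun: "\<exists>q k. (deriv ^^ n) (bump_fun p m) = bump_fun q k"
proof (induction n)
  case (Suc n)
  then obtain q k where "(deriv ^^ n) (bump_fun p m) = bump_fun q k" by blast
  moreover have "deriv (bump_fun q k) = bump_fun (bump_deriv_poly q k) (k + 2)"
    using bump_fun_has_derivative DERIV_imp_deriv by blast
  ultimately show ?case by auto
qed auto

lemma bump_fun_differentiable: "bump_fun p m differentiable (at x)"
  using bump_fun_has_derivative by (auto simp: real_differentiable_def)

text \<open>The test functions inserted into the definition of weak derivatives are reflected and
  rescaled copies of a fixed bump.\<close>

lemma higher_deriv_affine: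
  fixes f :: "real \<Rightarrow> real"
  assumes "\<And>n x. (deriv ^^ n) f differentiable (at x)"
  shows "(deriv ^^ n) (\<lambda>s. f (c * s + d)) = (\<lambda>s. c ^ n * (deriv ^^ n) f (c * s + d))"
proof (induction n)
  case (Suc n)
  have "((\<lambda>s. c ^ n * (deriv ^^ n) f (c * s + d)) has_real_derivative c ^ Suc n * (deriv ^^ Suc n) f (c * s + d)) (at s)" for s
  proof -
    have "((deriv ^^ n) f has_real_derivative (deriv ^^ Suc n) f (c * s + d)) (at (c * s + d))"
      using assms[of n "c * s + d"] by (auto simp: real_differentiable_def DERIV_imp_deriv)
    then have "((\<lambda>s. (deriv ^^ n) f (c * s + d)) has_real_derivative (deriv ^^ Suc n) f (c * s + d) * c) (at s)"
      by (rule DERIV_chain2) (auto intro!: derivative_eq_intros)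
    from DERIV_cmult[OF this, of "c ^ n"] show ?thesis by (simp add: mult_ac)
  qed
  then show ?case using Suc by (auto intro!: ext DERIV_imp_deriv)
qed simp

text \<open>Four derivatives are recorded because the second derivative of a mollified function has
  to be continuous: this is obtained by differentiating the convolution with the second derivative
  of the kernel, and the quadratic remainder estimate used there costs two further
  derivatives.\<close>

lemma unit_bump_exists:
  obtains \<beta> \<beta>1 \<beta>2 \<beta>3 \<beta>4 :: "real \<Rightarrow> real" where
    "\<And>n x. (deriv ^^ n) \<beta> differentiable (at x)"
    "\<And>x. (\<beta> has_real_derivative \<beta>1 x) (at x)" "\<And>x. (\<beta>1 has_real_derivative \<beta>2 x) (at x)"
    "\<And>x. (\<beta>2 has_real_derivative \<beta>3 x) (at x)" "\<And>x. (\<beta>3 has_real_derivative \<beta>4 x) (at x)"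
    "continuous_on UNIV \<beta>4"
    "\<And>x. 0 \<le> \<beta> x" "\<And>x. x \<notin> {0<..<1} \<Longrightarrow> \<beta> x = 0 \<and> \<beta>1 x = 0 \<and> \<beta>2 x = 0 \<and> \<beta>3 x = 0 \<and> \<beta>4 x = 0"
    "(\<beta> has_integral 1) {0..1}"
proof -
  define f where "f = bump_fun 1 0"
  have cont: "continuous_on S (bump_fun p m)" for p m S
    by (rule DERIV_continuous_on[OF has_field_derivative_at_within[OF bump_fun_has_derivative]])
  have f0: "0 \<le> f x" for x by (simp add: f_def bump_fun_def)
  define I where "I = integral {0..1} f"
  have int: "f integrable_on {0..1}" unfolding f_def by (rule integrable_continuous_interval[OF cont])
  have "integral {0..1} f \<noteq> 0"
  proof
    assume "integral {0..1} f = 0"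
    then have "(f has_integral 0) (cbox 0 1)" using int by (metis integrable_integral box_real(2))
    moreover have "continuous_on (cbox 0 1) f" unfolding f_def by (rule cont)
    ultimately have "f (1/2) = 0" using f0 by (intro has_integral_0_cbox_imp_0[of 0 1 f]) auto
    then show False by (simp add: f_def bump_fun_def)
  qed
  moreover have "I \<ge> 0" unfolding I_def using int f0 by (intro integral_nonneg) auto
  ultimately have I: "I > 0" by (simp add: I_def)
  define \<beta> where "\<beta> = bump_fun [:1/I:] 0"
  have \<beta>f: "\<beta> x = f x / I" for x by (simp add: \<beta>_def f_def bump_fun_def)
  show ?thesis
  proof (rule that[OF _ bump_fun_has_derivative bump_fun_has_derivative bump_fun_has_derivative
        bump_fun_has_derivative cont, of "[:1/I:]" 0])
    show "(deriv ^^ n) (bump_fun [:1/I:] 0) differentiable (at x)" for n x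
      using higher_deriv_bump_fun[of n "[:1/I:]" 0] bump_fun_differentiable by auto
    show "0 \<le> bump_fun [:1/I:] 0 x" for x using f0[of x] I \<beta>f[of x] by (simp add: \<beta>_def)
    have "(f has_integral I) {0..1}" using int by (simp add: I_def integrable_integral)
    from has_integral_mult_right[OF this, of "1/I"] I
    have "((\<lambda>x. f x / I) has_integral 1) {0..1}" by simp
    then show "(bump_fun [:1/I:] 0 has_integral 1) {0..1}" using \<beta>f by (simp add: \<beta>_def cong: has_integral_cong)
  qed (auto simp: bump_fun_def)
qed

section \<open>Mollification\<close>

text \<open>Bridge from vector-valued gauge integrals to nonnegative Lebesgue integrals, where
  Tonelli and Cauchy-Schwarz can be applied.\<close>

lemma norm_integral_le_nn_integral:
  fixes u :: "real \<Rightarrow> 'b::banach"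
  assumes u: "u integrable_on {a..b}" and v: "v \<in> borel_measurable borel" "\<And>s. 0 \<le> v s"
    and le: "AE s in lebesgue. s \<in> {a..b} \<longrightarrow> norm (u s) \<le> v s"
  shows "ennreal (norm (integral {a..b} u)) \<le> (\<integral>\<^sup>+s. ennreal (v s) * indicator {a..b} s \<partial>lborel)"
proof (cases "(\<integral>\<^sup>+s. ennreal (v s) * indicator {a..b} s \<partial>lborel) = \<infinity>")
  case False
  define w where "w s = v s * indicator {a..b} s" for s
  note [measurable] = v(1)
  have w: "w \<in> borel_measurable borel" "\<And>s. 0 \<le> w s"
    unfolding w_def[abs_def] using v(2) by (measurable, simp)
  have eq: "(\<integral>\<^sup>+s. ennreal (v s) * indicator {a..b} s \<partial>lborel) = (\<integral>\<^sup>+s. ennreal (w s) \<partial>lborel)"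
    by (intro nn_integral_cong) (auto simp: w_def indicator_def)
  have fin: "(\<integral>\<^sup>+s. ennreal (w s) \<partial>lborel) < \<infinity>" using False eq by (simp add: less_top)
  have wint: "w integrable_on UNIV" by (rule nn_integral_integrable_on[OF w fin])
  obtain N where N: "N \<in> null_sets lebesgue" "\<And>s. s \<notin> N \<Longrightarrow> s \<in> {a..b} \<Longrightarrow> norm (u s) \<le> v s"
    using le unfolding completion.AE_iff_null_sets by auto
  have neg: "negligible N" using N(1) by (simp add: negligible_iff_null_sets)
  define w' where "w' s = (if s \<in> N then norm (u s) else w s)" for s
  have 1: "w integrable_on {a..b}" using wint integrable_on_subcbox[of w UNIV a b] by simp
  have 2: "(w' has_integral integral {a..b} w) {a..b}"
    by (rule has_integral_spike[OF neg _ integrable_integral[OF 1]]) (auto simp: w'_def)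
  have "norm (integral {a..b} u) \<le> integral {a..b} w'"
    using 2 N(2) by (intro integral_norm_bound_integral[OF u]) (auto simp: w'_def w_def)
  also have "\<dots> = integral {a..b} w" using 2 by (rule integral_unique)
  also have "\<dots> \<le> integral UNIV w" using w(2) by (intro integral_subset_le 1 wint) auto
  finally show ?thesis
    using nn_integral_lborel_eq_integral[OF w fin] by (simp add: eq ennreal_leI)
qed simp

text \<open>A convolution truncated to \<open>{a..b}\<close>, so that only local integrability of
  \<open>f\<close> matters. For a kernel supported in [0, 1/n] the truncation is invisible at times
  t with a + 1/n \<le> t \<le> b.\<close>

definition conv :: "real \<Rightarrow> real \<Rightarrow> (real \<Rightarrow> real) \<Rightarrow> (real \<Rightarrow> 'b::real_normed_vector) \<Rightarrow> real \<Rightarrow> 'b" where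
  "conv a b \<theta> f t = integral {a..b} (\<lambda>s. \<theta> (t - s) *\<^sub>R f s)"

lemma conv_integrable:
  fixes f :: "real \<Rightarrow> 'b::banach"
  assumes f: "L1_approx (\<lambda>t. indicator {a..b} t *\<^sub>R f t)"
    and \<theta>: "continuous_on UNIV \<theta>" "\<And>x. \<bar>\<theta> x\<bar> \<le> M"
  shows "(\<lambda>s. \<theta> (t - s) *\<^sub>R f s) integrable_on {a..b}"
proof -
  have "continuous_on UNIV (\<lambda>s. \<theta> (t - s))"
    by (intro continuous_on_compose2[OF \<theta>(1)] continuous_intros) auto
  then have "L1_approx (\<lambda>s. \<theta> (t - s) *\<^sub>R (indicator {a..b} s *\<^sub>R f s))"
    using \<theta>(2) by (intro L1_approx_scale[OF f]) auto
  then have "(\<lambda>s. \<theta> (t - s) *\<^sub>R (indicator {a..b} s *\<^sub>R f s)) integrable_on {a..b}"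
    by (rule L1_approx_integrable)
  then show ?thesis by (rule integrable_eq) auto
qed

lemma conv_bounded_linear:
  fixes f :: "real \<Rightarrow> 'b::banach" and T :: "'b \<Rightarrow> 'c::banach"
  assumes f: "L1_approx (\<lambda>t. indicator {a..b} t *\<^sub>R f t)"
    and \<theta>: "continuous_on UNIV \<theta>" "\<And>x. \<bar>\<theta> x\<bar> \<le> M" and T: "bounded_linear T"
  shows "T (conv a b \<theta> f t) = conv a b \<theta> (\<lambda>s. T (f s)) t"
    and "(\<lambda>s. \<theta> (t - s) *\<^sub>R T (f s)) integrable_on {a..b}"
proof -
  have 1: "T \<circ> (\<lambda>s. \<theta> (t - s) *\<^sub>R f s) = (\<lambda>s. \<theta> (t - s) *\<^sub>R T (f s))"
    by (simp add: fun_eq_iff linear_scale[OF bounded_linear.linear[OF T]])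
  show "T (conv a b \<theta> f t) = conv a b \<theta> (\<lambda>s. T (f s)) t"
    using integral_linear[OF conv_integrable[OF f \<theta>] T, of t] by (simp add: conv_def 1)
  show "(\<lambda>s. \<theta> (t - s) *\<^sub>R T (f s)) integrable_on {a..b}"
    using integrable_linear[OF conv_integrable[OF f \<theta>] T, of t] by (simp add: 1)
qed

lemma has_vector_derivative_quadratic:
  fixes F :: "real \<Rightarrow> 'b::real_normed_vector"
  assumes "\<And>y. norm (F y - F t - (y - t) *\<^sub>R D) \<le> K * (y - t)\<^sup>2"
  shows "(F has_vector_derivative D) (at t)"
  unfolding has_vector_derivative_def has_derivative_within
proof (intro conjI)
  show "((\<lambda>y. (1 / norm (y - t)) *\<^sub>R (F y - (F t + (y - t) *\<^sub>R D))) \<longlongrightarrow> 0) (at t)"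
  proof (rule Lim_null_comparison)
    show "\<forall>\<^sub>F y in at t. norm ((1 / norm (y - t)) *\<^sub>R (F y - (F t + (y - t) *\<^sub>R D))) \<le> K * \<bar>y - t\<bar>"
      unfolding eventually_at_filter
    proof (intro always_eventually allI impI)
      fix y assume y: "y \<noteq> t"
      define z where "z = \<bar>y - t\<bar>"
      have sq: "(y - t)\<^sup>2 = z * z" "z \<noteq> 0" using y by (simp_all add: power2_eq_square z_def)
      have "norm ((1 / norm (y - t)) *\<^sub>R (F y - (F t + (y - t) *\<^sub>R D))) = norm (F y - F t - (y - t) *\<^sub>R D) / \<bar>y - t\<bar>"
        by (simp add: diff_diff_eq)
      also have "\<dots> \<le> K * (y - t)\<^sup>2 / \<bar>y - t\<bar>" using assms by (intro divide_right_mono) auto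
      also have "\<dots> = K * \<bar>y - t\<bar>" using sq(2) by (simp add: sq(1) flip: z_def)
      finally show "norm ((1 / norm (y - t)) *\<^sub>R (F y - (F t + (y - t) *\<^sub>R D))) \<le> K * \<bar>y - t\<bar>" .
    qed
    have "((\<lambda>y. K * \<bar>y - t\<bar>) \<longlongrightarrow> K * \<bar>t - t\<bar>) (at t)" by (intro tendsto_intros)
    then show "((\<lambda>y. K * \<bar>y - t\<bar>) \<longlongrightarrow> 0) (at t)" by simp
  qed
qed (rule bounded_linear_scaleR_left)

lemma taylor_quadratic_bound:
  fixes \<theta> :: "real \<Rightarrow> real"
  assumes d1: "\<And>x. (\<theta> has_real_derivative \<theta>1 x) (at x)" and d2: "\<And>x. (\<theta>1 has_real_derivative \<theta>2 x) (at x)"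
    and M: "\<And>x. \<bar>\<theta>2 x\<bar> \<le> M"
  shows "\<bar>\<theta> y - \<theta> x - (y - x) * \<theta>1 x\<bar> \<le> M * (y - x)\<^sup>2"
proof -
  have M0: "M \<ge> 0" using M[of 0] by linarith
  have 1: "\<bar>\<theta>1 z - \<theta>1 x\<bar> \<le> M * \<bar>z - x\<bar>" for z
    using field_differentiable_bound[of UNIV \<theta>1 \<theta>2 M x z] d2 M by (auto simp: abs_minus_commute)
  define S where "S = closed_segment x y"
  have "norm ((\<theta> y - y * \<theta>1 x) - (\<theta> x - x * \<theta>1 x)) \<le> (M * \<bar>y - x\<bar>) * norm (y - x)"
  proof (rule field_differentiable_bound[of S])
    show "convex S" "x \<in> S" "y \<in> S" by (auto simp: S_def)
    fix z assume z: "z \<in> S"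
    show "((\<lambda>y. \<theta> y - y * \<theta>1 x) has_field_derivative (\<theta>1 z - \<theta>1 x)) (at z within S)"
      by (rule has_field_derivative_at_within) (auto intro!: derivative_eq_intros d1)
    have "\<bar>z - x\<bar> \<le> \<bar>y - x\<bar>" using z by (auto simp: S_def closed_segment_eq_real_ivl split: if_splits)
    then show "norm (\<theta>1 z - \<theta>1 x) \<le> M * \<bar>y - x\<bar>"
      using 1[of z] mult_left_mono[of "\<bar>z - x\<bar>" "\<bar>y - x\<bar>" M] M0 by simp
  qed
  moreover have "(\<theta> y - y * \<theta>1 x) - (\<theta> x - x * \<theta>1 x) = \<theta> y - \<theta> x - (y - x) * \<theta>1 x" by (simp add: algebra_simps)
  ultimately show ?thesis by (simp add: power2_eq_square mult.assoc)
qed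

text \<open>The second-order Taylor remainder of the kernel is bounded uniformly in
  \<open>s\<close>; integrated against \<open>p\<close> it gives a quadratic error for the
  convolution, so no interchange of limit and integral is needed.\<close>

lemma conv_has_vector_derivative:
  fixes f :: "real \<Rightarrow> 'b::banach"
  assumes f: "L1_approx (\<lambda>t. indicator {a..b} t *\<^sub>R f t)"
    and p: "p integrable_on {a..b}" "\<And>s. s \<in> {a..b} \<Longrightarrow> norm (f s) \<le> p s"
    and d1: "\<And>x. (\<theta> has_real_derivative \<theta>1 x) (at x)" and d2: "\<And>x. (\<theta>1 has_real_derivative \<theta>2 x) (at x)"
    and M: "\<And>x. \<bar>\<theta> x\<bar> \<le> M" "\<And>x. \<bar>\<theta>1 x\<bar> \<le> M" "\<And>x. \<bar>\<theta>2 x\<bar> \<le> M"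
  shows "(conv a b \<theta> f has_vector_derivative conv a b \<theta>1 f t) (at t)"
proof (rule has_vector_derivative_quadratic)
  fix y
  have c: "continuous_on UNIV \<theta>" "continuous_on UNIV \<theta>1"
    using d1 d2 by (blast intro: DERIV_continuous_on)+
  note i = conv_integrable[OF f c(1) M(1)] conv_integrable[OF f c(2) M(2)]
  have "conv a b \<theta> f y - conv a b \<theta> f t - (y - t) *\<^sub>R conv a b \<theta>1 f t
    = integral {a..b} (\<lambda>s. \<theta> (y - s) *\<^sub>R f s - \<theta> (t - s) *\<^sub>R f s - (y - t) *\<^sub>R (\<theta>1 (t - s) *\<^sub>R f s))"
    unfolding conv_def using i by (simp add: integral_diff integrable_diff integrable_cmul del: scaleR_scaleR)
  also have "norm \<dots> \<le> integral {a..b} (\<lambda>s. M * (y - t)\<^sup>2 * p s)"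
  proof (rule integral_norm_bound_integral)
    show "(\<lambda>s. \<theta> (y - s) *\<^sub>R f s - \<theta> (t - s) *\<^sub>R f s - (y - t) *\<^sub>R (\<theta>1 (t - s) *\<^sub>R f s)) integrable_on {a..b}"
      using i by (intro integrable_diff integrable_cmul)
    show "(\<lambda>s. M * (y - t)\<^sup>2 * p s) integrable_on {a..b}"
      using p(1) integrable_on_cmult_left[of p "{a..b}" "M * (y - t)\<^sup>2"] by simp
    fix s assume s: "s \<in> {a..b}"
    have "\<theta> (y - s) *\<^sub>R f s - \<theta> (t - s) *\<^sub>R f s - (y - t) *\<^sub>R (\<theta>1 (t - s) *\<^sub>R f s)
       = (\<theta> (y - s) - \<theta> (t - s) - ((y - s) - (t - s)) * \<theta>1 (t - s)) *\<^sub>R f s"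
      by (simp add: algebra_simps)
    also have "norm \<dots> = \<bar>\<theta> (y - s) - \<theta> (t - s) - ((y - s) - (t - s)) * \<theta>1 (t - s)\<bar> * norm (f s)" by simp
    also have "\<dots> \<le> (M * ((y - s) - (t - s))\<^sup>2) * p s"
      by (rule mult_mono[OF taylor_quadratic_bound[OF d1 d2 M(3)] p(2)[OF s]])
        (use M(1)[of 0] in \<open>auto intro!: mult_nonneg_nonneg\<close>)
    finally show "norm (\<theta> (y - s) *\<^sub>R f s - \<theta> (t - s) *\<^sub>R f s - (y - t) *\<^sub>R (\<theta>1 (t - s) *\<^sub>R f s)) \<le> M * (y - t)\<^sup>2 * p s"
      by simp
  qed
  also have "\<dots> = M * integral {a..b} p * (y - t)\<^sup>2" by simp
  finally show "norm (conv a b \<theta> f y - conv a b \<theta> f t - (y - t) *\<^sub>R conv a b \<theta>1 f t) \<le> M * integral {a..b} p * (y - t)\<^sup>2" .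
qed

text \<open>The kernels are one-sided: the mollified value at t averages over [t - 1/n, t]. Support
  and mass are required for positive \<open>n\<close> only, since \<open>1 / real 0 = 0\<close>
  would leave a degenerate interval without mass.\<close>

locale mollifier =
  fixes \<theta> :: "nat \<Rightarrow> real \<Rightarrow> real" and M :: "nat \<Rightarrow> real"
  assumes cont: "\<And>n. continuous_on UNIV (\<theta> n)" and nonneg: "\<And>n x. 0 \<le> \<theta> n x" and bound: "\<And>n x. \<bar>\<theta> n x\<bar> \<le> M n"
    and supp: "\<And>n x. n > 0 \<Longrightarrow> x \<notin> {0..1 / real n} \<Longrightarrow> \<theta> n x = 0"
    and mass: "\<And>n. n > 0 \<Longrightarrow> (\<theta> n has_integral 1) {0..1 / real n}"
begin

lemma measurable_mollifier [measurable]: "\<theta> n \<in> borel_measurable borel"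
  by (rule borel_measurable_continuous_onI[OF cont])

lemma nn_integral_mollifier: "n > 0 \<Longrightarrow> (\<integral>\<^sup>+x. ennreal (\<theta> n x) \<partial>lborel) = 1"
proof -
  assume n: "n > 0"
  have "(\<theta> n has_integral 1) UNIV"
    by (rule has_integral_on_superset[OF mass[OF n]]) (use supp[OF n] in auto)
  from nn_integral_has_integral_lborel[OF measurable_mollifier nonneg this] show ?thesis by simp
qed

lemma nn_integral_mollifier_shift:
  assumes "n > 0"
  shows "(\<integral>\<^sup>+s. ennreal (\<theta> n (t - s)) \<partial>lborel) = 1" "(\<integral>\<^sup>+t. ennreal (\<theta> n (t - s)) \<partial>lborel) = 1"
proof -
  have "(\<integral>\<^sup>+x. ennreal (\<theta> n x) \<partial>lborel) = ennreal \<bar>-1\<bar> * (\<integral>\<^sup>+x. ennreal (\<theta> n (t + (-1) * x)) \<partial>lborel)"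
    by (rule nn_integral_real_affine) auto
  then show "(\<integral>\<^sup>+s. ennreal (\<theta> n (t - s)) \<partial>lborel) = 1" using nn_integral_mollifier[OF assms] by simp
  have "(\<integral>\<^sup>+x. ennreal (\<theta> n x) \<partial>lborel) = ennreal \<bar>1\<bar> * (\<integral>\<^sup>+x. ennreal (\<theta> n (- s + 1 * x)) \<partial>lborel)"
    by (rule nn_integral_real_affine) auto
  then show "(\<integral>\<^sup>+t. ennreal (\<theta> n (t - s)) \<partial>lborel) = 1" using nn_integral_mollifier[OF assms] by simp
qed

lemma conv_norm_le:
  fixes f :: "real \<Rightarrow> 'b::banach"
  assumes f: "(\<lambda>s. \<theta> n (t - s) *\<^sub>R f s) integrable_on {a..b}"
    and v: "v \<in> borel_measurable borel" "\<And>s. 0 \<le> v s"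
    and le: "AE s in lebesgue. s \<in> {a..b} \<longrightarrow> norm (f s) \<le> v s"
  shows "ennreal (norm (conv a b (\<theta> n) f t)) \<le> (\<integral>\<^sup>+s. ennreal (\<theta> n (t - s)) * (ennreal (v s) * indicator {a..b} s) \<partial>lborel)"
proof -
  note [measurable] = v(1)
  have "ennreal (norm (conv a b (\<theta> n) f t)) \<le> (\<integral>\<^sup>+s. ennreal (\<theta> n (t - s) * v s) * indicator {a..b} s \<partial>lborel)"
    unfolding conv_def
  proof (rule norm_integral_le_nn_integral[OF f])
    show "AE s in lebesgue. s \<in> {a..b} \<longrightarrow> norm (\<theta> n (t - s) *\<^sub>R f s) \<le> \<theta> n (t - s) * v s"
      using le by eventually_elim (auto simp: nonneg intro!: mult_left_mono)
  qed (use v nonneg in \<open>auto intro!: mult_nonneg_nonneg\<close>)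
  then show ?thesis by (simp add: ennreal_mult nonneg v(2) mult.assoc)
qed

text \<open>Jensen's inequality for the probability density \<open>\<theta> n (t - s)\<close>,
  obtained from Cauchy-Schwarz by splitting the density into two square roots.\<close>

lemma conv_norm_square_le:
  fixes f :: "real \<Rightarrow> 'b::banach"
  assumes n: "n > 0" and f: "(\<lambda>s. \<theta> n (t - s) *\<^sub>R f s) integrable_on {a..b}"
    and v: "v \<in> borel_measurable borel" "\<And>s. 0 \<le> v s"
    and le: "AE s in lebesgue. s \<in> {a..b} \<longrightarrow> norm (f s) \<le> v s"
  shows "ennreal ((norm (conv a b (\<theta> n) f t))\<^sup>2) \<le> (\<integral>\<^sup>+s. ennreal (\<theta> n (t - s)) * (ennreal ((v s)\<^sup>2) * indicator {a..b} s) \<partial>lborel)"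
proof -
  note [measurable] = v(1)
  have "ennreal ((norm (conv a b (\<theta> n) f t))\<^sup>2) = (ennreal (norm (conv a b (\<theta> n) f t)))\<^sup>2"
    by (simp add: ennreal_power)
  also have "\<dots> \<le> (\<integral>\<^sup>+s. ennreal (\<theta> n (t - s)) * (ennreal (v s) * indicator {a..b} s) \<partial>lborel)\<^sup>2"
    by (intro power_mono conv_norm_le[OF f v le]) auto
  also have "\<dots> = (\<integral>\<^sup>+s. ennreal (sqrt (\<theta> n (t - s))) * ennreal (sqrt (\<theta> n (t - s)) * (v s * indicator {a..b} s)) \<partial>lborel)\<^sup>2"
    by (intro arg_cong[where f = "\<lambda>x. x\<^sup>2"] nn_integral_cong)
      (auto simp: indicator_def nonneg v(2) simp flip: ennreal_mult)
  also have "\<dots> \<le> (\<integral>\<^sup>+s. (ennreal (sqrt (\<theta> n (t - s))))\<^sup>2 \<partial>lborel) *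
      (\<integral>\<^sup>+s. (ennreal (sqrt (\<theta> n (t - s)) * (v s * indicator {a..b} s)))\<^sup>2 \<partial>lborel)"
    by (rule Cauchy_Schwarz_nn_integral) measurable
  also have "(\<integral>\<^sup>+s. (ennreal (sqrt (\<theta> n (t - s))))\<^sup>2 \<partial>lborel) = 1"
    using nn_integral_mollifier_shift(1)[OF n, of t] by (simp add: ennreal_power nonneg)
  also have "(\<integral>\<^sup>+s. (ennreal (sqrt (\<theta> n (t - s)) * (v s * indicator {a..b} s)))\<^sup>2 \<partial>lborel)
      = (\<integral>\<^sup>+s. ennreal (\<theta> n (t - s)) * (ennreal ((v s)\<^sup>2) * indicator {a..b} s) \<partial>lborel)"
    by (intro nn_integral_cong)
      (auto simp: indicator_def nonneg v(2) ennreal_power power_mult_distrib simp flip: ennreal_mult)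
  finally show ?thesis by simp
qed

lemma conv_weighted_square_le:
  fixes f :: "real \<Rightarrow> 'b::banach"
  assumes n: "n > 0" and f: "\<And>t. (\<lambda>s. \<theta> n (t - s) *\<^sub>R f s) integrable_on {a..b}"
    and v: "v \<in> borel_measurable borel" "\<And>s. 0 \<le> v s"
    and le: "AE s in lebesgue. s \<in> {a..b} \<longrightarrow> norm (f s) \<le> v s"
    and w[measurable]: "w \<in> borel_measurable borel"
    and w'[measurable]: "w' \<in> borel_measurable borel"
    and ww': "\<And>s t. 0 \<le> t - s \<Longrightarrow> t - s \<le> 1 / real n \<Longrightarrow> w t \<le> w' s"
  shows "(\<integral>\<^sup>+t. w t * ennreal ((norm (conv a b (\<theta> n) f t))\<^sup>2) \<partial>lborel)
    \<le> (\<integral>\<^sup>+s. w' s * (ennreal ((v s)\<^sup>2) * indicator {a..b} s) \<partial>lborel)"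
proof -
  note [measurable] = v(1)
  let ?q = "\<lambda>s. ennreal ((v s)\<^sup>2) * indicator {a..b} s"
  have "(\<integral>\<^sup>+t. w t * ennreal ((norm (conv a b (\<theta> n) f t))\<^sup>2) \<partial>lborel)
    \<le> (\<integral>\<^sup>+t. w t * (\<integral>\<^sup>+s. ennreal (\<theta> n (t - s)) * ?q s \<partial>lborel) \<partial>lborel)"
    by (intro nn_integral_mono mult_left_mono conv_norm_square_le[OF n f v le]) auto
  also have "\<dots> = (\<integral>\<^sup>+t. (\<integral>\<^sup>+s. w t * (ennreal (\<theta> n (t - s)) * ?q s) \<partial>lborel) \<partial>lborel)"
    by (intro nn_integral_cong nn_integral_cmult[symmetric]) measurable
  also have "\<dots> \<le> (\<integral>\<^sup>+t. (\<integral>\<^sup>+s. w' s * (ennreal (\<theta> n (t - s)) * ?q s) \<partial>lborel) \<partial>lborel)"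
  proof (intro nn_integral_mono)
    fix t s
    show "w t * (ennreal (\<theta> n (t - s)) * ?q s) \<le> w' s * (ennreal (\<theta> n (t - s)) * ?q s)"
    proof (cases "t - s \<in> {0..1 / real n}")
      case True
      then show ?thesis by (intro mult_right_mono ww') auto
    qed (simp add: supp[OF n])
  qed
  also have "\<dots> = (\<integral>\<^sup>+s. (\<integral>\<^sup>+t. w' s * (ennreal (\<theta> n (t - s)) * ?q s) \<partial>lborel) \<partial>lborel)"
    by (rule lborel_pair.Fubini'[symmetric]) measurable
  also have "\<dots> = (\<integral>\<^sup>+s. (\<integral>\<^sup>+t. (w' s * ?q s) * ennreal (\<theta> n (t - s)) \<partial>lborel) \<partial>lborel)"
    by (simp add: mult_ac)
  also have "\<dots> = (\<integral>\<^sup>+s. w' s * ?q s \<partial>lborel)"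
    by (intro nn_integral_cong, subst nn_integral_cmult) (simp_all add: nn_integral_mollifier_shift(2)[OF n])
  finally show ?thesis .
qed

text \<open>Convergence in L1, phrased with a Borel majorant \<open>W\<close> of the error. The
  error splits into the mollified \<open>f - g\<close>, the oscillation of the continuous
  \<open>g\<close>, and \<open>g - f\<close>, each contributing a third of \<delta>.\<close>

lemma conv_approx:
  fixes f :: "real \<Rightarrow> 'b::banach"
  assumes f: "L1_approx (\<lambda>t. indicator {a..b} t *\<^sub>R f t)" and ac: "a < c" and \<delta>: "\<delta> > 0"
  shows "\<exists>n\<ge>n0. \<exists>W \<in> borel_measurable borel. (\<integral>\<^sup>+t. W t \<partial>lborel) \<le> ennreal \<delta> \<and>
    (AE t in lebesgue. t \<in> {c..b} \<longrightarrow> ennreal (norm (conv a b (\<theta> n) f t - f t)) \<le> W t)"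
proof -
  obtain g h where gh: "continuous_on UNIV g" "h \<in> borel_measurable borel" "\<And>t. 0 \<le> h t"
    "AE t in lebesgue. norm (indicator {a..b} t *\<^sub>R f t - g t) \<le> h t" "(\<integral>\<^sup>+t. ennreal (h t) \<partial>lborel) < ennreal (\<delta>/3)"
    using L1_approxE[OF f, of "\<delta>/3"] \<delta> by auto
  note [measurable] = gh(2)
  \<comment> \<open>The permitted oscillation of \<open>g\<close>, integrated over
    \<open>{c..b}\<close>, stays below \<delta>/3; the summand 1 covers the case
    \<open>b = c\<close>.\<close>
  define \<omega> where "\<omega> = \<delta> / (3 * (\<bar>b - c\<bar> + 1))"
  have \<omega>: "\<omega> > 0" using \<delta> by (simp add: \<omega>_def add_nonneg_pos)
  have "uniformly_continuous_on {a..b} g"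
    using gh(1) by (intro compact_uniformly_continuous continuous_on_subset[OF gh(1)]) auto
  then obtain \<eta> where \<eta>: "\<eta> > 0" "\<And>x y. x \<in> {a..b} \<Longrightarrow> y \<in> {a..b} \<Longrightarrow> dist y x < \<eta> \<Longrightarrow> dist (g y) (g x) < \<omega>"
    using \<omega> unfolding uniformly_continuous_on_def by metis
  obtain n1 :: nat where n1: "1 / min \<eta> (c - a) < real n1" using reals_Archimedean2 by blast
  define n where "n = max n0 (max n1 1)"
  have n: "n > 0" "n \<ge> n0" by (auto simp: n_def)
  have imp: "1 / real n < \<mu>" if "1 / \<mu> < real n" "0 < \<mu>" for \<mu>
    using n(1) that by (simp add: field_simps)
  \<comment> \<open>The first bound makes the oscillation of \<open>g\<close> small over the support
    of the kernel, the second keeps this support inside \<open>{a..b}\<close> for all t in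
    \<open>{c..b}\<close>, so that it has full mass.\<close>
  have "1 / real n < min \<eta> (c - a)"
    by (rule imp) (use \<eta>(1) ac n1 in \<open>auto simp: n_def simp del: min_less_iff_conj\<close>)
  then have n': "1 / real n < \<eta>" "1 / real n < c - a" by auto
  let ?h = "\<lambda>s. ennreal (h s) * indicator {a..b} s"
  define W where "W t = (\<integral>\<^sup>+s. ennreal (\<theta> n (t - s)) * ?h s \<partial>lborel) + ennreal \<omega> * indicator {c..b} t + ennreal (h t)" for t
  have Wm: "W \<in> borel_measurable borel" unfolding W_def by measurable
  have "(\<integral>\<^sup>+t. W t \<partial>lborel) = (\<integral>\<^sup>+t. (\<integral>\<^sup>+s. ennreal (\<theta> n (t - s)) * ?h s \<partial>lborel) \<partial>lborel) +
     (\<integral>\<^sup>+t. ennreal \<omega> * indicator {c..b} t \<partial>lborel) + (\<integral>\<^sup>+t. ennreal (h t) \<partial>lborel)"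
    unfolding W_def by (subst nn_integral_add; (simp | measurable)?)+
  also have "(\<integral>\<^sup>+t. (\<integral>\<^sup>+s. ennreal (\<theta> n (t - s)) * ?h s \<partial>lborel) \<partial>lborel) = (\<integral>\<^sup>+s. (\<integral>\<^sup>+t. ?h s * ennreal (\<theta> n (t - s)) \<partial>lborel) \<partial>lborel)"
    by (subst lborel_pair.Fubini') (auto simp: mult_ac)
  also have "\<dots> = (\<integral>\<^sup>+s. ?h s \<partial>lborel)"
    by (intro nn_integral_cong, subst nn_integral_cmult) (simp_all add: nn_integral_mollifier_shift(2)[OF n(1)])
  also have "\<dots> \<le> (\<integral>\<^sup>+s. ennreal (h s) \<partial>lborel)"
    by (intro nn_integral_mono) (auto simp: indicator_def)
  also have "(\<integral>\<^sup>+t. ennreal \<omega> * indicator {c..b} t \<partial>lborel) \<le> ennreal (\<delta>/3)"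
  proof -
    have "(\<integral>\<^sup>+t. ennreal \<omega> * indicator {c..b} t \<partial>lborel) = ennreal \<omega> * emeasure lborel {c..b}"
      by (subst nn_integral_cmult) auto
    also have "\<dots> \<le> ennreal \<omega> * ennreal \<bar>b - c\<bar>" by (intro mult_left_mono) (auto simp: emeasure_lborel_Icc_eq)
    also have "\<dots> = ennreal (\<omega> * \<bar>b - c\<bar>)" using \<omega> by (simp add: ennreal_mult)
    also have "\<dots> \<le> ennreal (\<delta>/3)"
    proof (rule ennreal_leI)
      have "\<bar>b - c\<bar> + 1 \<noteq> 0" by (metis abs_ge_zero add_nonneg_pos less_irrefl zero_less_one)
      moreover have "\<delta> / (3 * x) * x = \<delta> / 3" if "x \<noteq> 0" for x using that by simp
      ultimately have "\<omega> * (\<bar>b - c\<bar> + 1) = \<delta>/3" unfolding \<omega>_def by blast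
      then show "\<omega> * \<bar>b - c\<bar> \<le> \<delta>/3" using \<omega> by (simp add: distrib_left)
    qed
    finally show ?thesis .
  qed
  finally have "(\<integral>\<^sup>+t. W t \<partial>lborel) \<le> (\<integral>\<^sup>+s. ennreal (h s) \<partial>lborel) + ennreal (\<delta>/3) + (\<integral>\<^sup>+t. ennreal (h t) \<partial>lborel)"
    by (simp add: add_mono)
  also have "\<dots> \<le> ennreal (\<delta>/3) + ennreal (\<delta>/3) + ennreal (\<delta>/3)"
    using gh(5) by (intro add_mono) (auto intro: less_imp_le)
  also have "\<dots> = ennreal \<delta>" using \<delta> by (simp flip: ennreal_plus)
  finally have W1: "(\<integral>\<^sup>+t. W t \<partial>lborel) \<le> ennreal \<delta>" .
  have W2: "AE t in lebesgue. t \<in> {c..b} \<longrightarrow> ennreal (norm (conv a b (\<theta> n) f t - f t)) \<le> W t"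
    using gh(4)
  proof eventually_elim
    case (elim t)
    show ?case
    proof
      assume t: "t \<in> {c..b}"
      have tab: "t \<in> {a..b}" using t ac by auto
      define I1 where "I1 = conv a b (\<theta> n) (\<lambda>s. f s - g s) t"
      have if': "(\<lambda>s. \<theta> n (t - s) *\<^sub>R f s) integrable_on {a..b}" by (rule conv_integrable[OF f cont bound])
      have ct: "continuous_on {a..b} (\<lambda>s. \<theta> n (t - s))"
        by (intro continuous_on_compose2[OF cont] continuous_intros) auto
      have ig: "(\<lambda>s. \<theta> n (t - s) *\<^sub>R g s) integrable_on {a..b}"
        by (intro integrable_continuous_interval continuous_on_scaleR ct continuous_on_subset[OF gh(1)]) auto
      have ifg: "(\<lambda>s. \<theta> n (t - s) *\<^sub>R (f s - g s)) integrable_on {a..b}"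
        using integrable_diff[OF if' ig] by (simp add: scaleR_diff_right)
      have mass1: "((\<lambda>s. \<theta> n (t - s)) has_integral 1) {a..b}"
      proof -
        have "((\<lambda>s. \<theta> n (t - s)) has_integral 1) UNIV"
        proof (subst has_integral_iff_nn_integral_lebesgue)
          have "(\<lambda>s. \<theta> n (t - s)) \<in> borel_measurable lebesgue" by (rule measurable_completion) measurable
          moreover have "integral\<^sup>N lebesgue (\<lambda>s. ennreal (\<theta> n (t - s))) = ennreal 1"
            unfolding nn_integral_completion by (simp only: nn_integral_mollifier_shift(1)[OF n(1)] ennreal_1)
          ultimately show "(\<lambda>s. \<theta> n (t - s)) \<in> borel_measurable lebesgue \<and>
            integral\<^sup>N lebesgue (\<lambda>s. ennreal (\<theta> n (t - s))) = ennreal 1 \<and> (0::real) \<le> 1" by simp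
        qed (rule nonneg)
        moreover have "(\<lambda>s. \<theta> n (t - s)) = (\<lambda>s. if s \<in> {a..b} then \<theta> n (t - s) else 0)"
        proof
          fix s
          show "\<theta> n (t - s) = (if s \<in> {a..b} then \<theta> n (t - s) else 0)"
          proof (cases "s \<in> {a..b}")
            case False
            then have "t - s \<notin> {0..1 / real n}" using t n'(2) by auto
            then show ?thesis using False by (simp add: supp[OF n(1)])
          qed simp
        qed
        ultimately have "((\<lambda>s. if s \<in> {a..b} then \<theta> n (t - s) else 0) has_integral 1) UNIV" by simp
        then show ?thesis unfolding has_integral_restrict_UNIV .
      qed
      have "integral {a..b} (\<lambda>s. \<theta> n (t - s) *\<^sub>R g t) = g t"
        using has_integral_scaleR_left[OF mass1, of "g t"] by (simp add: integral_unique)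
      moreover have igt: "(\<lambda>s. \<theta> n (t - s) *\<^sub>R g t) integrable_on {a..b}"
        using has_integral_scaleR_left[OF mass1, of "g t"] by blast
      ultimately have e: "conv a b (\<theta> n) f t - f t = I1 + integral {a..b} (\<lambda>s. \<theta> n (t - s) *\<^sub>R (g s - g t)) + (g t - f t)"
        unfolding I1_def conv_def using if' ig by (simp add: scaleR_diff_right integral_diff)
      have "norm (integral {a..b} (\<lambda>s. \<theta> n (t - s) *\<^sub>R (g s - g t))) \<le> integral {a..b} (\<lambda>s. \<theta> n (t - s) * \<omega>)"
      proof (rule integral_norm_bound_integral)
        show "(\<lambda>s. \<theta> n (t - s) *\<^sub>R (g s - g t)) integrable_on {a..b}"
          using integrable_diff[OF ig igt] by (simp add: scaleR_diff_right)
        show "(\<lambda>s. \<theta> n (t - s) * \<omega>) integrable_on {a..b}" using has_integral_mult_left[OF mass1, of \<omega>] by blast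
        fix s assume s: "s \<in> {a..b}"
        show "norm (\<theta> n (t - s) *\<^sub>R (g s - g t)) \<le> \<theta> n (t - s) * \<omega>"
        proof (cases "t - s \<in> {0..1 / real n}")
          case True
          then have "dist s t < \<eta>" using n'(1) by (simp add: dist_real_def)
          from \<eta>(2)[OF tab s this] have "norm (g s - g t) \<le> \<omega>" by (simp add: dist_norm)
          then show ?thesis by (simp add: nonneg mult_left_mono)
        qed (simp add: supp[OF n(1)])
      qed
      also have "\<dots> = \<omega>" using integral_unique[OF mass1] by simp
      finally have I2: "norm (integral {a..b} (\<lambda>s. \<theta> n (t - s) *\<^sub>R (g s - g t))) \<le> \<omega>" .
      have I3: "norm (g t - f t) \<le> h t" using elim tab by (simp add: norm_minus_commute)
      have I1: "ennreal (norm I1) \<le> (\<integral>\<^sup>+s. ennreal (\<theta> n (t - s)) * ?h s \<partial>lborel)"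
        unfolding I1_def
      proof (rule conv_norm_le[OF ifg gh(2,3)])
        show "AE s in lebesgue. s \<in> {a..b} \<longrightarrow> norm (f s - g s) \<le> h s" using gh(4) by eventually_elim auto
      qed
      have "norm (conv a b (\<theta> n) f t - f t) \<le> norm I1 + \<omega> + h t"
        unfolding e using I2 I3 norm_triangle_ineq[of "I1 + integral {a..b} (\<lambda>s. \<theta> n (t - s) *\<^sub>R (g s - g t))" "g t - f t"]
          norm_triangle_ineq[of I1 "integral {a..b} (\<lambda>s. \<theta> n (t - s) *\<^sub>R (g s - g t))"] by linarith
      then have "ennreal (norm (conv a b (\<theta> n) f t - f t)) \<le> ennreal (norm I1) + ennreal \<omega> + ennreal (h t)"
        using \<omega> gh(3)[of t] by (simp flip: ennreal_plus)
      also have "\<dots> \<le> W t" unfolding W_def using I1 t by (intro add_mono) auto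
      finally show "ennreal (norm (conv a b (\<theta> n) f t - f t)) \<le> W t" .
    qed
  qed
  show ?thesis using n(2) Wm W1 W2 by blast
qed

text \<open>Errors of size 2^-k in L1 are summable, hence the sum of the majorants is finite almost
  everywhere and the errors tend to zero there.\<close>

lemma conv_tendsto_AE:
  fixes f :: "real \<Rightarrow> 'b::banach"
  assumes f: "L1_approx (\<lambda>t. indicator {a..b} t *\<^sub>R f t)" and ac: "a < c"
  obtains N :: "nat \<Rightarrow> nat" where "\<And>k. k \<le> N k"
    "AE t in lebesgue. t \<in> {c..b} \<longrightarrow> (\<lambda>k. conv a b (\<theta> (N k)) f t) \<longlonglongrightarrow> f t"
proof -
  have "\<forall>k. \<exists>n. \<exists>W. k \<le> n \<and> W \<in> borel_measurable borel \<and> (\<integral>\<^sup>+t. W t \<partial>lborel) \<le> ennreal ((1/2)^k) \<and>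
    (AE t in lebesgue. t \<in> {c..b} \<longrightarrow> ennreal (norm (conv a b (\<theta> n) f t - f t)) \<le> W t)"
  proof
    fix k :: nat
    have "(1/2 :: real) ^ k > 0" by simp
    from conv_approx[OF f ac this, of k]
    show "\<exists>n. \<exists>W. k \<le> n \<and> W \<in> borel_measurable borel \<and> (\<integral>\<^sup>+t. W t \<partial>lborel) \<le> ennreal ((1/2)^k) \<and>
      (AE t in lebesgue. t \<in> {c..b} \<longrightarrow> ennreal (norm (conv a b (\<theta> n) f t - f t)) \<le> W t)" by blast
  qed
  from choice[OF this] obtain N where "\<forall>k. \<exists>W. k \<le> N k \<and> W \<in> borel_measurable borel \<and>
    (\<integral>\<^sup>+t. W t \<partial>lborel) \<le> ennreal ((1/2)^k) \<and>
    (AE t in lebesgue. t \<in> {c..b} \<longrightarrow> ennreal (norm (conv a b (\<theta> (N k)) f t - f t)) \<le> W t)" by blast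
  from choice[OF this] obtain W where N: "\<And>k::nat. k \<le> N k" "\<And>k. W k \<in> borel_measurable borel"
    "\<And>k. (\<integral>\<^sup>+t. W k t \<partial>lborel) \<le> ennreal ((1/2)^k)"
    "\<And>k. AE t in lebesgue. t \<in> {c..b} \<longrightarrow> ennreal (norm (conv a b (\<theta> (N k)) f t - f t)) \<le> W k t"
    by blast
  note [measurable] = N(2)
  have "(\<integral>\<^sup>+t. (\<Sum>k. W k t) \<partial>lborel) = (\<Sum>k. \<integral>\<^sup>+t. W k t \<partial>lborel)" by (rule nn_integral_suminf) measurable
  also have "\<dots> \<le> (\<Sum>k. ennreal ((1/2)^k))" by (intro suminf_le N(3)) auto
  also have "\<dots> = ennreal (\<Sum>k. (1/2)^k)" by (intro suminf_ennreal2) (auto intro: summable_geometric)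
  also have "\<dots> < \<infinity>" by simp
  finally have "(\<integral>\<^sup>+t. (\<Sum>k. W k t) \<partial>lborel) \<noteq> \<infinity>" by simp
  then have "AE t in lborel. (\<Sum>k. W k t) \<noteq> \<infinity>" by (rule nn_integral_PInf_AE[rotated]) measurable
  then have "AE t in lebesgue. (\<Sum>k. W k t) \<noteq> \<infinity>" by (rule AE_completion)
  moreover have "AE t in lebesgue. \<forall>k. t \<in> {c..b} \<longrightarrow> ennreal (norm (conv a b (\<theta> (N k)) f t - f t)) \<le> W k t"
    using N(4) unfolding AE_all_countable by blast
  ultimately have "AE t in lebesgue. t \<in> {c..b} \<longrightarrow> (\<lambda>k. conv a b (\<theta> (N k)) f t) \<longlonglongrightarrow> f t"
  proof eventually_elim
    case (elim t)
    show ?case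
    proof
      assume t: "t \<in> {c..b}"
      have "(\<Sum>k. ennreal (norm (conv a b (\<theta> (N k)) f t - f t))) \<le> (\<Sum>k. W k t)"
        using elim(2) t by (intro suminf_le) auto
      then have "(\<Sum>k. ennreal (norm (conv a b (\<theta> (N k)) f t - f t))) \<noteq> top"
        using elim(1) by (auto simp: top_unique)
      then have "summable (\<lambda>k. norm (conv a b (\<theta> (N k)) f t - f t))"
        by (intro summable_suminf_not_top) auto
      then have "(\<lambda>k. norm (conv a b (\<theta> (N k)) f t - f t)) \<longlonglongrightarrow> 0" by (rule summable_LIMSEQ_zero)
      then show "(\<lambda>k. conv a b (\<theta> (N k)) f t) \<longlonglongrightarrow> f t"
        using tendsto_norm_zero_iff Lim_null by blast
    qed
  qed
  with N(1) show ?thesis using that by blast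
qed

end

section \<open>Carleman estimates\<close>

lemma integral_exact_derivative_zero:
  fixes E e :: "real \<Rightarrow> real"
  assumes "\<alpha> \<le> \<beta>" "\<And>t. t \<in> {\<alpha>..\<beta>} \<Longrightarrow> (E has_vector_derivative e t) (at t)" "E \<alpha> = E \<beta>"
  shows "(e has_integral 0) {\<alpha>..\<beta>}"
proof -
  have "(e has_integral E \<beta> - E \<alpha>) {\<alpha>..\<beta>}"
    by (rule fundamental_theorem_of_calculus[OF assms(1)]) (rule has_vector_derivative_at_within[OF assms(2)])
  then show ?thesis by (simp add: assms(3))
qed

text \<open>Integration by parts in the form used below: adding the derivative of a quantity with
  equal boundary values does not change the integral, so a pointwise inequality is needed only after
  this correction.\<close>

lemma integral_mono_exact_derivative:
  fixes E e f g :: "real \<Rightarrow> real"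
  assumes ab: "\<alpha> \<le> \<beta>" and f: "f integrable_on {\<alpha>..\<beta>}" and g: "g integrable_on {\<alpha>..\<beta>}"
    and E: "\<And>t. t \<in> {\<alpha>..\<beta>} \<Longrightarrow> (E has_vector_derivative e t) (at t)" "E \<alpha> = E \<beta>"
    and le: "\<And>t. t \<in> {\<alpha>..\<beta>} \<Longrightarrow> f t \<le> g t + e t"
  shows "integral {\<alpha>..\<beta>} f \<le> integral {\<alpha>..\<beta>} g"
proof -
  have e: "(e has_integral 0) {\<alpha>..\<beta>}" by (rule integral_exact_derivative_zero[OF ab E])
  then have "((\<lambda>t. g t + e t) has_integral (integral {\<alpha>..\<beta>} g + 0)) {\<alpha>..\<beta>}"
    by (intro has_integral_add integrable_integral g)
  from has_integral_le[OF integrable_integral[OF f] this le] show ?thesis by simp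
qed

text \<open>In applications \<open>R\<close> is a regularising resolvent of the operator and \<open>Q\<close> is the operator times
  \<open>R\<close>; then the integrand on the right-hand side is the squared norm of the operator
  \<open>(d/dt - \<mu>)\<^sup>2 - A\<close> applied to \<open>R U\<close>.\<close>

definition carleman_estimate :: "('b::real_inner \<Rightarrow> 'b) \<Rightarrow> ('b \<Rightarrow> 'b) \<Rightarrow> real \<Rightarrow> real \<Rightarrow> real \<Rightarrow> bool" where
  "carleman_estimate R Q \<mu> d L \<longleftrightarrow> (\<forall>U U1 U2 \<alpha> \<beta>. \<alpha> < \<beta> \<longrightarrow> \<beta> - \<alpha> \<le> L \<longrightarrow>
     (\<forall>t. (U has_vector_derivative U1 t) (at t)) \<longrightarrow> (\<forall>t. (U1 has_vector_derivative U2 t) (at t)) \<longrightarrow>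
     continuous_on UNIV U2 \<longrightarrow> U \<alpha> = 0 \<longrightarrow> U \<beta> = 0 \<longrightarrow> U1 \<alpha> = 0 \<longrightarrow> U1 \<beta> = 0 \<longrightarrow>
     integral {\<alpha>..\<beta>} (\<lambda>t. d\<^sup>2 * (norm (R (U t)))\<^sup>2)
     \<le> integral {\<alpha>..\<beta>} (\<lambda>t. (norm (R (U2 t) - (2 * \<mu>) *\<^sub>R R (U1 t) - (Q (U t) - \<mu>\<^sup>2 *\<^sub>R R (U t))))\<^sup>2))"

lemma has_vector_derivative_continuous_on:
  "(\<And>t. (f has_vector_derivative f' t) (at t)) \<Longrightarrow> continuous_on S f"
  by (meson continuous_at_imp_continuous_on has_vector_derivative_continuous)

lemma has_vector_derivative_inner:
  fixes f g :: "real \<Rightarrow> 'b::real_inner"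
  assumes "(f has_vector_derivative f') (at t)" "(g has_vector_derivative g') (at t)"
  shows "((\<lambda>t. inner (f t) (g t)) has_vector_derivative (inner (f t) g' + inner f' (g t))) (at t)"
  by (rule bounded_bilinear.has_vector_derivative[OF bounded_bilinear_inner assms])

lemmas bounded_linear_has_vector_derivative = bounded_linear.has_vector_derivative

lemma real_mult_has_vector_derivative:
  fixes f g :: "real \<Rightarrow> real"
  assumes "(f has_vector_derivative f') (at t)" "(g has_vector_derivative g') (at t)"
  shows "((\<lambda>t. f t * g t) has_vector_derivative (f t * g' + f' * g t)) (at t)"
  by (rule bounded_bilinear.has_vector_derivative[OF bounded_bilinear_mult assms])

context
  fixes R Q :: "'b::real_inner \<Rightarrow> 'b"
  assumes R: "bounded_linear R" and Q: "bounded_linear Q"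
    and sym: "\<And>x y. inner (Q x) (R y) = inner (R x) (Q y)"
begin

text \<open>After integration by parts the remaining indefinite term is 2<RU', BU'> \<ge>
  -2(\<gamma> + \<mu>^2)|RU'|^2, which the assumption \<gamma> \<le> \<mu>^2 makes at least
  -4\<mu>^2|RU'|^2. The square |BU|^2 is left, and the gap bounds it from below.\<close>

lemma carleman_estimate_gap:
  assumes \<gamma>: "\<And>x. - \<gamma> * (norm (R x))\<^sup>2 \<le> inner (Q x) (R x)" and \<mu>: "\<gamma> \<le> \<mu>\<^sup>2"
    and gap: "\<And>x. d * norm (R x) \<le> norm (Q x - \<mu>\<^sup>2 *\<^sub>R R x)" and d: "d \<ge> 0"
  shows "carleman_estimate R Q \<mu> d L"
  unfolding carleman_estimate_def
proof (intro allI impI)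
  fix U U1 U2 :: "real \<Rightarrow> 'b" and \<alpha> \<beta> :: real
  assume ab: "\<alpha> < \<beta>" and dU: "\<forall>t. (U has_vector_derivative U1 t) (at t)"
    and dU1: "\<forall>t. (U1 has_vector_derivative U2 t) (at t)" and c2: "continuous_on UNIV U2"
    and bd: "U \<alpha> = 0" "U \<beta> = 0" "U1 \<alpha> = 0" "U1 \<beta> = 0"
  define B where "B x = Q x - \<mu>\<^sup>2 *\<^sub>R R x" for x
  have B: "bounded_linear B" unfolding B_def[abs_def]
    by (rule bounded_linear_sub[OF Q bounded_linear_compose[OF bounded_linear_scaleR_right R]])
  have symB: "inner (B x) (R y) = inner (R x) (B y)" for x y by (simp add: B_def inner_simps sym)
  have c: "continuous_on S U" "continuous_on S U1" "continuous_on S U2" for S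
    using dU dU1 c2 continuous_on_subset by (blast intro: has_vector_derivative_continuous_on)+
  note cs = bounded_linear.continuous_on[OF R] bounded_linear.continuous_on[OF B]
  \<comment> \<open>The cross terms of the expanded square, completed by -2<RU', BU'> to an exact
    derivative.\<close>
  define e where "e t = -4 * \<mu> * inner (R (U2 t) - B (U t)) (R (U1 t))
      - 2 * (inner (R (U2 t)) (B (U t)) + inner (R (U1 t)) (B (U1 t)))" for t
  have "integral {\<alpha>..\<beta>} (\<lambda>t. d\<^sup>2 * (norm (R (U t)))\<^sup>2)
     \<le> integral {\<alpha>..\<beta>} (\<lambda>t. (norm (R (U2 t) - (2 * \<mu>) *\<^sub>R R (U1 t) - B (U t)))\<^sup>2)"
  proof (rule integral_mono_exact_derivative[where e = "\<lambda>t. - e t" and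
      E = "\<lambda>t. - (- 2 * \<mu> * (inner (R (U1 t)) (R (U1 t)) - inner (B (U t)) (R (U t))) - 2 * inner (R (U1 t)) (B (U t)))"])
    show "(\<lambda>t. d\<^sup>2 * (norm (R (U t)))\<^sup>2) integrable_on {\<alpha>..\<beta>}"
      by (intro integrable_continuous_interval continuous_intros cs c)
    show "(\<lambda>t. (norm (R (U2 t) - (2 * \<mu>) *\<^sub>R R (U1 t) - B (U t)))\<^sup>2) integrable_on {\<alpha>..\<beta>}"
      by (intro integrable_continuous_interval continuous_intros cs c)
    fix t
    note dR = bounded_linear_has_vector_derivative[OF R dU[rule_format, of t]]
      bounded_linear_has_vector_derivative[OF R dU1[rule_format, of t]]
      bounded_linear_has_vector_derivative[OF B dU[rule_format, of t]]
    have "((\<lambda>t. - (- 2 * \<mu> * (inner (R (U1 t)) (R (U1 t)) - inner (B (U t)) (R (U t))) - 2 * inner (R (U1 t)) (B (U t))))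
      has_vector_derivative - (- 2 * \<mu> * ((inner (R (U1 t)) (R (U2 t)) + inner (R (U2 t)) (R (U1 t)))
        - (inner (B (U t)) (R (U1 t)) + inner (B (U1 t)) (R (U t))))
        - 2 * (inner (R (U1 t)) (B (U1 t)) + inner (R (U2 t)) (B (U t))))) (at t)"
      by (intro has_vector_derivative_minus has_vector_derivative_diff has_vector_derivative_mult_right
          has_vector_derivative_inner dR)
    also have "- (- 2 * \<mu> * ((inner (R (U1 t)) (R (U2 t)) + inner (R (U2 t)) (R (U1 t)))
        - (inner (B (U t)) (R (U1 t)) + inner (B (U1 t)) (R (U t))))
        - 2 * (inner (R (U1 t)) (B (U1 t)) + inner (R (U2 t)) (B (U t)))) = - e t"
      using symB[of "U1 t" "U t"] by (simp add: e_def inner_simps inner_commute algebra_simps)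
    finally show "((\<lambda>t. - (- 2 * \<mu> * (inner (R (U1 t)) (R (U1 t)) - inner (B (U t)) (R (U t))) - 2 * inner (R (U1 t)) (B (U t))))
      has_vector_derivative - e t) (at t)" .
    have eq: "(norm (R (U2 t) - (2 * \<mu>) *\<^sub>R R (U1 t) - B (U t)))\<^sup>2 + - e t
      = (norm (R (U2 t)))\<^sup>2 + (norm (B (U t)))\<^sup>2 + 4 * \<mu>\<^sup>2 * (norm (R (U1 t)))\<^sup>2 + 2 * inner (R (U1 t)) (B (U1 t))"
      by (simp only: power2_norm_eq_inner e_def)
        (simp add: inner_simps inner_commute algebra_simps power2_eq_square)
    have "- (\<gamma> + \<mu>\<^sup>2) * (norm (R (U1 t)))\<^sup>2 \<le> inner (R (U1 t)) (B (U1 t))"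
      using \<gamma>[of "U1 t"] by (simp add: B_def inner_simps inner_commute power2_norm_eq_inner algebra_simps)
    moreover have "\<gamma> * (norm (R (U1 t)))\<^sup>2 \<le> \<mu>\<^sup>2 * (norm (R (U1 t)))\<^sup>2" using \<mu> by (intro mult_right_mono) auto
    ultimately have "0 \<le> 4 * \<mu>\<^sup>2 * (norm (R (U1 t)))\<^sup>2 + 2 * inner (R (U1 t)) (B (U1 t))"
      by (simp add: algebra_simps)
    moreover have "d\<^sup>2 * (norm (R (U t)))\<^sup>2 \<le> (norm (B (U t)))\<^sup>2"
      using power_mono[OF gap[of "U t"], of 2] d by (simp add: B_def power_mult_distrib)
    ultimately show "d\<^sup>2 * (norm (R (U t)))\<^sup>2 \<le> (norm (R (U2 t) - (2 * \<mu>) *\<^sub>R R (U1 t) - B (U t)))\<^sup>2 + - e t"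
      unfolding eq by (smt (verit) zero_le_power2)
  qed (use ab bd in \<open>auto simp: linear_0[OF bounded_linear.linear[OF R]] linear_0[OF bounded_linear.linear[OF B]]\<close>)
  then show "integral {\<alpha>..\<beta>} (\<lambda>t. d\<^sup>2 * (norm (R (U t)))\<^sup>2)
     \<le> integral {\<alpha>..\<beta>} (\<lambda>t. (norm (R (U2 t) - (2 * \<mu>) *\<^sub>R R (U1 t) - (Q (U t) - \<mu>\<^sup>2 *\<^sub>R R (U t))))\<^sup>2)"
    by (simp add: B_def)
qed

text \<open>Adding the derivative of 2\<mu>(|RU'|^2 - <BU, RU>) turns the integrand into |RU'' -
  BU|^2 + 4\<mu>^2|RU'|^2. The second square is traded for |RU|^2 by a Poincare inequality, which
  brings in the length of the interval.\<close>

lemma carleman_estimate_bounded_interval: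
  assumes L: "L > 0"
  shows "carleman_estimate R Q \<mu> (\<mu> / L) L"
  unfolding carleman_estimate_def
proof (intro allI impI)
  fix U U1 U2 :: "real \<Rightarrow> 'b" and \<alpha> \<beta> :: real
  assume ab: "\<alpha> < \<beta>" and abL: "\<beta> - \<alpha> \<le> L" and dU: "\<forall>t. (U has_vector_derivative U1 t) (at t)"
    and dU1: "\<forall>t. (U1 has_vector_derivative U2 t) (at t)" and c2: "continuous_on UNIV U2"
    and bd: "U \<alpha> = 0" "U \<beta> = 0" "U1 \<alpha> = 0" "U1 \<beta> = 0"
  define B where "B x = Q x - \<mu>\<^sup>2 *\<^sub>R R x" for x
  have B: "bounded_linear B" unfolding B_def[abs_def]
    by (rule bounded_linear_sub[OF Q bounded_linear_compose[OF bounded_linear_scaleR_right R]])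
  have symB: "inner (B x) (R y) = inner (R x) (B y)" for x y by (simp add: B_def inner_simps sym)
  have c: "continuous_on S U" "continuous_on S U1" "continuous_on S U2" for S
    using dU dU1 c2 continuous_on_subset by (blast intro: has_vector_derivative_continuous_on)+
  note cs = bounded_linear.continuous_on[OF R] bounded_linear.continuous_on[OF B]
  \<comment> \<open>Chosen such that \<open>\<kappa> * (2 * L\<^sup>2)\<close> equals
    \<open>4 * \<mu>\<^sup>2\<close>: the Poincare term uses up the whole gradient term and leaves
    \<open>\<kappa> / 2 = (\<mu> / L)\<^sup>2\<close> in front of |RU|^2.\<close>
  define \<kappa> where "\<kappa> = 2 * \<mu>\<^sup>2 / L\<^sup>2"
  \<comment> \<open>The derivative of (t - \<alpha>)|RU|^2. Its lower bound |RU|^2/2 - 2L^2|RU'|^2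
    is Poincare's inequality in pointwise form.\<close>
  define g where "g t = inner (R (U t)) (R (U t)) + 2 * ((t - \<alpha>) * inner (R (U t)) (R (U1 t)))" for t
  define e where "e t = 4 * \<mu> * inner (R (U2 t) - B (U t)) (R (U1 t)) + \<kappa> * g t" for t
  have "integral {\<alpha>..\<beta>} (\<lambda>t. (\<mu>/L)\<^sup>2 * (norm (R (U t)))\<^sup>2)
     \<le> integral {\<alpha>..\<beta>} (\<lambda>t. (norm (R (U2 t) - (2 * \<mu>) *\<^sub>R R (U1 t) - B (U t)))\<^sup>2)"
  proof (rule integral_mono_exact_derivative[where e = e and
      E = "\<lambda>t. 2 * \<mu> * (inner (R (U1 t)) (R (U1 t)) - inner (B (U t)) (R (U t)))
        + \<kappa> * ((t - \<alpha>) * inner (R (U t)) (R (U t)))"])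
    show "(\<lambda>t. (\<mu>/L)\<^sup>2 * (norm (R (U t)))\<^sup>2) integrable_on {\<alpha>..\<beta>}"
      by (intro integrable_continuous_interval continuous_intros cs c)
    show "(\<lambda>t. (norm (R (U2 t) - (2 * \<mu>) *\<^sub>R R (U1 t) - B (U t)))\<^sup>2) integrable_on {\<alpha>..\<beta>}"
      by (intro integrable_continuous_interval continuous_intros cs c)
    fix t
    note dR = bounded_linear_has_vector_derivative[OF R dU[rule_format, of t]]
      bounded_linear_has_vector_derivative[OF R dU1[rule_format, of t]]
      bounded_linear_has_vector_derivative[OF B dU[rule_format, of t]]
    have dt: "((\<lambda>t. t - \<alpha>) has_vector_derivative 1) (at t)"
      by (auto intro!: derivative_eq_intros)
    have "((\<lambda>t. 2 * \<mu> * (inner (R (U1 t)) (R (U1 t)) - inner (B (U t)) (R (U t)))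
        + \<kappa> * ((t - \<alpha>) * inner (R (U t)) (R (U t))))
      has_vector_derivative (2 * \<mu> * ((inner (R (U1 t)) (R (U2 t)) + inner (R (U2 t)) (R (U1 t)))
        - (inner (B (U t)) (R (U1 t)) + inner (B (U1 t)) (R (U t))))
        + \<kappa> * ((t - \<alpha>) * (inner (R (U t)) (R (U1 t)) + inner (R (U1 t)) (R (U t))) + 1 * inner (R (U t)) (R (U t))))) (at t)"
      by (intro has_vector_derivative_add has_vector_derivative_diff has_vector_derivative_mult_right
          has_vector_derivative_inner dR real_mult_has_vector_derivative dt)
    also have "2 * \<mu> * ((inner (R (U1 t)) (R (U2 t)) + inner (R (U2 t)) (R (U1 t)))
        - (inner (B (U t)) (R (U1 t)) + inner (B (U1 t)) (R (U t))))
        + \<kappa> * ((t - \<alpha>) * (inner (R (U t)) (R (U1 t)) + inner (R (U1 t)) (R (U t))) + 1 * inner (R (U t)) (R (U t))) = e t"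
      using symB[of "U1 t" "U t"] by (simp add: e_def g_def inner_simps inner_commute algebra_simps)
    finally show "((\<lambda>t. 2 * \<mu> * (inner (R (U1 t)) (R (U1 t)) - inner (B (U t)) (R (U t)))
        + \<kappa> * ((t - \<alpha>) * inner (R (U t)) (R (U t)))) has_vector_derivative e t) (at t)" .
    assume t: "t \<in> {\<alpha>..\<beta>}"
    have eq: "(norm (R (U2 t) - (2 * \<mu>) *\<^sub>R R (U1 t) - B (U t)))\<^sup>2 + 4 * \<mu> * inner (R (U2 t) - B (U t)) (R (U1 t))
      = (norm (R (U2 t) - B (U t)))\<^sup>2 + 4 * \<mu>\<^sup>2 * (norm (R (U1 t)))\<^sup>2"
      by (simp only: power2_norm_eq_inner)
        (simp add: inner_simps inner_commute algebra_simps power2_eq_square)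
    define x y where "x = norm (R (U t))" and "y = norm (R (U1 t))"
    have "\<bar>(t - \<alpha>) * inner (R (U t)) (R (U1 t))\<bar> \<le> L * (x * y)"
      unfolding abs_mult x_def y_def using t abL L by (intro mult_mono Cauchy_Schwarz_ineq2) auto
    moreover have "inner (R (U t)) (R (U t)) = x\<^sup>2" by (simp add: x_def power2_norm_eq_inner)
    ultimately have "g t \<ge> x\<^sup>2 - 2 * (L * (x * y))" unfolding g_def by linarith
    moreover have "0 \<le> (x - 2 * L * y)\<^sup>2" by simp
    ultimately have "x\<^sup>2 / 2 - 2 * L\<^sup>2 * y\<^sup>2 \<le> g t"
      by (simp add: power2_eq_square algebra_simps)
    then have "\<kappa> * (x\<^sup>2 / 2 - 2 * L\<^sup>2 * y\<^sup>2) \<le> \<kappa> * g t" by (intro mult_left_mono) (auto simp: \<kappa>_def)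
    moreover have "\<kappa> * (x\<^sup>2 / 2 - 2 * L\<^sup>2 * y\<^sup>2) = (\<mu> / L)\<^sup>2 * x\<^sup>2 - 4 * \<mu>\<^sup>2 * y\<^sup>2"
      using L by (simp add: \<kappa>_def field_simps)
    ultimately show "(\<mu>/L)\<^sup>2 * (norm (R (U t)))\<^sup>2 \<le> (norm (R (U2 t) - (2 * \<mu>) *\<^sub>R R (U1 t) - B (U t)))\<^sup>2 + e t"
      using eq zero_le_power2[of "norm (R (U2 t) - B (U t))"] unfolding e_def x_def y_def by linarith
  qed (use ab bd in \<open>auto simp: linear_0[OF bounded_linear.linear[OF R]] linear_0[OF bounded_linear.linear[OF B]]\<close>)
  then show "integral {\<alpha>..\<beta>} (\<lambda>t. (\<mu>/L)\<^sup>2 * (norm (R (U t)))\<^sup>2)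
     \<le> integral {\<alpha>..\<beta>} (\<lambda>t. (norm (R (U2 t) - (2 * \<mu>) *\<^sub>R R (U1 t) - (Q (U t) - \<mu>\<^sup>2 *\<^sub>R R (U t))))\<^sup>2)"
    by (simp add: B_def)
qed

text \<open>The terms with \<open>\<Phi>1\<close> are removed by testing the equation against \<open>(\<eta>1 e\<^bsup>\<mu>t\<^esup>)\<^sup>2 \<Phi>\<close> (a Caccioppoli
  inequality).\<close>

lemma localized_carleman_estimate:
  fixes \<Phi> \<Phi>1 \<Phi>2 :: "real \<Rightarrow> 'b" and \<eta> \<eta>1 \<eta>2 :: "real \<Rightarrow> real"
  assumes carl: "carleman_estimate R Q \<mu> d L" and ab: "\<alpha> < \<beta>" "\<beta> - \<alpha> \<le> L"
    and \<gamma>: "\<And>x. - \<gamma> * (norm (R x))\<^sup>2 \<le> inner (Q x) (R x)"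
    and \<Phi>: "\<And>t. (\<Phi> has_vector_derivative \<Phi>1 t) (at t)" "\<And>t. (\<Phi>1 has_vector_derivative \<Phi>2 t) (at t)"
      "continuous_on UNIV \<Phi>2"
    and \<eta>: "\<And>t. (\<eta> has_vector_derivative \<eta>1 t) (at t)" "\<And>t. (\<eta>1 has_vector_derivative \<eta>2 t) (at t)"
      "continuous_on UNIV \<eta>2"
    and bd: "\<eta> \<alpha> = 0" "\<eta>1 \<alpha> = 0" "\<eta> \<beta> = 0" "\<eta>1 \<beta> = 0"
  shows "integral {\<alpha>..\<beta>} (\<lambda>t. d\<^sup>2 * (exp (2 * \<mu> * t) * (\<eta> t)\<^sup>2 * (norm (R (\<Phi> t)))\<^sup>2))
    \<le> integral {\<alpha>..\<beta>} (\<lambda>t. exp (2 * \<mu> * t) * ((2 * (\<eta> t)\<^sup>2 + 16 * (\<eta>1 t)\<^sup>2) * (norm (R (\<Phi>2 t) - Q (\<Phi> t)))\<^sup>2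
        + (16 * (2 * \<gamma> + 1) * (\<eta>1 t)\<^sup>2 + 64 * (\<eta>2 t + \<mu> * \<eta>1 t)\<^sup>2 + 4 * (\<eta>2 t)\<^sup>2) * (norm (R (\<Phi> t)))\<^sup>2))"
proof -
  note linR = bounded_linear.linear[OF R] and linQ = bounded_linear.linear[OF Q]
  define E where "E t = exp (\<mu> * t)" for t
  have dE: "(E has_vector_derivative \<mu> * E t) (at t)" for t
    unfolding E_def[abs_def] has_real_derivative_iff_has_vector_derivative[symmetric]
    by (auto intro!: derivative_eq_intros)
  have E2: "exp (2 * \<mu> * t) = (E t)\<^sup>2" for t by (simp add: E_def power2_eq_square flip: exp_add)
  define F where "F t = R (\<Phi>2 t) - Q (\<Phi> t)" for t
  define w w1 w2 where "w t = \<eta> t * E t" and "w1 t = \<eta> t * (\<mu> * E t) + \<eta>1 t * E t"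
    and "w2 t = (\<eta> t * (\<mu> * (\<mu> * E t)) + \<eta>1 t * (\<mu> * E t)) + (\<eta>1 t * (\<mu> * E t) + \<eta>2 t * E t)" for t
  have dw: "(w has_vector_derivative w1 t) (at t)" "(w1 has_vector_derivative w2 t) (at t)" for t
    unfolding w_def[abs_def] w1_def[abs_def] w2_def
    by (intro has_vector_derivative_add real_mult_has_vector_derivative has_vector_derivative_mult_right \<eta> dE)+
  have cE: "continuous_on S E" for S by (rule has_vector_derivative_continuous_on[OF dE])
  have c\<eta>: "continuous_on S \<eta>" "continuous_on S \<eta>1" "continuous_on S \<eta>2" for S
    using has_vector_derivative_continuous_on[OF \<eta>(1)] has_vector_derivative_continuous_on[OF \<eta>(2)]
      continuous_on_subset[OF \<eta>(3)] by auto
  have c\<Phi>: "continuous_on S \<Phi>" "continuous_on S \<Phi>1" "continuous_on S \<Phi>2" for S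
    using has_vector_derivative_continuous_on[OF \<Phi>(1)] has_vector_derivative_continuous_on[OF \<Phi>(2)]
      continuous_on_subset[OF \<Phi>(3)] by auto
  note cRQ = bounded_linear.continuous_on[OF R] bounded_linear.continuous_on[OF Q]
  define U U1 U2 where "U t = w t *\<^sub>R \<Phi> t" and "U1 t = w t *\<^sub>R \<Phi>1 t + w1 t *\<^sub>R \<Phi> t"
    and "U2 t = (w t *\<^sub>R \<Phi>2 t + w1 t *\<^sub>R \<Phi>1 t) + (w1 t *\<^sub>R \<Phi>1 t + w2 t *\<^sub>R \<Phi> t)" for t
  have dU: "(U has_vector_derivative U1 t) (at t)" "(U1 has_vector_derivative U2 t) (at t)" for t
    unfolding U_def[abs_def] U1_def[abs_def] U2_def
    by (intro has_vector_derivative_add bounded_bilinear.has_vector_derivative[OF bounded_bilinear_scaleR] \<Phi> dw)+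
  have cU2: "continuous_on UNIV U2"
    unfolding U2_def[abs_def] w_def w1_def w2_def by (intro continuous_intros c\<eta> c\<Phi> cE)
  have bU: "U \<alpha> = 0" "U \<beta> = 0" "U1 \<alpha> = 0" "U1 \<beta> = 0"
    by (simp_all add: U_def U1_def w_def w1_def bd)
  \<comment> \<open>Conjugation with the exponential turns the operator into the original one;
    besides \<eta>F only the commutator with the cutoff remains, which lives where the derivatives
    of \<eta> do.\<close>
  have f: "R (U2 t) - (2 * \<mu>) *\<^sub>R R (U1 t) - (Q (U t) - \<mu>\<^sup>2 *\<^sub>R R (U t))
      = E t *\<^sub>R (\<eta> t *\<^sub>R F t + (2 * \<eta>1 t) *\<^sub>R R (\<Phi>1 t) + \<eta>2 t *\<^sub>R R (\<Phi> t))" for t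
  proof -
    have 1: "w2 t - 2 * \<mu> * w1 t + \<mu>\<^sup>2 * w t = E t * \<eta>2 t" "2 * w1 t - 2 * \<mu> * w t = E t * (2 * \<eta>1 t)" "w t = E t * \<eta> t"
      by (simp_all add: w_def w1_def w2_def algebra_simps power2_eq_square)
    have "R (U2 t) - (2 * \<mu>) *\<^sub>R R (U1 t) - (Q (U t) - \<mu>\<^sup>2 *\<^sub>R R (U t))
      = w t *\<^sub>R F t + (2 * w1 t - 2 * \<mu> * w t) *\<^sub>R R (\<Phi>1 t) + (w2 t - 2 * \<mu> * w1 t + \<mu>\<^sup>2 * w t) *\<^sub>R R (\<Phi> t)"
      by (simp add: U_def U1_def U2_def F_def linear_add[OF linR] linear_scale[OF linR] linear_scale[OF linQ]
          algebra_simps scaleR_2[symmetric] scaleR_left.add)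
    then show ?thesis unfolding 1(1) 1(2) by (simp add: 1(3) scaleR_add_right)
  qed
  let ?V = "\<lambda>t. (norm (R (\<Phi> t)))\<^sup>2" and ?V1 = "\<lambda>t. (norm (R (\<Phi>1 t)))\<^sup>2" and ?F = "\<lambda>t. (norm (F t))\<^sup>2"
  have cF: "continuous_on S F" for S unfolding F_def[abs_def] by (intro continuous_intros cRQ c\<Phi>)
  have "integral {\<alpha>..\<beta>} (\<lambda>t. d\<^sup>2 * (norm (R (U t)))\<^sup>2) \<le> integral {\<alpha>..\<beta>}
      (\<lambda>t. (norm (R (U2 t) - (2 * \<mu>) *\<^sub>R R (U1 t) - (Q (U t) - \<mu>\<^sup>2 *\<^sub>R R (U t))))\<^sup>2)"
    using carl dU cU2 bU ab unfolding carleman_estimate_def by blast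
  also have "(\<lambda>t. d\<^sup>2 * (norm (R (U t)))\<^sup>2) = (\<lambda>t. d\<^sup>2 * (exp (2 * \<mu> * t) * (\<eta> t)\<^sup>2 * ?V t))"
    by (simp add: fun_eq_iff U_def linear_scale[OF linR] w_def E2 power_mult_distrib)
  also have "integral {\<alpha>..\<beta>} (\<lambda>t. (norm (R (U2 t) - (2 * \<mu>) *\<^sub>R R (U1 t) - (Q (U t) - \<mu>\<^sup>2 *\<^sub>R R (U t))))\<^sup>2)
    \<le> integral {\<alpha>..\<beta>} (\<lambda>t. (E t)\<^sup>2 * ((2 * (\<eta> t)\<^sup>2 + 16 * (\<eta>1 t)\<^sup>2) * ?F t
        + (16 * (2 * \<gamma> + 1) * (\<eta>1 t)\<^sup>2 + 64 * (\<eta>2 t + \<mu> * \<eta>1 t)\<^sup>2 + 4 * (\<eta>2 t)\<^sup>2) * ?V t))"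
  \<comment> \<open>The exact derivative tests the equation; its factor 32 is 16, the coefficient of
    (\<eta>1)^2|R\<Phi>1|^2 to be removed, times the 2 of the inequality
    \<open>cacc\<close>.\<close>
  proof (rule integral_mono_exact_derivative[where E = "\<lambda>t. 32 * ((\<eta>1 t * E t * (\<eta>1 t * E t)) * inner (R (\<Phi>1 t)) (R (\<Phi> t)))"
      and e = "\<lambda>t. 32 * ((\<eta>1 t * E t * (\<eta>1 t * E t)) * (inner (R (\<Phi>1 t)) (R (\<Phi>1 t)) + inner (R (\<Phi>2 t)) (R (\<Phi> t)))
        + (\<eta>1 t * E t * (\<eta>1 t * (\<mu> * E t) + \<eta>2 t * E t) + (\<eta>1 t * (\<mu> * E t) + \<eta>2 t * E t) * (\<eta>1 t * E t)) * inner (R (\<Phi>1 t)) (R (\<Phi> t)))"])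
    show "(\<lambda>t. (norm (R (U2 t) - (2 * \<mu>) *\<^sub>R R (U1 t) - (Q (U t) - \<mu>\<^sup>2 *\<^sub>R R (U t))))\<^sup>2) integrable_on {\<alpha>..\<beta>}"
      unfolding f by (intro integrable_continuous_interval continuous_intros cRQ c\<Phi> c\<eta> cE cF)
    show "(\<lambda>t. (E t)\<^sup>2 * ((2 * (\<eta> t)\<^sup>2 + 16 * (\<eta>1 t)\<^sup>2) * ?F t
        + (16 * (2 * \<gamma> + 1) * (\<eta>1 t)\<^sup>2 + 64 * (\<eta>2 t + \<mu> * \<eta>1 t)\<^sup>2 + 4 * (\<eta>2 t)\<^sup>2) * ?V t)) integrable_on {\<alpha>..\<beta>}"
      by (intro integrable_continuous_interval continuous_intros cRQ c\<Phi> c\<eta> cE cF)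
    fix t
    show "((\<lambda>t. 32 * ((\<eta>1 t * E t * (\<eta>1 t * E t)) * inner (R (\<Phi>1 t)) (R (\<Phi> t)))) has_vector_derivative
      32 * ((\<eta>1 t * E t * (\<eta>1 t * E t)) * (inner (R (\<Phi>1 t)) (R (\<Phi>1 t)) + inner (R (\<Phi>2 t)) (R (\<Phi> t)))
        + (\<eta>1 t * E t * (\<eta>1 t * (\<mu> * E t) + \<eta>2 t * E t) + (\<eta>1 t * (\<mu> * E t) + \<eta>2 t * E t) * (\<eta>1 t * E t)) * inner (R (\<Phi>1 t)) (R (\<Phi> t)))) (at t)"
      by (intro has_vector_derivative_mult_right real_mult_has_vector_derivative has_vector_derivative_inner
          bounded_linear_has_vector_derivative[OF R] \<Phi> \<eta> dE)
    \<comment> \<open>The derivative of \<eta>1 e^(\<mu>t) is \<open>b\<close> times the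
      exponential, so the exact derivative involves \<open>a\<close> and \<open>b\<close>
      only.\<close>
    define a b where "a = \<eta>1 t" and "b = \<eta>2 t + \<mu> * \<eta>1 t"
    define X Y Z where "X = norm (F t)" and "Y = norm (R (\<Phi>1 t))" and "Z = norm (R (\<Phi> t))"
    define p q where "p = inner (R (\<Phi>2 t)) (R (\<Phi> t))" and "q = inner (R (\<Phi>1 t)) (R (\<Phi> t))"
    have N: "(norm (R (U2 t) - (2 * \<mu>) *\<^sub>R R (U1 t) - (Q (U t) - \<mu>\<^sup>2 *\<^sub>R R (U t))))\<^sup>2
        \<le> (E t)\<^sup>2 * (2 * (\<eta> t)\<^sup>2 * X\<^sup>2 + 16 * a\<^sup>2 * Y\<^sup>2 + 4 * (\<eta>2 t)\<^sup>2 * Z\<^sup>2)"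
    proof -
      have sq: "(norm (x + y))\<^sup>2 \<le> 2 * (norm x)\<^sup>2 + 2 * (norm y)\<^sup>2" for x y :: 'b
      proof -
        have "0 \<le> (norm (x - y))\<^sup>2" by simp
        then show ?thesis by (simp add: power2_norm_eq_inner inner_simps inner_commute)
      qed
      have "(norm (\<eta> t *\<^sub>R F t + (2 * \<eta>1 t) *\<^sub>R R (\<Phi>1 t) + \<eta>2 t *\<^sub>R R (\<Phi> t)))\<^sup>2
        \<le> 2 * (norm (\<eta> t *\<^sub>R F t))\<^sup>2 + 2 * (2 * (norm ((2 * \<eta>1 t) *\<^sub>R R (\<Phi>1 t)))\<^sup>2 + 2 * (norm (\<eta>2 t *\<^sub>R R (\<Phi> t)))\<^sup>2)"
        unfolding add.assoc by (rule order_trans[OF sq add_left_mono[OF mult_left_mono[OF sq]]]) simp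
      also have "\<dots> = 2 * (\<eta> t)\<^sup>2 * X\<^sup>2 + 16 * a\<^sup>2 * Y\<^sup>2 + 4 * (\<eta>2 t)\<^sup>2 * Z\<^sup>2"
        by (simp add: power_mult_distrib a_def X_def Y_def Z_def)
      finally show ?thesis unfolding f by (simp add: power_mult_distrib mult_left_mono)
    qed
    \<comment> \<open>Of the two copies of a^2 Y^2 on the right, one is spent on the mixed term by
      4|ab|YZ \<le> a^2 Y^2 + 4b^2 Z^2; the lower bound on the operator controls its part in
      \<open>p\<close>.\<close>
    have cacc: "a\<^sup>2 * Y\<^sup>2 \<le> 2 * (a\<^sup>2 * (Y\<^sup>2 + p) + 2 * a * b * q) + a\<^sup>2 * X\<^sup>2 + ((1 + 2 * \<gamma>) * a\<^sup>2 + 4 * b\<^sup>2) * Z\<^sup>2"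
    proof -
      have p: "p = inner (F t) (R (\<Phi> t)) + inner (Q (\<Phi> t)) (R (\<Phi> t))"
        by (simp add: p_def F_def inner_simps)
      have "\<bar>inner (F t) (R (\<Phi> t))\<bar> \<le> X * Z" unfolding X_def Z_def by (rule Cauchy_Schwarz_ineq2)
      moreover have "- (\<gamma> * Z\<^sup>2) \<le> inner (Q (\<Phi> t)) (R (\<Phi> t))" using \<gamma>[of "\<Phi> t"] by (simp add: Z_def)
      ultimately have "2 * p \<ge> - 2 * (X * Z) - 2 * (\<gamma> * Z\<^sup>2)" unfolding p distrib_left by linarith
      moreover have "2 * (X * Z) \<le> X\<^sup>2 + Z\<^sup>2" using sum_squares_bound[of X Z] by simp
      ultimately have "2 * p \<ge> - X\<^sup>2 - Z\<^sup>2 - 2 * (\<gamma> * Z\<^sup>2)" by linarith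
      from mult_left_mono[OF this, of "a\<^sup>2"]
      have 1: "a\<^sup>2 * (2 * p) \<ge> a\<^sup>2 * (- X\<^sup>2 - Z\<^sup>2 - 2 * (\<gamma> * Z\<^sup>2))" by simp
      have "\<bar>q\<bar> \<le> Y * Z" unfolding q_def Y_def Z_def by (rule Cauchy_Schwarz_ineq2)
      then have "\<bar>a * b\<bar> * \<bar>q\<bar> \<le> \<bar>a * b\<bar> * (Y * Z)" by (intro mult_left_mono) auto
      then have "\<bar>a * b * q\<bar> \<le> \<bar>a * b\<bar> * (Y * Z)" by (simp only: abs_mult)
      then have "4 * (a * b * q) \<ge> - (4 * (\<bar>a * b\<bar> * (Y * Z)))" by linarith
      moreover have "0 \<le> (\<bar>a\<bar> * Y - 2 * \<bar>b\<bar> * Z)\<^sup>2" by simp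
      then have "4 * (\<bar>a * b\<bar> * (Y * Z)) \<le> a\<^sup>2 * Y\<^sup>2 + 4 * b\<^sup>2 * Z\<^sup>2"
        by (simp add: power2_diff power_mult_distrib abs_mult mult_ac)
      ultimately have "4 * (a * b * q) \<ge> - (a\<^sup>2 * Y\<^sup>2) - 4 * b\<^sup>2 * Z\<^sup>2" by linarith
      with 1 show ?thesis by (simp add: algebra_simps)
    qed
    have "(E t)\<^sup>2 * (2 * (\<eta> t)\<^sup>2 * X\<^sup>2 + 16 * a\<^sup>2 * Y\<^sup>2 + 4 * (\<eta>2 t)\<^sup>2 * Z\<^sup>2)
      \<le> (E t)\<^sup>2 * (2 * (\<eta> t)\<^sup>2 * X\<^sup>2 + 16 * (2 * (a\<^sup>2 * (Y\<^sup>2 + p) + 2 * a * b * q) + a\<^sup>2 * X\<^sup>2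
          + ((1 + 2 * \<gamma>) * a\<^sup>2 + 4 * b\<^sup>2) * Z\<^sup>2) + 4 * (\<eta>2 t)\<^sup>2 * Z\<^sup>2)"
      using cacc by (intro mult_left_mono) auto
    also have "\<dots> = (E t)\<^sup>2 * ((2 * (\<eta> t)\<^sup>2 + 16 * a\<^sup>2) * X\<^sup>2 + (16 * (2 * \<gamma> + 1) * a\<^sup>2 + 64 * b\<^sup>2 + 4 * (\<eta>2 t)\<^sup>2) * Z\<^sup>2)
       + 32 * ((a * E t * (a * E t)) * (Y\<^sup>2 + p) + (a * E t * (b * E t) + (b * E t) * (a * E t)) * q)"
      by (simp add: algebra_simps power2_eq_square)
    finally have N2: "(E t)\<^sup>2 * (2 * (\<eta> t)\<^sup>2 * X\<^sup>2 + 16 * a\<^sup>2 * Y\<^sup>2 + 4 * (\<eta>2 t)\<^sup>2 * Z\<^sup>2) \<le>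
       (E t)\<^sup>2 * ((2 * (\<eta> t)\<^sup>2 + 16 * a\<^sup>2) * X\<^sup>2 + (16 * (2 * \<gamma> + 1) * a\<^sup>2 + 64 * b\<^sup>2 + 4 * (\<eta>2 t)\<^sup>2) * Z\<^sup>2)
       + 32 * ((a * E t * (a * E t)) * (Y\<^sup>2 + p) + (a * E t * (b * E t) + (b * E t) * (a * E t)) * q)" .
    show "(norm (R (U2 t) - (2 * \<mu>) *\<^sub>R R (U1 t) - (Q (U t) - \<mu>\<^sup>2 *\<^sub>R R (U t))))\<^sup>2
      \<le> (E t)\<^sup>2 * ((2 * (\<eta> t)\<^sup>2 + 16 * (\<eta>1 t)\<^sup>2) * ?F t
        + (16 * (2 * \<gamma> + 1) * (\<eta>1 t)\<^sup>2 + 64 * (\<eta>2 t + \<mu> * \<eta>1 t)\<^sup>2 + 4 * (\<eta>2 t)\<^sup>2) * ?V t)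
       + 32 * ((\<eta>1 t * E t * (\<eta>1 t * E t)) * (inner (R (\<Phi>1 t)) (R (\<Phi>1 t)) + inner (R (\<Phi>2 t)) (R (\<Phi> t)))
        + (\<eta>1 t * E t * (\<eta>1 t * (\<mu> * E t) + \<eta>2 t * E t) + (\<eta>1 t * (\<mu> * E t) + \<eta>2 t * E t) * (\<eta>1 t * E t)) * inner (R (\<Phi>1 t)) (R (\<Phi> t)))"
    proof -
      have b: "\<eta>1 t * (\<mu> * E t) + \<eta>2 t * E t = b * E t" by (simp add: b_def algebra_simps)
      show ?thesis using order_trans[OF N N2]
        unfolding b unfolding b_def[symmetric] unfolding a_def[symmetric] p_def[symmetric] q_def[symmetric] X_def[symmetric] Y_def[symmetric]
          Z_def[symmetric] power2_norm_eq_inner[of "R (\<Phi>1 t)", symmetric] .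
    qed
  qed (use ab(1) bd in auto)
  finally show ?thesis unfolding E2 F_def .
qed

end

section \<open>Cutoffs and resolvents\<close>

lemma continuous_compact_support_bounded:
  fixes f :: "real \<Rightarrow> real"
  assumes "continuous_on UNIV f" "\<And>x. x \<notin> {0<..<1} \<Longrightarrow> f x = 0"
  obtains K where "K \<ge> 0" "\<And>x. \<bar>f x\<bar> \<le> K"
proof -
  have "compact (f ` {0..1})" by (intro compact_continuous_image continuous_on_subset[OF assms(1)]) auto
  then have "bounded (f ` {0..1})" by (rule compact_imp_bounded)
  then obtain K where K: "\<forall>y\<in>f ` {0..1}. norm y \<le> K" using bounded_iff by blast
  have "\<bar>f x\<bar> \<le> max K 0" for x
  proof (cases "x \<in> {0..1}")
    case True
    then show ?thesis using K by force
  next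
    case False
    then have "x \<notin> {0<..<1}" by auto
    then show ?thesis using assms(2) by simp
  qed
  then show ?thesis using that[of "max K 0"] by simp
qed

lemma smooth_step_exists:
  obtains s s1 s2 :: "real \<Rightarrow> real" and K where
    "\<And>x. (s has_real_derivative s1 x) (at x)" "\<And>x. (s1 has_real_derivative s2 x) (at x)" "continuous_on UNIV s2"
    "\<And>x. 0 \<le> s x \<and> s x \<le> 1" "\<And>x. x \<le> 0 \<Longrightarrow> s x = 0" "\<And>x. x \<ge> 1 \<Longrightarrow> s x = 1"
    "\<And>x. x \<notin> {0<..<1} \<Longrightarrow> s1 x = 0 \<and> s2 x = 0" "K \<ge> 0" "\<And>x. \<bar>s1 x\<bar> \<le> K" "\<And>x. \<bar>s2 x\<bar> \<le> K"
proof -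
  obtain \<beta> \<beta>1 \<beta>2 :: "real \<Rightarrow> real" where d: "\<And>x. (\<beta> has_real_derivative \<beta>1 x) (at x)"
    "\<And>x. (\<beta>1 has_real_derivative \<beta>2 x) (at x)" and nn: "\<And>x. 0 \<le> \<beta> x"
    and z: "\<And>x. x \<notin> {0<..<1} \<Longrightarrow> \<beta> x = 0 \<and> \<beta>1 x = 0" and m: "(\<beta> has_integral 1) {0..1}"
    using unit_bump_exists by (metis (no_types))
  have c: "continuous_on S \<beta>" "continuous_on S \<beta>1" for S
    using DERIV_continuous_on[OF has_field_derivative_at_within[OF d(1)]]
      DERIV_continuous_on[OF has_field_derivative_at_within[OF d(2)]] by auto
  obtain K0 K1 where K: "K0 \<ge> 0" "\<And>x. \<bar>\<beta> x\<bar> \<le> K0" "K1 \<ge> 0" "\<And>x. \<bar>\<beta>1 x\<bar> \<le> K1"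
    using continuous_compact_support_bounded[OF c(1)] continuous_compact_support_bounded[OF c(2)] z by metis
  have int: "\<beta> integrable_on {x..y}" for x y by (rule integrable_continuous_interval[OF c(1)])
  \<comment> \<open>The upper limit is clipped to [-1, 2] so that all integrals live on one compact
    interval. The integrand vanishes outside (0, 1), so the clipping has no effect on the
    values.\<close>
  define s where "s t = integral {-1..max (-1) (min 2 t)} \<beta>" for t
  have G0: "integral {-1..t} \<beta> = 0" if "t \<le> 0" for t
    using integral_cong[of "{-1..t}" \<beta> "\<lambda>_. 0"] z that by auto
  have G01: "integral {-1..1} \<beta> = 1"
    using Henstock_Kurzweil_Integration.integral_combine[OF _ _ int, of "-1" 0 1] G0[of 0] m by (simp add: integral_unique)
  have G1: "integral {-1..t} \<beta> = 1" if "t \<ge> 1" for t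
    using Henstock_Kurzweil_Integration.integral_combine[OF _ _ int, of "-1" 1 t] integral_cong[of "{1..t}" \<beta> "\<lambda>_. 0"] z that G01 by auto
  have s0: "s x = 0" if "x \<le> 0" for x using that G0 by (simp add: s_def)
  have s1: "s x = 1" if "x \<ge> 1" for x using that G1 by (simp add: s_def)
  have s01: "0 \<le> s x \<and> s x \<le> 1" for x
  proof -
    have "0 \<le> s x" unfolding s_def by (intro integral_nonneg int nn)
    moreover have "s x \<le> integral {-1..2} \<beta>" unfolding s_def by (intro integral_subset_le int) (auto intro: nn)
    ultimately show ?thesis using G1[of 2] by simp
  qed
  have ds: "(s has_real_derivative \<beta> x) (at x)" for x
  proof -
    consider "x < 0" | "x > 1" | "-1 < x \<and> x < 2" by linarith
    then show ?thesis
    proof cases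
      case 1
      have "((\<lambda>_. 0) has_real_derivative \<beta> x) (at x)" using z[of x] 1 by simp
      then show ?thesis
        by (rule has_field_derivative_transform_within_open[of _ _ _ "{..<0}"]) (use 1 s0 in auto)
    next
      case 2
      have "((\<lambda>_. 1) has_real_derivative \<beta> x) (at x)" using z[of x] 2 by simp
      then show ?thesis
        by (rule has_field_derivative_transform_within_open[of _ _ _ "{1<..}"]) (use 2 s1 in auto)
    next
      case 3
      have "((\<lambda>u. integral {-1..u} \<beta>) has_vector_derivative \<beta> x) (at x within {-1..2})"
        using 3 by (intro integral_has_vector_derivative c) auto
      moreover have "at x within {-1..2} = at x" using 3 by (intro at_within_interior) auto
      ultimately have "((\<lambda>u. integral {-1..u} \<beta>) has_real_derivative \<beta> x) (at x)"
        by (simp add: has_real_derivative_iff_has_vector_derivative)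
      then show ?thesis
        by (rule has_field_derivative_transform_within_open[of _ _ _ "{-1<..<2}"]) (use 3 in \<open>auto simp: s_def\<close>)
    qed
  qed
  show ?thesis
  proof (rule that[OF ds d(1) c(2) s01 s0 s1 z])
    show "0 \<le> max K0 K1" using K by simp
    show "\<bar>\<beta> x\<bar> \<le> max K0 K1" "\<bar>\<beta>1 x\<bar> \<le> max K0 K1" for x using K(2,4)[of x] by auto
  qed auto
qed

abbreviation smooth_cutoff :: "real \<Rightarrow> real \<Rightarrow> real \<Rightarrow> real \<Rightarrow> (real \<Rightarrow> real) \<Rightarrow> (real \<Rightarrow> real) \<Rightarrow> (real \<Rightarrow> real) \<Rightarrow> bool"
  where "smooth_cutoff a r T K \<eta> \<eta>1 \<eta>2 \<equiv> (\<forall>t. (\<eta> has_vector_derivative \<eta>1 t) (at t)) \<and>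
     (\<forall>t. (\<eta>1 has_vector_derivative \<eta>2 t) (at t)) \<and> continuous_on UNIV \<eta>2 \<and> (\<forall>t::real. 0 \<le> \<eta> t \<and> \<eta> t \<le> 1) \<and>
     (\<forall>t\<in>{a + r..T}. \<eta> t = 1) \<and> (\<forall>t. t \<notin> {a<..<a + r} \<union> {T<..<T + r} \<longrightarrow> \<eta>1 t = 0 \<and> \<eta>2 t = 0) \<and>
     (\<forall>t. \<bar>\<eta>1 t\<bar> \<le> K \<and> \<bar>\<eta>2 t\<bar> \<le> K) \<and> \<eta> a = 0 \<and> \<eta> (T + r) = 0"

text \<open>The cutoff is a difference of two translates of a smooth step of width \<open>r\<close>,
  so its derivative bound \<open>K\<close> depends on \<open>r\<close> alone. This uniformity
  matters when \<open>T\<close> tends to infinity.\<close>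

lemma cutoff_exists:
  assumes r: "r > 0"
  obtains K :: real where "K \<ge> 0" "\<And>a T. a + r \<le> T \<Longrightarrow> \<exists>\<eta> \<eta>1 \<eta>2. smooth_cutoff a r T K \<eta> \<eta>1 \<eta>2"
proof -
  obtain s s1 s2 :: "real \<Rightarrow> real" and K where s:
    "\<And>x. (s has_real_derivative s1 x) (at x)" "\<And>x. (s1 has_real_derivative s2 x) (at x)" "continuous_on UNIV s2"
    "\<And>x. 0 \<le> s x \<and> s x \<le> 1" "\<And>x. x \<le> 0 \<Longrightarrow> s x = 0" "\<And>x. x \<ge> 1 \<Longrightarrow> s x = 1"
    "\<And>x. x \<notin> {0<..<1} \<Longrightarrow> s1 x = 0 \<and> s2 x = 0" "K \<ge> 0" "\<And>x. \<bar>s1 x\<bar> \<le> K" "\<And>x. \<bar>s2 x\<bar> \<le> K"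
    using smooth_step_exists by (metis (no_types))
  define K' where "K' = K / r + K / r\<^sup>2"
  have K': "K / r \<le> K'" "K / r\<^sup>2 \<le> K'" "0 \<le> K'" using s(8) r by (auto simp: K'_def)
  show ?thesis
  proof (rule that[OF K'(3)])
    fix a T :: real assume aT: "a + r \<le> T"
    define p q where "p t = (t - a) / r" and "q t = (t - T) / r" for t
    define \<eta> \<eta>1 \<eta>2 where "\<eta> t = s (p t) - s (q t)" and "\<eta>1 t = (s1 (p t) - s1 (q t)) / r"
      and "\<eta>2 t = (s2 (p t) - s2 (q t)) / r\<^sup>2" for t
    have dp: "(p has_real_derivative 1 / r) (at t)" "(q has_real_derivative 1 / r) (at t)" for t
      unfolding p_def[abs_def] q_def[abs_def] using r by (auto intro!: derivative_eq_intros)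
    have sp: "((\<lambda>t. s (p t)) has_real_derivative s1 (p t) * (1 / r)) (at t)"
      "((\<lambda>t. s (q t)) has_real_derivative s1 (q t) * (1 / r)) (at t)"
      "((\<lambda>t. s1 (p t)) has_real_derivative s2 (p t) * (1 / r)) (at t)"
      "((\<lambda>t. s1 (q t)) has_real_derivative s2 (q t) * (1 / r)) (at t)" for t
      by (rule DERIV_chain2[OF s(1) dp(1)] DERIV_chain2[OF s(1) dp(2)] DERIV_chain2[OF s(2) dp(1)] DERIV_chain2[OF s(2) dp(2)])+
    have "(\<eta> has_vector_derivative \<eta>1 t) (at t)" for t
      unfolding has_real_derivative_iff_has_vector_derivative[symmetric] \<eta>_def[abs_def]
      using DERIV_diff[OF sp(1,2)] by (simp add: \<eta>1_def diff_divide_distrib)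
    moreover have "(\<eta>1 has_vector_derivative \<eta>2 t) (at t)" for t
      unfolding has_real_derivative_iff_has_vector_derivative[symmetric] \<eta>1_def[abs_def]
      using DERIV_cdivide[OF DERIV_diff[OF sp(3,4)], of r] by (simp add: \<eta>2_def diff_divide_distrib power2_eq_square)
    moreover have "continuous_on UNIV \<eta>2"
    proof -
      have "continuous_on UNIV (\<lambda>t. s2 (p t))" "continuous_on UNIV (\<lambda>t. s2 (q t))"
        unfolding p_def q_def by (intro continuous_on_compose2[OF s(3)] continuous_intros; use r in simp)+
      then show ?thesis unfolding \<eta>2_def[abs_def] using r by (intro continuous_intros) auto
    qed
    moreover have "0 \<le> \<eta> t \<and> \<eta> t \<le> 1" for t
    proof (cases "q t \<le> 0")
      case True
      then show ?thesis using s(4)[of "p t"] s(5)[of "q t"] by (simp add: \<eta>_def)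
    next
      case False
      then have "p t \<ge> 1" using r aT by (simp add: p_def q_def field_simps)
      then show ?thesis using s(4)[of "q t"] s(6)[of "p t"] by (simp add: \<eta>_def)
    qed
    moreover have "\<eta> t = 1" if "t \<in> {a + r..T}" for t
    proof -
      have "p t \<ge> 1" "q t \<le> 0" using that r by (auto simp: p_def q_def field_simps)
      then show ?thesis using s(5)[of "q t"] s(6)[of "p t"] by (simp add: \<eta>_def)
    qed
    moreover have pq: "p t \<notin> {0<..<1} \<and> q t \<notin> {0<..<1}" if "t \<notin> {a<..<a + r} \<union> {T<..<T + r}" for t
      using that r by (auto simp: p_def q_def field_simps)
    moreover have "\<eta>1 t = 0 \<and> \<eta>2 t = 0" if "t \<notin> {a<..<a + r} \<union> {T<..<T + r}" for t
      using s(7)[of "p t"] s(7)[of "q t"] pq[OF that] by (simp add: \<eta>1_def \<eta>2_def)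
    moreover have "\<bar>\<eta>1 t\<bar> \<le> K' \<and> \<bar>\<eta>2 t\<bar> \<le> K'" for t
    proof -
      \<comment> \<open>The two transition zones are disjoint since a + r \<le> T, so at most one of
        the two terms is nonzero and no factor 2 is lost.\<close>
      have "p t \<notin> {0<..<1} \<or> q t \<notin> {0<..<1}" using r aT by (auto simp: p_def q_def field_simps)
      then have "\<bar>s1 (p t) - s1 (q t)\<bar> \<le> K" "\<bar>s2 (p t) - s2 (q t)\<bar> \<le> K"
        using s(7)[of "p t"] s(7)[of "q t"] s(9,10)[of "p t"] s(9,10)[of "q t"] by auto
      then have "\<bar>\<eta>1 t\<bar> \<le> K / r" "\<bar>\<eta>2 t\<bar> \<le> K / r\<^sup>2"
        using r by (auto simp: \<eta>1_def \<eta>2_def abs_divide intro!: divide_right_mono)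
      then show ?thesis using K' by linarith
    qed
    moreover have "\<eta> a = 0" "\<eta> (T + r) = 0"
    proof -
      have "p a \<le> 0" "q a \<le> 0" "p (T + r) \<ge> 1" "q (T + r) \<ge> 1" using r aT by (auto simp: p_def q_def field_simps)
      then show "\<eta> a = 0" "\<eta> (T + r) = 0" using s(5)[of "p a"] s(5)[of "q a"] s(6)[of "p (T + r)"] s(6)[of "q (T + r)"]
        by (auto simp: \<eta>_def)
    qed
    ultimately show "\<exists>\<eta> \<eta>1 \<eta>2. smooth_cutoff a r T K' \<eta> \<eta>1 \<eta>2"
      by (intro exI[of _ \<eta>] exI[of _ \<eta>1] exI[of _ \<eta>2]) auto
  qed
qed

lemma integral_eq_if_support:
  fixes f :: "real \<Rightarrow> 'b::banach"
  assumes "\<And>s. s \<in> S - T \<or> s \<in> T - S \<Longrightarrow> f s = 0"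
  shows "integral S f = integral T f"
proof -
  have "(\<lambda>x. if x \<in> S then f x else 0) = (\<lambda>x. if x \<in> T then f x else 0)" using assms by (auto simp: fun_eq_iff)
  then show ?thesis using integral_restrict_UNIV[of S f] integral_restrict_UNIV[of T f] by simp
qed

text \<open>The last clause transfers two derivatives from the kernel to the function: the weak
  derivative is tested with the kernel reflected about t. Its support lies in [t - 1/n, t], which
  the conditions on \<open>t\<close> place inside \<open>{a..b}\<close>.\<close>

lemma smooth_mollifier_exists:
  obtains \<theta> \<theta>1 \<theta>2 \<theta>3 \<theta>4 :: "nat \<Rightarrow> real \<Rightarrow> real" and M where "mollifier \<theta> M"
    "\<And>n x. (\<theta> n has_real_derivative \<theta>1 n x) (at x)" "\<And>n x. (\<theta>1 n has_real_derivative \<theta>2 n x) (at x)"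
    "\<And>n x. (\<theta>2 n has_real_derivative \<theta>3 n x) (at x)" "\<And>n x. (\<theta>3 n has_real_derivative \<theta>4 n x) (at x)"
    "\<And>n x. \<bar>\<theta>1 n x\<bar> \<le> M n" "\<And>n x. \<bar>\<theta>2 n x\<bar> \<le> M n" "\<And>n x. \<bar>\<theta>3 n x\<bar> \<le> M n" "\<And>n x. \<bar>\<theta>4 n x\<bar> \<le> M n"
    "\<And>n t a b (f :: real \<Rightarrow> 'a::banach) g. n > 0 \<Longrightarrow> has_weak_deriv 2 f g \<Longrightarrow> 0 < a \<Longrightarrow> a + 1 / real n \<le> t \<Longrightarrow> t \<le> b \<Longrightarrow>
       conv a b (\<theta>2 n) f t = conv a b (\<theta> n) g t"
proof -
  obtain \<beta> \<beta>1 \<beta>2 \<beta>3 \<beta>4 :: "real \<Rightarrow> real" where sm: "\<And>n x. (deriv ^^ n) \<beta> differentiable (at x)"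
    and d1: "\<And>x. (\<beta> has_real_derivative \<beta>1 x) (at x)" and d2: "\<And>x. (\<beta>1 has_real_derivative \<beta>2 x) (at x)"
    and d3: "\<And>x. (\<beta>2 has_real_derivative \<beta>3 x) (at x)" and d4: "\<And>x. (\<beta>3 has_real_derivative \<beta>4 x) (at x)"
    and c4: "continuous_on UNIV \<beta>4" and nn: "\<And>x. 0 \<le> \<beta> x"
    and z: "\<And>x. x \<notin> {0<..<1} \<Longrightarrow> \<beta> x = 0 \<and> \<beta>1 x = 0 \<and> \<beta>2 x = 0 \<and> \<beta>3 x = 0 \<and> \<beta>4 x = 0"
    and mass: "(\<beta> has_integral 1) {0..1}"
    using unit_bump_exists by (metis (no_types, lifting))
  have cd: "continuous_on UNIV f" if "\<And>x. (f has_real_derivative f' x) (at x)" for f f' :: "real \<Rightarrow> real"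
    by (rule DERIV_continuous_on[OF has_field_derivative_at_within[OF that]])
  obtain K0 where K0: "K0 \<ge> 0" "\<And>x. \<bar>\<beta> x\<bar> \<le> K0" using continuous_compact_support_bounded[OF cd[OF d1]] z by blast
  obtain K1 where K1: "K1 \<ge> 0" "\<And>x. \<bar>\<beta>1 x\<bar> \<le> K1" using continuous_compact_support_bounded[OF cd[OF d2]] z by blast
  obtain K2 where K2: "K2 \<ge> 0" "\<And>x. \<bar>\<beta>2 x\<bar> \<le> K2" using continuous_compact_support_bounded[OF cd[OF d3]] z by blast
  obtain K3 where K3: "K3 \<ge> 0" "\<And>x. \<bar>\<beta>3 x\<bar> \<le> K3" using continuous_compact_support_bounded[OF cd[OF d4]] z by blast
  obtain K4 where K4: "K4 \<ge> 0" "\<And>x. \<bar>\<beta>4 x\<bar> \<le> K4" using continuous_compact_support_bounded[OF c4] z by blast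
  define k where "k = K0 + K1 + K2 + K3 + K4"
  have k: "\<bar>\<beta> x\<bar> \<le> k" "\<bar>\<beta>1 x\<bar> \<le> k" "\<bar>\<beta>2 x\<bar> \<le> k" "\<bar>\<beta>3 x\<bar> \<le> k" "\<bar>\<beta>4 x\<bar> \<le> k" for x
    using K0(1) K0(2)[of x] K1(1) K1(2)[of x] K2(1) K2(2)[of x] K3(1) K3(2)[of x] K4(1) K4(2)[of x] by (simp_all add: k_def)
  have k0: "k \<ge> 0" using k(1)[of 0] by linarith
  define \<theta> where "\<theta> n x = real n * \<beta> (real n * x)" for n x
  define \<theta>1 where "\<theta>1 n x = real n ^ 2 * \<beta>1 (real n * x)" for n x
  define \<theta>2 where "\<theta>2 n x = real n ^ 3 * \<beta>2 (real n * x)" for n x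
  define \<theta>3 where "\<theta>3 n x = real n ^ 4 * \<beta>3 (real n * x)" for n x
  define \<theta>4 where "\<theta>4 n x = real n ^ 5 * \<beta>4 (real n * x)" for n x
  define M where "M n = (real n + real n ^ 2 + real n ^ 3 + real n ^ 4 + real n ^ 5) * k" for n
  have sc: "((\<lambda>x. c * f (real n * x)) has_real_derivative (c * real n) * f' (real n * x)) (at x)"
    if "\<And>x. (f has_real_derivative f' x) (at x)" for f f' :: "real \<Rightarrow> real" and c n x
  proof -
    have "((\<lambda>x. f (real n * x)) has_real_derivative f' (real n * x) * real n) (at x)"
      by (rule DERIV_chain2[OF that]) (auto intro!: derivative_eq_intros)
    from DERIV_cmult[OF this, of c] show ?thesis by (simp add: mult_ac)
  qed
  have D: "(\<theta> n has_real_derivative \<theta>1 n x) (at x)" "(\<theta>1 n has_real_derivative \<theta>2 n x) (at x)"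
    "(\<theta>2 n has_real_derivative \<theta>3 n x) (at x)" "(\<theta>3 n has_real_derivative \<theta>4 n x) (at x)" for n x
    using sc[OF d1, of "real n" n x] sc[OF d2, of "real n ^ 2" n x] sc[OF d3, of "real n ^ 3" n x] sc[OF d4, of "real n ^ 4" n x]
    unfolding \<theta>_def[abs_def] \<theta>1_def[abs_def] \<theta>2_def[abs_def] \<theta>3_def[abs_def] \<theta>4_def[abs_def]
    by (simp_all add: power2_eq_square power3_eq_cube power4_eq_xxxx numeral_eq_Suc mult_ac)
  have bnd: "\<bar>c * y\<bar> \<le> M n" if "\<bar>y\<bar> \<le> k" "c \<in> {real n, real n ^ 2, real n ^ 3, real n ^ 4, real n ^ 5}" for c y n
  proof -
    have "0 \<le> c" "c \<le> real n + real n ^ 2 + real n ^ 3 + real n ^ 4 + real n ^ 5" using that(2) by auto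
    then show ?thesis using that(1) k0 unfolding abs_mult M_def by (intro mult_mono) auto
  qed
  have B: "\<bar>\<theta> n x\<bar> \<le> M n" "\<bar>\<theta>1 n x\<bar> \<le> M n" "\<bar>\<theta>2 n x\<bar> \<le> M n" "\<bar>\<theta>3 n x\<bar> \<le> M n" "\<bar>\<theta>4 n x\<bar> \<le> M n" for n x
    unfolding \<theta>_def \<theta>1_def \<theta>2_def \<theta>3_def \<theta>4_def by (rule bnd[OF k(1)] bnd[OF k(2)] bnd[OF k(3)] bnd[OF k(4)] bnd[OF k(5)]; simp)+
  have zero: "\<beta> (real n * x) = 0 \<and> \<beta>2 (real n * x) = 0" if "n > 0" "x \<notin> {0<..<1 / real n}" for n x
  proof -
    have "real n * x \<notin> {0<..<1}" using that by (auto simp: field_simps zero_less_mult_iff)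
    then show ?thesis using z by blast
  qed
  have moll: "mollifier \<theta> M"
  proof
    show "continuous_on UNIV (\<theta> n)" for n by (rule cd[OF D(1)])
    show "0 \<le> \<theta> n x" for n x by (simp add: \<theta>_def nn)
    show "\<bar>\<theta> n x\<bar> \<le> M n" for n x by (rule B)
    show "\<theta> n x = 0" if "n > 0" "x \<notin> {0..1 / real n}" for n x
    proof -
      have "x \<notin> {0<..<1 / real n}" using that(2) by auto
      then show ?thesis using zero[OF that(1), of x] by (simp add: \<theta>_def)
    qed
    show "(\<theta> n has_integral 1) {0..1 / real n}" if n: "n > 0" for n
    proof -
      have "((\<lambda>x. \<beta> (real n * x)) has_integral (1 / \<bar>real n\<bar>) *\<^sub>R 1) ((\<lambda>x. x / real n) ` {0..1})"
        by (rule has_integral_stretch_real[OF mass]) (use n in simp)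
      moreover have "(\<lambda>x. x / real n) ` {0..1} = {0..1 / real n}"
        using n image_divide_atLeastAtMost[of "real n" 0 1] by simp
      ultimately have "((\<lambda>x. \<beta> (real n * x)) has_integral (1 / real n)) {0..1 / real n}" by simp
      from has_integral_mult_right[OF this, of "real n"] n show ?thesis by (simp add: \<theta>_def[abs_def])
    qed
  qed
  have weak: "conv a b (\<theta>2 n) f t = conv a b (\<theta> n) g t"
    if n: "n > 0" and w: "has_weak_deriv 2 f g" and t: "0 < a" "a + 1 / real n \<le> t" "t \<le> b"
    for n t a b and f g :: "real \<Rightarrow> 'a"
  proof -
    \<comment> \<open>As a function of s the kernel is reflected; for an even number of derivatives
      the reflection produces no sign.\<close>
    define \<xi> where "\<xi> = (\<lambda>s. \<beta> (- real n * s + real n * t))"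
    note hd = higher_deriv_affine[OF sm, of _ "- real n" "real n * t", folded \<xi>_def]
    have arg: "- real n * s + real n * t = real n * (t - s)" for s by (simp add: algebra_simps)
    have "deriv \<beta> = \<beta>1" "deriv \<beta>1 = \<beta>2" using d1 d2 DERIV_imp_deriv by blast+
    then have dd: "(deriv ^^ 2) \<xi> s = real n ^ 2 * \<beta>2 (real n * (t - s))" for s
      unfolding hd[of 2] arg by (simp add: numeral_2_eq_2)
    have \<xi>s: "\<xi> s = \<beta> (real n * (t - s))" for s by (simp only: \<xi>_def arg)
    have supp: "t - s \<notin> {0<..<1 / real n}" if "s \<notin> {a..b}" for s using that t by auto
    have tf: "test_function \<xi>"
      unfolding test_function_def
    proof (intro conjI allI)
      fix m s
      obtain D where D: "((deriv ^^ m) \<beta> has_real_derivative D) (at (- real n * s + real n * t))"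
        using sm[of m "- real n * s + real n * t"] by (auto simp: real_differentiable_def)
      have "((\<lambda>s. (deriv ^^ m) \<beta> (- real n * s + real n * t)) has_real_derivative D * (- real n)) (at s)"
        using D by (rule DERIV_chain2) (auto intro!: derivative_eq_intros)
      from DERIV_cmult[OF this, of "(- real n) ^ m"]
      show "(deriv ^^ m) \<xi> differentiable (at s)" unfolding hd[of m] real_differentiable_def by blast
      show "\<exists>K. compact K \<and> K \<subseteq> {0<..} \<and> (\<forall>t. t \<notin> K \<longrightarrow> \<xi> t = 0)"
      proof (intro exI[of _ "{a..b}"] conjI allI impI)
        show "\<xi> s = 0" if "s \<notin> {a..b}" for s using zero[OF n supp[OF that]] unfolding \<xi>_def arg by blast
      qed (use t(1) in auto)
    qed
    have "integral {0<..} (\<lambda>s. (deriv ^^ 2) \<xi> s *\<^sub>R f s) = (-1) ^ 2 *\<^sub>R integral {0<..} (\<lambda>s. \<xi> s *\<^sub>R g s)"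
      using w tf unfolding has_weak_deriv_def by blast
    then have "integral {0<..} (\<lambda>s. (real n ^ 2 * \<beta>2 (real n * (t - s))) *\<^sub>R f s) = integral {0<..} (\<lambda>s. \<beta> (real n * (t - s)) *\<^sub>R g s)"
      by (simp add: dd \<xi>s)
    moreover have "integral {0<..} (\<lambda>s. (real n ^ 2 * \<beta>2 (real n * (t - s))) *\<^sub>R f s) = integral {a..b} (\<lambda>s. (real n ^ 2 * \<beta>2 (real n * (t - s))) *\<^sub>R f s)"
      by (rule integral_eq_if_support) (use t(1) zero[OF n supp] in auto)
    moreover have "integral {0<..} (\<lambda>s. \<beta> (real n * (t - s)) *\<^sub>R g s) = integral {a..b} (\<lambda>s. \<beta> (real n * (t - s)) *\<^sub>R g s)"
      by (rule integral_eq_if_support) (use t(1) zero[OF n supp] in auto)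
    ultimately have e: "integral {a..b} (\<lambda>s. (real n ^ 2 * \<beta>2 (real n * (t - s))) *\<^sub>R f s) = integral {a..b} (\<lambda>s. \<beta> (real n * (t - s)) *\<^sub>R g s)" by simp
    have "conv a b (\<theta>2 n) f t = integral {a..b} (\<lambda>s. real n *\<^sub>R ((real n ^ 2 * \<beta>2 (real n * (t - s))) *\<^sub>R f s))"
      by (simp add: conv_def \<theta>2_def power2_eq_square power3_eq_cube mult_ac)
    also have "\<dots> = real n *\<^sub>R integral {a..b} (\<lambda>s. (real n ^ 2 * \<beta>2 (real n * (t - s))) *\<^sub>R f s)" by (rule integral_cmul)
    also have "\<dots> = real n *\<^sub>R integral {a..b} (\<lambda>s. \<beta> (real n * (t - s)) *\<^sub>R g s)" by (simp only: e)
    also have "\<dots> = integral {a..b} (\<lambda>s. real n *\<^sub>R (\<beta> (real n * (t - s)) *\<^sub>R g s))" by (rule integral_cmul[symmetric])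
    also have "\<dots> = conv a b (\<theta> n) g t" by (simp add: conv_def \<theta>_def)
    finally show ?thesis .
  qed
  show ?thesis by (rule that[OF moll D B(2-5) weak])
qed

text \<open>The Yosida regularisation R = n(A - c + n)^-1. It is a contraction because A - c is
  nonnegative, AR is bounded, and Rx - x = (A - c + n)^-1 (cx - Ax) gives the rate 1/n on the
  domain.\<close>

lemma resolvent_family:
  fixes A :: "'a::complex_hilbert \<rightharpoonup> 'a"
  assumes A: "self_adjoint A" and low: "bounded_below_by c A" and n: "n > 0"
  obtains R Q where "bounded_linear R" "bounded_linear Q" "\<And>x. R x \<in> dom A" "\<And>x. Q x = the (A (R x))"
    "\<And>x. x \<in> dom A \<Longrightarrow> Q x = R (the (A x))" "\<And>x. norm (R x) \<le> norm x"
    "\<And>x. x \<in> dom A \<Longrightarrow> n * norm (R x - x) \<le> norm (the (A x) - c *\<^sub>R x)"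
proof -
  note LA = linear_operatorD[OF self_adjoint_linear[OF A]]
  define k where "k = n - c"
  have "n * norm x \<le> norm (the (A x) + k *\<^sub>R x)" if x: "x \<in> dom A" for x
  proof (cases "x = 0")
    case False
    have "n * (norm x)\<^sup>2 \<le> inner (the (A x) + k *\<^sub>R x) x"
      using low x by (auto simp: bounded_below_by_def Re_cinner inner_simps k_def power2_norm_eq_inner algebra_simps)
    also have "\<dots> \<le> norm (the (A x) + k *\<^sub>R x) * norm x" by (rule norm_cauchy_schwarz)
    finally show ?thesis using False by (simp add: power2_eq_square mult.assoc[symmetric])
  qed simp
  then obtain R' where R': "bounded_linear R'" "\<And>y. R' y \<in> dom A" "\<And>y. the (A (R' y)) + k *\<^sub>R R' y = y"
    "\<And>x. x \<in> dom A \<Longrightarrow> R' (the (A x) + k *\<^sub>R x) = x" "\<And>y. n * norm (R' y) \<le> norm y"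
    using self_adjoint_bounded_inverse[OF A n, of k] by (metis (no_types))
  note lin = bounded_linear.linear[OF R'(1)]
  define R where "R x = n *\<^sub>R R' x" for x
  define Q where "Q x = n *\<^sub>R (x - k *\<^sub>R R' x)" for x
  show ?thesis
  proof (rule that)
    show "bounded_linear R" unfolding R_def[abs_def] by (rule bounded_linear_compose[OF bounded_linear_scaleR_right R'(1)])
    show "bounded_linear Q" unfolding Q_def[abs_def]
      by (rule bounded_linear_compose[OF bounded_linear_scaleR_right
          bounded_linear_sub[OF bounded_linear_ident bounded_linear_compose[OF bounded_linear_scaleR_right R'(1)]]])
    show "R x \<in> dom A" for x unfolding R_def by (rule LA(5)[OF R'(2) R'(2)])
    show "Q x = the (A (R x))" for x
    proof -
      have "the (A (R' x)) = x - k *\<^sub>R R' x" using R'(3)[of x] by (metis add_diff_cancel_right')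
      then show ?thesis using LA(6)[OF R'(2) R'(2), of n x] by (simp add: R_def Q_def)
    qed
    show "norm (R x) \<le> norm x" for x using R'(5)[of x] n by (simp add: R_def)
    fix x assume x: "x \<in> dom A"
    have 1: "R' (the (A x)) = x - k *\<^sub>R R' x"
      using R'(4)[OF x] by (simp add: linear_add[OF lin] linear_scale[OF lin] algebra_simps)
    show "Q x = R (the (A x))" by (simp add: Q_def R_def 1)
    have "R x - x = R' (c *\<^sub>R x - the (A x))"
      using 1 by (simp add: R_def linear_diff[OF lin] linear_scale[OF lin] k_def algebra_simps)
    then show "n * norm (R x - x) \<le> norm (the (A x) - c *\<^sub>R x)"
      using R'(5)[of "c *\<^sub>R x - the (A x)"] by (simp add: norm_minus_commute)
  qed
qed

lemma resolvent_family_tendsto: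
  fixes R :: "nat \<Rightarrow> 'a::complex_hilbert \<Rightarrow> 'a"
  assumes dense: "closure D = UNIV" and R: "\<And>k. linear (R k)" "\<And>k x. norm (R k x) \<le> norm x"
    and C: "\<And>k x. x \<in> D \<Longrightarrow> real (Suc k) * norm (R k x - x) \<le> C x"
  shows "(\<lambda>k. R k x) \<longlonglongrightarrow> x"
proof (rule metric_LIMSEQ_I)
  fix e :: real assume e: "e > 0"
  have "x \<in> closure D" using dense by simp
  then obtain y where y: "y \<in> D" "dist y x < e/3" using e unfolding closure_approachable by (meson divide_pos_pos zero_less_numeral)
  obtain N where N: "3 * C y / e < real N" using reals_Archimedean2 by blast
  show "\<exists>N. \<forall>k\<ge>N. dist (R k x) x < e"
  proof (intro exI allI impI)
    fix k assume k: "k \<ge> N"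
    have "3 * C y < e * real (Suc k)" using N k e by (simp add: field_simps) (smt (verit) mult_left_mono of_nat_mono)
    then have "C y < e * real (Suc k) / 3" by linarith
    also have "\<dots> = real (Suc k) * (e/3)" by simp
    finally have "real (Suc k) * norm (R k y - y) < real (Suc k) * (e/3)" using C[OF y(1), of k] by linarith
    then have 1: "norm (R k y - y) < e/3" by (simp only: mult_less_cancel_left_pos of_nat_0_less_iff zero_less_Suc)
    have "R k x - x = R k (x - y) + (R k y - y) + (y - x)" by (simp add: linear_diff[OF R(1)])
    then have "norm (R k x - x) \<le> norm (R k (x - y)) + norm (R k y - y) + norm (y - x)"
      by (metis norm_triangle_ineq norm_triangle_mono order_refl)
    also have "\<dots> < e" using R(2)[of k "x - y"] 1 y(2) by (simp add: dist_norm norm_minus_commute)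
    finally show "dist (R k x) x < e" by (simp add: dist_norm)
  qed
qed

section \<open>The weighted estimate\<close>

lemma nn_integral_half_line_Icc:
  assumes "0 < a"
  shows "(\<integral>\<^sup>+t\<in>{a..b}. f t \<partial>half_line) = (\<integral>\<^sup>+t. f t * indicator {a..b} t \<partial>lebesgue)"
proof -
  have "(\<integral>\<^sup>+t\<in>{a..b}. f t \<partial>half_line) = (\<integral>\<^sup>+t. f t * indicator {a..b} t * indicator {0<..} t \<partial>lebesgue)"
    by (rule nn_integral_restrict_space) auto
  also have "\<dots> = (\<integral>\<^sup>+t. f t * indicator {a..b} t \<partial>lebesgue)"
    by (rule nn_integral_cong) (use assms in \<open>auto simp: indicator_def\<close>)
  finally show ?thesis .
qed

lemma AE_half_line_iff: "(AE t in half_line. P t) \<longleftrightarrow> (AE t in lebesgue. t > 0 \<longrightarrow> P t)"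
  by (subst AE_restrict_space_iff) auto

lemma Lp_loc_1_L1_approx:
  assumes "f \<in> Lp_loc 1" "0 < a"
  shows "L1_approx (\<lambda>t. indicator {a..b} t *\<^sub>R f t)"
proof (rule strongly_measurable_L1_approx[OF _ assms(2)])
  show "strongly_measurable f" using assms(1) by (simp add: Lp_loc_def)
  have "(\<integral>\<^sup>+t\<in>{a..b}. ennreal (norm (f t) ^ 1) \<partial>half_line) < \<infinity>"
    using assms unfolding Lp_loc_def by (auto simp: subset_eq)
  then show "(\<integral>\<^sup>+t. ennreal (norm (f t)) * indicator {a..b} t \<partial>lebesgue) < \<infinity>"
    by (simp add: nn_integral_half_line_Icc[OF assms(2)])
qed

lemma Lp_loc_1_norm_integrable:
  assumes "f \<in> Lp_loc 1" "0 < a"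
  shows "(\<lambda>t. norm (f t)) integrable_on {a..b}"
proof -
  let ?g = "\<lambda>t. indicator {a..b} t * norm (f t)"
  have sm: "strongly_measurable f" using assms(1) by (simp add: Lp_loc_def)
  have "(\<lambda>t. indicator {a..b} t * (indicator {0<..} t * norm (f t))) \<in> borel_measurable lebesgue"
    by (intro borel_measurable_times strongly_measurable_norm[OF sm] borel_measurable_indicator) auto
  also have "(\<lambda>t. indicator {a..b} t * (indicator {0<..} t * norm (f t))) = ?g"
    using assms(2) by (auto simp: indicator_def fun_eq_iff)
  finally have m: "?g \<in> borel_measurable lebesgue" .
  have "(\<integral>\<^sup>+t\<in>{a..b}. ennreal (norm (f t) ^ 1) \<partial>half_line) < \<infinity>"
    using assms unfolding Lp_loc_def by (auto simp: subset_eq)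
  then have "(\<integral>\<^sup>+t. ennreal (norm (f t)) * indicator {a..b} t \<partial>lebesgue) < \<infinity>"
    by (simp add: nn_integral_half_line_Icc[OF assms(2)])
  also have "(\<integral>\<^sup>+t. ennreal (norm (f t)) * indicator {a..b} t \<partial>lebesgue) = (\<integral>\<^sup>+t. ennreal (?g t) \<partial>lebesgue)"
    by (rule nn_integral_cong) (auto simp: indicator_def)
  finally obtain I where I: "(\<integral>\<^sup>+t. ennreal (?g t) \<partial>lebesgue) = ennreal I" "0 \<le> I"
    by (cases "\<integral>\<^sup>+t. ennreal (?g t) \<partial>lebesgue" rule: ennreal_cases) auto
  have "(?g has_integral I) UNIV"
    by (subst has_integral_iff_nn_integral_lebesgue) (use m I in auto)
  moreover have "?g = (\<lambda>t. if t \<in> {a..b} then norm (f t) else 0)" by (auto simp: indicator_def fun_eq_iff)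
  ultimately have "((\<lambda>t. if t \<in> {a..b} then norm (f t) else 0) has_integral I) UNIV" by simp
  then show ?thesis unfolding has_integral_restrict_UNIV by blast
qed

text \<open>From here on |\<phi>| is represented by a nonnegative Borel function, so that all
  weighted integrals can be taken with respect to \<open>lborel\<close>.\<close>

lemma strongly_measurable_norm_version:
  assumes "strongly_measurable f"
  obtains v :: "real \<Rightarrow> real" where "v \<in> borel_measurable borel" "\<And>t. 0 \<le> v t"
    "AE t in lebesgue. t > 0 \<longrightarrow> norm (f t) = v t"
proof -
  obtain v0 where v0: "v0 \<in> borel_measurable lborel" "AE t in lborel. indicator {0<..} t * norm (f t) = v0 t"
    using completion_ex_borel_measurable_real[OF strongly_measurable_norm[OF assms]] by blast
  have "AE t in lebesgue. indicator {0<..} t * norm (f t) = v0 t" using v0(2) by (rule AE_completion)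
  then have "AE t in lebesgue. t > 0 \<longrightarrow> norm (f t) = \<bar>v0 t\<bar>"
    by eventually_elim (auto simp: indicator_def, metis abs_norm_cancel)
  moreover have "(\<lambda>t. \<bar>v0 t\<bar>) \<in> borel_measurable borel" using v0(1) by simp
  ultimately show ?thesis using that[of "\<lambda>t. \<bar>v0 t\<bar>"] by simp
qed

lemma ennreal_integral_eq_nn_integral:
  fixes f :: "real \<Rightarrow> real"
  assumes "continuous_on UNIV f" "\<And>t. 0 \<le> f t"
  shows "ennreal (integral {\<alpha>..\<beta>} f) = (\<integral>\<^sup>+t. ennreal (f t) * indicator {\<alpha>..\<beta>} t \<partial>lborel)"
proof -
  have "(f has_integral integral {\<alpha>..\<beta>} f) {\<alpha>..\<beta>}"
    by (intro integrable_integral integrable_continuous_interval continuous_on_subset[OF assms(1)]) auto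
  from nn_integral_has_integral_lebesgue'[OF assms(2) this] show ?thesis by simp
qed

abbreviation exp_energy :: "(real \<Rightarrow> real) \<Rightarrow> real \<Rightarrow> real set \<Rightarrow> ennreal" where
  "exp_energy v \<mu> S \<equiv> \<integral>\<^sup>+t. ennreal (exp (2 * \<mu> * t) * (v t)\<^sup>2) * indicator S t \<partial>lborel"

text \<open>The analytic core. The Carleman estimate enters as a hypothesis, so that both versions
  can be inserted, and \<open>D\<close> is obtained before \<open>T\<close>, \<open>\<mu>\<close>
  and \<open>d\<close>, as these are sent to their limits later. The condition 8\<kappa>^2 \<le> d^2
  absorbs the perturbation, whose coefficient is 4\<kappa>^2 after mollification.\<close>

lemma weighted_l2_bound_by_cutoff_zones:
  fixes A :: "'a::complex_hilbert \<rightharpoonup> 'a" and \<phi> \<phi>'' :: "real \<Rightarrow> 'a"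
  assumes A: "self_adjoint A" and low: "bounded_below_by c A"
    and dom: "AE t in lebesgue. t > 0 \<longrightarrow> \<phi> t \<in> dom A"
    and weak: "has_weak_deriv 2 \<phi> \<phi>''"
    and v: "v \<in> borel_measurable borel" "\<And>t. 0 \<le> v t" "AE t in lebesgue. t > 0 \<longrightarrow> norm (\<phi> t) = v t"
    and fin: "\<And>a b. 0 < a \<Longrightarrow> (\<integral>\<^sup>+t. ennreal ((v t)\<^sup>2) * indicator {a..b} t \<partial>lborel) < \<infinity>"
    and \<tau>: "0 \<le> \<tau>" and \<kappa>: "0 \<le> \<kappa>" and r: "r > 0"
    and ineq: "AE t in lebesgue. t > \<tau> \<longrightarrow> norm (\<phi>'' t - the (A (\<phi> t))) \<le> \<kappa> * norm (\<phi> t)"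
  obtains D where "D \<ge> 0"
    "\<And>T \<mu> d. \<tau> + 4 * r \<le> T \<Longrightarrow> 0 \<le> \<mu> \<Longrightarrow> 0 < d \<Longrightarrow> 8 * \<kappa>\<^sup>2 \<le> d\<^sup>2 \<Longrightarrow>
      (\<And>R Q. bounded_linear R \<Longrightarrow> bounded_linear Q \<Longrightarrow> (\<And>x. R x \<in> dom A) \<Longrightarrow> (\<And>x. Q x = the (A (R x))) \<Longrightarrow>
        carleman_estimate R Q \<mu> d (T + r)) \<Longrightarrow>
      (exp_energy v \<mu> {\<tau> + 3 * r..T})
      \<le> ennreal (D * (1 + \<mu>)\<^sup>2 / d\<^sup>2) * (exp_energy v \<mu> ({\<tau> + r..\<tau> + 3 * r} \<union> {T - r..T + r}))"
proof -

  \<comment> \<open>Cutoffs, mollifiers and resolvents chosen independently of \<open>T\<close>,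
    \<open>\<mu>\<close> and \<open>d\<close>\<close>
  note [measurable] = v(1)
  obtain K :: real where K: "K \<ge> 0" "\<And>a T. a + r \<le> T \<Longrightarrow> \<exists>\<eta> \<eta>1 \<eta>2. smooth_cutoff a r T K \<eta> \<eta>1 \<eta>2"
    using cutoff_exists[OF r] by metis
  obtain \<theta> \<theta>1 \<theta>2 \<theta>3 \<theta>4 :: "nat \<Rightarrow> real \<Rightarrow> real" and M where moll: "mollifier \<theta> M"
    and d\<theta>: "\<And>n x. (\<theta> n has_real_derivative \<theta>1 n x) (at x)" "\<And>n x. (\<theta>1 n has_real_derivative \<theta>2 n x) (at x)"
    "\<And>n x. (\<theta>2 n has_real_derivative \<theta>3 n x) (at x)" "\<And>n x. (\<theta>3 n has_real_derivative \<theta>4 n x) (at x)"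
    and b\<theta>: "\<And>n x. \<bar>\<theta>1 n x\<bar> \<le> M n" "\<And>n x. \<bar>\<theta>2 n x\<bar> \<le> M n" "\<And>n x. \<bar>\<theta>3 n x\<bar> \<le> M n" "\<And>n x. \<bar>\<theta>4 n x\<bar> \<le> M n"
    and wk: "\<And>n t a b (f :: real \<Rightarrow> 'a) g. n > 0 \<Longrightarrow> has_weak_deriv 2 f g \<Longrightarrow> 0 < a \<Longrightarrow> a + 1 / real n \<le> t \<Longrightarrow> t \<le> b \<Longrightarrow>
       conv a b (\<theta>2 n) f t = conv a b (\<theta> n) g t"
    by (rule smooth_mollifier_exists, rule that, assumption+)
  interpret mollifier \<theta> M by (rule moll)
  have "\<forall>k. \<exists>R Q. bounded_linear R \<and> bounded_linear Q \<and> (\<forall>x. R x \<in> dom A) \<and> (\<forall>x. Q x = the (A (R x))) \<and>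
    (\<forall>x\<in>dom A. Q x = R (the (A x))) \<and> (\<forall>x. norm (R x) \<le> norm x) \<and>
    (\<forall>x\<in>dom A. real (Suc k) * norm (R x - x) \<le> norm (the (A x) - c *\<^sub>R x))"
  proof
    fix k
    show "\<exists>R Q. bounded_linear R \<and> bounded_linear Q \<and> (\<forall>x. R x \<in> dom A) \<and> (\<forall>x. Q x = the (A (R x))) \<and>
      (\<forall>x\<in>dom A. Q x = R (the (A x))) \<and> (\<forall>x. norm (R x) \<le> norm x) \<and>
      (\<forall>x\<in>dom A. real (Suc k) * norm (R x - x) \<le> norm (the (A x) - c *\<^sub>R x))"
      by (rule resolvent_family[OF A low, of "real (Suc k)"]) (simp, blast)
  qed
  from choice[OF this] obtain R where "\<forall>k. \<exists>Q. bounded_linear (R k) \<and> bounded_linear Q \<and> (\<forall>x. R k x \<in> dom A) \<and> (\<forall>x. Q x = the (A (R k x))) \<and>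
    (\<forall>x\<in>dom A. Q x = R k (the (A x))) \<and> (\<forall>x. norm (R k x) \<le> norm x) \<and>
    (\<forall>x\<in>dom A. real (Suc k) * norm (R k x - x) \<le> norm (the (A x) - c *\<^sub>R x))" by blast
  from choice[OF this] obtain Q where RQ: "\<And>k. bounded_linear (R k)" "\<And>k. bounded_linear (Q k)"
    "\<And>k x. R k x \<in> dom A" "\<And>k x. Q k x = the (A (R k x))" "\<And>k x. x \<in> dom A \<Longrightarrow> Q k x = R k (the (A x))"
    "\<And>k x. norm (R k x) \<le> norm x" "\<And>k x. x \<in> dom A \<Longrightarrow> real (Suc k) * norm (R k x - x) \<le> norm (the (A x) - c *\<^sub>R x)"
    by blast
  define \<gamma> where "\<gamma> = \<bar>c\<bar>"
  have \<gamma>0: "\<gamma> \<ge> 0" by (simp add: \<gamma>_def)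
  have symRQ: "inner (Q k x) (R k y) = inner (R k x) (Q k y)" for k x y
    using self_adjoint_sym[OF A RQ(3) RQ(3), of k x k y] by (simp add: RQ(4))
  have lowRQ: "- \<gamma> * (norm (R k x))\<^sup>2 \<le> inner (Q k x) (R k x)" for k x
  proof -
    have "c * (norm (R k x))\<^sup>2 \<le> inner (Q k x) (R k x)"
      using low RQ(3)[of k x] by (simp add: bounded_below_by_def Re_cinner RQ(4))
    moreover have "- \<gamma> * (norm (R k x))\<^sup>2 \<le> c * (norm (R k x))\<^sup>2" by (intro mult_right_mono) (auto simp: \<gamma>_def)
    ultimately show ?thesis by linarith
  qed
  have Rlim: "(\<lambda>k. R k x) \<longlonglongrightarrow> x" for x
    by (rule resolvent_family_tendsto[where D = "dom A" and C = "\<lambda>x. norm (the (A x) - c *\<^sub>R x)"])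
      (use A RQ(6,7) bounded_linear.linear[OF RQ(1)] in \<open>simp_all add: self_adjoint_def\<close>)
  have L1: "\<phi> \<in> Lp_loc 1" "\<phi>'' \<in> Lp_loc 1" using weak by (auto simp: has_weak_deriv_def)
  \<comment> \<open>The zones receive 4\<kappa>^2 + 32K^2\<kappa>^2 from the source term and the
    last summand from the commutators. Absorption doubles the total.\<close>
  define D0 where "D0 = 4 * \<kappa>\<^sup>2 + 32 * K\<^sup>2 * \<kappa>\<^sup>2 + 2 * K\<^sup>2 * (16 * (2 * \<gamma> + 1) + 68)"
  have D0: "D0 \<ge> 0" using \<gamma>0 by (simp add: D0_def)
  show ?thesis
  proof (rule that[of "2 * D0"])
    show "0 \<le> 2 * D0" using D0 by simp
    fix T \<mu> d :: real
    assume T: "\<tau> + 4 * r \<le> T" and \<mu>: "0 \<le> \<mu>" and d: "0 < d" "8 * \<kappa>\<^sup>2 \<le> d\<^sup>2"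
      and carl: "\<And>R Q. bounded_linear R \<Longrightarrow> bounded_linear Q \<Longrightarrow> (\<And>x. R x \<in> dom A) \<Longrightarrow> (\<And>x. Q x = the (A (R x))) \<Longrightarrow>
        carleman_estimate R Q \<mu> d (T + r)"
    \<comment> \<open>The cutoff starts at \<alpha>, one length \<open>r\<close> after the left end
      \<open>a\<close> of the convolution, so mollifying never reaches beyond
      \<open>a\<close>.\<close>
    define a b \<alpha> where "a = \<tau> + r" and "b = T + r" and "\<alpha> = \<tau> + 2 * r"
    have ab: "0 < a" "a < \<alpha>" "\<alpha> < b" "b - \<alpha> \<le> T + r" "\<alpha> + r \<le> T" using \<tau> r T by (auto simp: a_def b_def \<alpha>_def)
    obtain \<eta> \<eta>1 \<eta>2 where \<eta>: "\<And>t. (\<eta> has_vector_derivative \<eta>1 t) (at t)" "\<And>t. (\<eta>1 has_vector_derivative \<eta>2 t) (at t)"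
      "continuous_on UNIV \<eta>2" "\<And>t::real. 0 \<le> \<eta> t \<and> \<eta> t \<le> 1" "\<And>t. t \<in> {\<alpha> + r..T} \<Longrightarrow> \<eta> t = 1"
      "\<And>t. t \<notin> {\<alpha><..<\<alpha> + r} \<union> {T<..<T + r} \<Longrightarrow> \<eta>1 t = 0 \<and> \<eta>2 t = 0"
      "\<And>t. \<bar>\<eta>1 t\<bar> \<le> K \<and> \<bar>\<eta>2 t\<bar> \<le> K" "\<eta> \<alpha> = 0" "\<eta> b = 0"
      using K(2)[OF ab(5)] unfolding b_def by blast
    have \<eta>1z: "\<eta>1 \<alpha> = 0" "\<eta>1 b = 0" using \<eta>(6)[of \<alpha>] \<eta>(6)[of b] ab by (auto simp: b_def)
    have c\<eta>: "continuous_on UNIV \<eta>" "continuous_on UNIV \<eta>1"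
      using has_vector_derivative_continuous_on[OF \<eta>(1)] has_vector_derivative_continuous_on[OF \<eta>(2)] by auto
    note [measurable] = borel_measurable_continuous_onI[OF c\<eta>(1)] borel_measurable_continuous_onI[OF c\<eta>(2)]
      borel_measurable_continuous_onI[OF \<eta>(3)]

    \<comment> \<open>Weights before and after mollification\<close>
    define Z where "Z = {\<tau> + r..\<tau> + 3 * r} \<union> {T - r..T + r}"
    define wF wV where "wF t = exp (2 * \<mu> * t) * (2 * (\<eta> t)\<^sup>2 + 16 * (\<eta>1 t)\<^sup>2)"
      and "wV t = exp (2 * \<mu> * t) * (16 * (2 * \<gamma> + 1) * (\<eta>1 t)\<^sup>2 + 64 * (\<eta>2 t + \<mu> * \<eta>1 t)\<^sup>2 + 4 * (\<eta>2 t)\<^sup>2)" for t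
    have w0: "0 \<le> wF t" "0 \<le> wV t" for t using \<gamma>0 by (auto simp: wF_def wV_def)
    have [measurable]: "wF \<in> borel_measurable borel" "wV \<in> borel_measurable borel"
      unfolding wF_def wV_def by measurable
    define E where "E s = ennreal (exp (2 * \<mu> * s))" for s
    have [measurable]: "E \<in> borel_measurable borel" unfolding E_def by measurable
    define KV where "KV = K\<^sup>2 * (16 * (2 * \<gamma> + 1) + 68) * (1 + \<mu>)\<^sup>2"
    have KV0: "KV \<ge> 0" using \<gamma>0 by (simp add: KV_def)
    \<comment> \<open>Weights at s dominating the weights at t for s slightly before t. All
      constants are doubled to pay for the change of the exponential, and the zones in
      \<open>Z\<close> are widened by \<open>r\<close> to the left.\<close>
    define WF WV where "WF s = E s * (ennreal 4 * indicator {a..b} s + ennreal (32 * K\<^sup>2) * indicator Z s)"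
      and "WV s = E s * (ennreal (2 * KV) * indicator Z s)" for s
    have [measurable]: "WF \<in> borel_measurable borel" "WV \<in> borel_measurable borel"
      unfolding WF_def WV_def Z_def by measurable
    have e1: "1 \<le> (1 + \<mu>)\<^sup>2" "\<mu>\<^sup>2 \<le> (1 + \<mu>)\<^sup>2" using \<mu> by (auto simp: power2_eq_square algebra_simps)
    have \<eta>sq: "(\<eta> t)\<^sup>2 \<le> 1" "(\<eta>1 t)\<^sup>2 \<le> K\<^sup>2" "(\<eta>2 t)\<^sup>2 \<le> K\<^sup>2" "(\<eta>2 t + \<mu> * \<eta>1 t)\<^sup>2 \<le> K\<^sup>2 * (1 + \<mu>)\<^sup>2" for t
    proof -
      show "(\<eta> t)\<^sup>2 \<le> 1" using \<eta>(4)[of t] by (simp add: power_le_one)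
      show "(\<eta>1 t)\<^sup>2 \<le> K\<^sup>2" "(\<eta>2 t)\<^sup>2 \<le> K\<^sup>2" using \<eta>(7)[of t] K(1) by (auto intro!: abs_le_square_iff[THEN iffD1])
      have "\<bar>\<eta>2 t + \<mu> * \<eta>1 t\<bar> \<le> \<bar>\<eta>2 t\<bar> + \<mu> * \<bar>\<eta>1 t\<bar>" using abs_triangle_ineq[of "\<eta>2 t" "\<mu> * \<eta>1 t"] \<mu> by (simp add: abs_mult)
      also have "\<dots> \<le> K + \<mu> * K" using \<eta>(7)[of t] \<mu> by (intro add_mono mult_left_mono) auto
      also have "\<dots> = K * (1 + \<mu>)" by (simp add: algebra_simps)
      finally have "\<bar>\<eta>2 t + \<mu> * \<eta>1 t\<bar> \<le> \<bar>K * (1 + \<mu>)\<bar>" using K(1) \<mu> by simp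
      then show "(\<eta>2 t + \<mu> * \<eta>1 t)\<^sup>2 \<le> K\<^sup>2 * (1 + \<mu>)\<^sup>2" by (simp add: abs_le_square_iff power_mult_distrib)
    qed
    \<comment> \<open>Over a time lag of this length the weight changes at most by a factor 2 and
      the zones move at most by \<open>r\<close>; the summand 1 avoids dividing by zero for
      \<open>\<mu> = 0\<close>.\<close>
    define \<epsilon> where "\<epsilon> = min r (ln 2 / (2 * \<mu> + 1))"
    have \<epsilon>: "\<epsilon> > 0" using r \<mu> by (simp add: \<epsilon>_def)
    have exp2: "exp (2 * \<mu> * t) \<le> 2 * exp (2 * \<mu> * s)" if "0 \<le> t - s" "t - s \<le> \<epsilon>" for s t
    proof -
      have "2 * \<mu> * (t - s) \<le> 2 * \<mu> * \<epsilon>" using that \<mu> by (intro mult_left_mono) auto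
      also have "\<dots> \<le> (2 * \<mu> + 1) * \<epsilon>" using \<epsilon> by (simp add: algebra_simps)
      also have "\<dots> \<le> (2 * \<mu> + 1) * (ln 2 / (2 * \<mu> + 1))" using \<mu> by (intro mult_left_mono) (auto simp: \<epsilon>_def)
      also have "\<dots> = ln 2" using \<mu> by simp
      finally have "exp (2 * \<mu> * (t - s)) \<le> 2" by (metis exp_le_cancel_iff exp_ln zero_less_numeral)
      then have "exp (2 * \<mu> * (t - s)) * exp (2 * \<mu> * s) \<le> 2 * exp (2 * \<mu> * s)" by (intro mult_right_mono) auto
      then show ?thesis by (simp add: algebra_simps flip: exp_add)
    qed
    have domW: "ennreal (wF t) * indicator {\<alpha>..b} t \<le> WF s \<and> ennreal (wV t) * indicator {\<alpha>..b} t \<le> WV s"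
      if st: "0 \<le> t - s" "t - s \<le> \<epsilon>" for s t
    proof (cases "t \<in> {\<alpha>..b}")
      case True
      have sr: "t - s \<le> r" using st by (simp add: \<epsilon>_def)
      have sab: "s \<in> {a..b}" using True st(1) sr by (auto simp: \<alpha>_def a_def)
      have I: "ennreal (exp (2 * \<mu> * t) * x) \<le> E s * ennreal (2 * y)" if "x \<le> y" "0 \<le> x" for x y
      proof -
        have "exp (2 * \<mu> * t) * x \<le> (2 * exp (2 * \<mu> * s)) * y" using exp2[OF st] that by (intro mult_mono) auto
        then have "ennreal (exp (2 * \<mu> * t) * x) \<le> ennreal (exp (2 * \<mu> * s) * (2 * y))" by (intro ennreal_leI) (simp add: mult_ac)
        also have "\<dots> = E s * ennreal (2 * y)" unfolding E_def using that by (intro ennreal_mult) auto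
        finally show ?thesis .
      qed
      show ?thesis
      proof (cases "t \<in> {\<alpha><..<\<alpha> + r} \<union> {T<..<T + r}")
        case True
        have sZ: "s \<in> Z" using True st(1) sr by (auto simp: Z_def \<alpha>_def)
        have "wF t \<le> exp (2 * \<mu> * t) * (2 + 16 * K\<^sup>2)"
          unfolding wF_def using \<eta>sq[of t] by (intro mult_left_mono add_mono) auto
        moreover have "ennreal (exp (2 * \<mu> * t) * (2 + 16 * K\<^sup>2)) \<le> E s * ennreal (2 * (2 + 16 * K\<^sup>2))" by (rule I) auto
        moreover have "ennreal (2 * (2 + 16 * K\<^sup>2)) = ennreal 4 + ennreal (32 * K\<^sup>2)"
          by (subst ennreal_plus[symmetric]; simp)
        moreover have "WF s = E s * (ennreal 4 + ennreal (32 * K\<^sup>2))"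
          by (simp only: WF_def indicator_simps(1)[OF sZ] indicator_simps(1)[OF sab] mult_1_right)
        ultimately have 1: "ennreal (wF t) \<le> WF s" by (metis ennreal_leI order_trans)
        have "16 * (2 * \<gamma> + 1) * (\<eta>1 t)\<^sup>2 + 64 * (\<eta>2 t + \<mu> * \<eta>1 t)\<^sup>2 + 4 * (\<eta>2 t)\<^sup>2
          \<le> 16 * (2 * \<gamma> + 1) * (K\<^sup>2 * (1 + \<mu>)\<^sup>2) + 64 * (K\<^sup>2 * (1 + \<mu>)\<^sup>2) + 4 * (K\<^sup>2 * (1 + \<mu>)\<^sup>2)"
        proof -
          have "K\<^sup>2 * 1 \<le> K\<^sup>2 * (1 + \<mu>)\<^sup>2" using e1 by (intro mult_left_mono) auto
          then have "(\<eta>1 t)\<^sup>2 \<le> K\<^sup>2 * (1 + \<mu>)\<^sup>2" "(\<eta>2 t)\<^sup>2 \<le> K\<^sup>2 * (1 + \<mu>)\<^sup>2" using \<eta>sq(2,3)[of t] by linarith+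
          then show ?thesis using \<eta>sq(4)[of t] \<gamma>0 by (intro add_mono mult_left_mono) auto
        qed
        also have "\<dots> = KV" by (simp add: KV_def algebra_simps)
        finally have "ennreal (wV t) \<le> E s * ennreal (2 * KV)" unfolding wV_def using \<gamma>0 by (intro I) auto
        then have 2: "ennreal (wV t) \<le> WV s" using sZ by (simp add: WV_def)
        show ?thesis using 1 2 \<open>t \<in> {\<alpha>..b}\<close> by simp
      next
        case False
        then have z: "\<eta>1 t = 0" "\<eta>2 t = 0" using \<eta>(6) by auto
        have "ennreal (exp (2 * \<mu> * t) * (2 * (\<eta> t)\<^sup>2)) \<le> E s * ennreal (2 * 2)" using \<eta>sq(1)[of t] by (intro I) auto
        also have "\<dots> \<le> WF s" unfolding WF_def using sab by (intro mult_left_mono) auto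
        finally have "ennreal (wF t) \<le> WF s" by (simp add: wF_def z)
        moreover have "wV t = 0" by (simp add: wV_def z)
        ultimately show ?thesis using \<open>t \<in> {\<alpha>..b}\<close> by simp
      qed
    qed simp

    \<comment> \<open>The regularised solutions and a bound uniform in the regularisation\<close>
    note f1 = Lp_loc_1_L1_approx[OF L1(1) ab(1), of b] and f2 = Lp_loc_1_L1_approx[OF L1(2) ab(1), of b]
      and p1 = Lp_loc_1_norm_integrable[OF L1(1) ab(1), of b]
    have c\<theta>: "continuous_on UNIV (\<theta>1 n)" "continuous_on UNIV (\<theta>2 n)" for n
      using DERIV_continuous_on[OF has_field_derivative_at_within[OF d\<theta>(2)]]
        DERIV_continuous_on[OF has_field_derivative_at_within[OF d\<theta>(3)]] by auto
    obtain N where N: "\<And>k. k \<le> N k" "AE t in lebesgue. t \<in> {\<alpha>..b} \<longrightarrow> (\<lambda>k. conv a b (\<theta> (N k)) \<phi> t) \<longlonglongrightarrow> \<phi> t"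
      using conv_tendsto_AE[OF f1 ab(2)] by blast
    define \<Phi> \<Phi>1 \<Phi>2 where "\<Phi> k = conv a b (\<theta> (N k)) \<phi>" and "\<Phi>1 k = conv a b (\<theta>1 (N k)) \<phi>" and "\<Phi>2 k = conv a b (\<theta>2 (N k)) \<phi>" for k
    have d\<Phi>: "(\<Phi> k has_vector_derivative \<Phi>1 k t) (at t)" "(\<Phi>1 k has_vector_derivative \<Phi>2 k t) (at t)" for k t
      unfolding \<Phi>_def \<Phi>1_def \<Phi>2_def
      by (rule conv_has_vector_derivative[OF f1 p1 order_refl d\<theta>(1,2) bound b\<theta>(1,2)]
          conv_has_vector_derivative[OF f1 p1 order_refl d\<theta>(2,3) b\<theta>(1-3)])+
    have "(\<Phi>2 k has_vector_derivative conv a b (\<theta>3 (N k)) \<phi> t) (at t)" for k t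
      unfolding \<Phi>2_def by (rule conv_has_vector_derivative[OF f1 p1 order_refl d\<theta>(3,4) b\<theta>(2-4)])
    then have c\<Phi>2: "continuous_on UNIV (\<Phi>2 k)" for k by (rule has_vector_derivative_continuous_on)
    have c\<Phi>: "continuous_on UNIV (\<Phi> k)" for k by (rule has_vector_derivative_continuous_on[OF d\<Phi>(1)])
    define V F where "V k t = R k (\<Phi> k t)" and "F k t = R k (\<Phi>2 k t) - Q k (\<Phi> k t)" for k t
    have cV: "continuous_on UNIV (V k)" for k unfolding V_def by (intro bounded_linear.continuous_on[OF RQ(1)] c\<Phi>)
    have cF: "continuous_on UNIV (F k)" for k unfolding F_def[abs_def]
      by (intro continuous_intros bounded_linear.continuous_on[OF RQ(1)] bounded_linear.continuous_on[OF RQ(2)] c\<Phi> c\<Phi>2)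
    have mV [measurable]: "(\<lambda>t. (norm (V k t))\<^sup>2) \<in> borel_measurable borel" "(\<lambda>t. (norm (F k t))\<^sup>2) \<in> borel_measurable borel" for k
      by (intro borel_measurable_continuous_onI continuous_intros cV cF)+
    define LHS where "LHS k = (\<integral>\<^sup>+t. ennreal (d\<^sup>2 * (exp (2 * \<mu> * t) * (\<eta> t)\<^sup>2 * (norm (V k t))\<^sup>2)) * indicator {\<alpha>..b} t \<partial>lborel)" for k
    let ?v2 = "\<lambda>s. ennreal ((v s)\<^sup>2) * indicator {a..b} s"
    \<comment> \<open>Independent of \<open>k\<close>, at the price that the source is measured by
      \<kappa>v and not by the regularised solution.\<close>
    define B where "B = (\<integral>\<^sup>+s. WF s * (ennreal ((\<kappa> * v s)\<^sup>2) * indicator {a..b} s) \<partial>lborel) + (\<integral>\<^sup>+s. WV s * ?v2 s \<partial>lborel)"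
    have step: "LHS k \<le> B" if k: "k > 0" "1 / real k \<le> \<epsilon>" for k
    proof -
      have Nk: "N k > 0" using k(1) N(1)[of k] by simp
      have Nk': "1 / real (N k) \<le> \<epsilon>"
      proof -
        have "1 / real (N k) \<le> 1 / real k" using k(1) N(1)[of k] by (intro divide_left_mono) auto
        then show ?thesis using k(2) by simp
      qed
      have "ennreal (integral {\<alpha>..b} (\<lambda>t. d\<^sup>2 * (exp (2 * \<mu> * t) * (\<eta> t)\<^sup>2 * (norm (R k (\<Phi> k t)))\<^sup>2)))
        \<le> ennreal (integral {\<alpha>..b} (\<lambda>t. exp (2 * \<mu> * t) * ((2 * (\<eta> t)\<^sup>2 + 16 * (\<eta>1 t)\<^sup>2) * (norm (R k (\<Phi>2 k t) - Q k (\<Phi> k t)))\<^sup>2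
        + (16 * (2 * \<gamma> + 1) * (\<eta>1 t)\<^sup>2 + 64 * (\<eta>2 t + \<mu> * \<eta>1 t)\<^sup>2 + 4 * (\<eta>2 t)\<^sup>2) * (norm (R k (\<Phi> k t)))\<^sup>2)))"
      proof (rule ennreal_leI, rule localized_carleman_estimate[OF RQ(1,2) symRQ carl[OF RQ(1,2,3,4)] ab(3,4) lowRQ])
      qed (use d\<Phi> c\<Phi>2 \<eta> \<eta>1z in auto)
      also have "(\<lambda>t. exp (2 * \<mu> * t) * ((2 * (\<eta> t)\<^sup>2 + 16 * (\<eta>1 t)\<^sup>2) * (norm (R k (\<Phi>2 k t) - Q k (\<Phi> k t)))\<^sup>2
        + (16 * (2 * \<gamma> + 1) * (\<eta>1 t)\<^sup>2 + 64 * (\<eta>2 t + \<mu> * \<eta>1 t)\<^sup>2 + 4 * (\<eta>2 t)\<^sup>2) * (norm (R k (\<Phi> k t)))\<^sup>2))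
        = (\<lambda>t. wF t * (norm (F k t))\<^sup>2 + wV t * (norm (V k t))\<^sup>2)"
        by (simp add: fun_eq_iff wF_def wV_def V_def F_def algebra_simps)
      also have "ennreal (integral {\<alpha>..b} (\<lambda>t. d\<^sup>2 * (exp (2 * \<mu> * t) * (\<eta> t)\<^sup>2 * (norm (R k (\<Phi> k t)))\<^sup>2))) = LHS k"
        unfolding LHS_def V_def[symmetric]
        by (rule ennreal_integral_eq_nn_integral) (auto intro!: continuous_intros c\<eta> cV)
      also have "ennreal (integral {\<alpha>..b} (\<lambda>t. wF t * (norm (F k t))\<^sup>2 + wV t * (norm (V k t))\<^sup>2))
        = (\<integral>\<^sup>+t. ennreal (wF t * (norm (F k t))\<^sup>2 + wV t * (norm (V k t))\<^sup>2) * indicator {\<alpha>..b} t \<partial>lborel)"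
        by (rule ennreal_integral_eq_nn_integral)
          (auto intro!: continuous_intros c\<eta> \<eta>(3) cV cF w0 simp: wF_def[abs_def] wV_def[abs_def] \<gamma>0 add_nonneg_nonneg)
      also have "\<dots> = (\<integral>\<^sup>+t. (ennreal (wF t) * indicator {\<alpha>..b} t) * ennreal ((norm (F k t))\<^sup>2)
          + (ennreal (wV t) * indicator {\<alpha>..b} t) * ennreal ((norm (V k t))\<^sup>2) \<partial>lborel)"
        by (intro nn_integral_cong) (auto simp: indicator_def ennreal_mult w0)
      also have "\<dots> = (\<integral>\<^sup>+t. (ennreal (wF t) * indicator {\<alpha>..b} t) * ennreal ((norm (F k t))\<^sup>2) \<partial>lborel)
          + (\<integral>\<^sup>+t. (ennreal (wV t) * indicator {\<alpha>..b} t) * ennreal ((norm (V k t))\<^sup>2) \<partial>lborel)"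
        by (rule nn_integral_add) measurable
      also have "\<dots> \<le> B" unfolding B_def
      proof (rule add_mono)
        \<comment> \<open>Almost everywhere this is \<open>R k\<close> applied to the residual of
          the equation, because \<open>R k\<close> commutes with \<open>A\<close> on its domain;
          contractivity then bounds it by \<kappa>v.\<close>
        define f where "f s = R k (\<phi>'' s) - Q k (\<phi> s)" for s
        have i1: "(\<lambda>s. \<theta> (N k) (t - s) *\<^sub>R R k (\<phi>'' s)) integrable_on {a..b}"
          and i2: "(\<lambda>s. \<theta> (N k) (t - s) *\<^sub>R Q k (\<phi> s)) integrable_on {a..b}" for t
          by (rule conv_bounded_linear(2)[OF f2 cont bound RQ(1)] conv_bounded_linear(2)[OF f1 cont bound RQ(2)])+
        have if': "(\<lambda>s. \<theta> (N k) (t - s) *\<^sub>R f s) integrable_on {a..b}" for t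
          using integrable_diff[OF i1 i2, of t t] by (simp add: f_def scaleR_diff_right)
        have Fc: "F k t = conv a b (\<theta> (N k)) f t" if t: "t \<in> {\<alpha>..b}" for t
        proof -
          have "a + 1 / real (N k) \<le> t" using t Nk' by (auto simp: \<epsilon>_def a_def \<alpha>_def)
          then have "\<Phi>2 k t = conv a b (\<theta> (N k)) \<phi>'' t" unfolding \<Phi>2_def using t by (intro wk Nk weak ab(1)) auto
          then have "F k t = conv a b (\<theta> (N k)) (\<lambda>s. R k (\<phi>'' s)) t - conv a b (\<theta> (N k)) (\<lambda>s. Q k (\<phi> s)) t"
            unfolding F_def \<Phi>_def by (simp add: conv_bounded_linear(1)[OF f2 cont bound RQ(1)] conv_bounded_linear(1)[OF f1 cont bound RQ(2)])
          also have "\<dots> = conv a b (\<theta> (N k)) f t"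
            unfolding conv_def f_def by (simp add: integral_diff[OF i1 i2] scaleR_diff_right)
          finally show ?thesis .
        qed
        have "(\<integral>\<^sup>+t. (ennreal (wF t) * indicator {\<alpha>..b} t) * ennreal ((norm (F k t))\<^sup>2) \<partial>lborel)
          = (\<integral>\<^sup>+t. (ennreal (wF t) * indicator {\<alpha>..b} t) * ennreal ((norm (conv a b (\<theta> (N k)) f t))\<^sup>2) \<partial>lborel)"
          by (intro nn_integral_cong) (auto simp: indicator_def Fc)
        also have "\<dots> \<le> (\<integral>\<^sup>+s. WF s * (ennreal ((\<kappa> * v s)\<^sup>2) * indicator {a..b} s) \<partial>lborel)"
        proof (rule conv_weighted_square_le[OF Nk if'])
          show "AE s in lebesgue. s \<in> {a..b} \<longrightarrow> norm (f s) \<le> \<kappa> * v s"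
            using dom v(3) ineq
          proof eventually_elim
            case (elim s)
            show ?case
            proof
              assume s: "s \<in> {a..b}"
              then have s0: "s > 0" "s > \<tau>" using ab(1) r by (auto simp: a_def)
              have "f s = R k (\<phi>'' s - the (A (\<phi> s)))"
                using elim(1) s0 by (simp add: f_def RQ(5) linear_diff[OF bounded_linear.linear[OF RQ(1)]])
              then have "norm (f s) \<le> norm (\<phi>'' s - the (A (\<phi> s)))" using RQ(6) by simp
              also have "\<dots> \<le> \<kappa> * v s" using elim s0 by simp
              finally show "norm (f s) \<le> \<kappa> * v s" .
            qed
          qed
          show "ennreal (wF t) * indicator {\<alpha>..b} t \<le> WF s" if "0 \<le> t - s" "t - s \<le> 1 / real (N k)" for s t
            using domW[of t s] that Nk' by auto
        qed (use v \<kappa> in auto)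
        finally show "(\<integral>\<^sup>+t. (ennreal (wF t) * indicator {\<alpha>..b} t) * ennreal ((norm (F k t))\<^sup>2) \<partial>lborel)
          \<le> (\<integral>\<^sup>+s. WF s * (ennreal ((\<kappa> * v s)\<^sup>2) * indicator {a..b} s) \<partial>lborel)" .
        have Vc: "V k t = conv a b (\<theta> (N k)) (\<lambda>s. R k (\<phi> s)) t" for t
          unfolding V_def \<Phi>_def by (rule conv_bounded_linear(1)[OF f1 cont bound RQ(1)])
        show "(\<integral>\<^sup>+t. (ennreal (wV t) * indicator {\<alpha>..b} t) * ennreal ((norm (V k t))\<^sup>2) \<partial>lborel) \<le> (\<integral>\<^sup>+s. WV s * ?v2 s \<partial>lborel)"
          unfolding Vc
        proof (rule conv_weighted_square_le[OF Nk conv_bounded_linear(2)[OF f1 cont bound RQ(1)]])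
          show "AE s in lebesgue. s \<in> {a..b} \<longrightarrow> norm (R k (\<phi> s)) \<le> v s"
            using v(3)
          proof eventually_elim
            case (elim s)
            then show ?case using RQ(6)[of k "\<phi> s"] ab(1) by auto
          qed
          show "ennreal (wV t) * indicator {\<alpha>..b} t \<le> WV s" if "0 \<le> t - s" "t - s \<le> 1 / real (N k)" for s t
            using domW[of t s] that Nk' by auto
        qed (use v in auto)
      qed
      finally show ?thesis .
    qed

    \<comment> \<open>Removing the regularisation and absorbing the perturbation\<close>
    define X where "X = (exp_energy v \<mu> {\<tau> + 3 * r..T})"
    define Y where "Y = (exp_energy v \<mu> Z)"
    obtain k0 :: nat where k0: "1 / \<epsilon> < real k0" using reals_Archimedean2 by blast
    have small: "k > 0 \<and> 1 / real k \<le> \<epsilon>" if "k \<ge> k0" for k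
    proof -
      have "real k > 1 / \<epsilon>" using k0 that by (meson less_le_trans of_nat_mono)
      moreover have "1 / \<epsilon> > 0" using \<epsilon> by simp
      ultimately have "real k > 0" by linarith
      then show ?thesis using \<open>real k > 1 / \<epsilon>\<close> \<epsilon> by (simp add: field_simps)
    qed
    \<comment> \<open>Mollification and resolvent are removed along the same sequence: contractivity
      controls \<open>R k\<close> on the mollification error, and strong convergence handles
      \<open>R k (\<phi> t)\<close>.\<close>
    have Vlim: "AE t in lborel. t \<in> {\<alpha>..b} \<longrightarrow> (\<lambda>k. V k t) \<longlonglongrightarrow> \<phi> t \<and> norm (\<phi> t) = v t"
    proof (subst AE_completion_iff[symmetric], use N(2) v(3) in eventually_elim)
      case (elim t)
      show ?case
      proof
        assume t: "t \<in> {\<alpha>..b}"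
        have 1: "(\<lambda>k. \<Phi> k t) \<longlonglongrightarrow> \<phi> t" using elim(1) t unfolding \<Phi>_def by blast
        have "(\<lambda>k. R k (\<Phi> k t - \<phi> t)) \<longlonglongrightarrow> 0"
        proof (rule Lim_null_comparison)
          show "\<forall>\<^sub>F k in sequentially. norm (R k (\<Phi> k t - \<phi> t)) \<le> norm (\<Phi> k t - \<phi> t)" using RQ(6) by simp
          show "(\<lambda>k. norm (\<Phi> k t - \<phi> t)) \<longlonglongrightarrow> 0" using 1 LIM_zero tendsto_norm_zero by blast
        qed
        then have "(\<lambda>k. R k (\<Phi> k t - \<phi> t) + R k (\<phi> t)) \<longlonglongrightarrow> 0 + \<phi> t" by (intro tendsto_add Rlim)
        then have "(\<lambda>k. V k t) \<longlonglongrightarrow> \<phi> t" by (simp add: V_def linear_diff[OF bounded_linear.linear[OF RQ(1)]])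
        then show "(\<lambda>k. V k t) \<longlonglongrightarrow> \<phi> t \<and> norm (\<phi> t) = v t" using elim(2) t ab by auto
      qed
    qed
    \<comment> \<open>Fatou's lemma for the left-hand sides; the cutoff equals 1 on
      \<open>{\<tau> + 3 * r..T}\<close>.\<close>
    have "ennreal (d\<^sup>2) * X = (\<integral>\<^sup>+t. ennreal (d\<^sup>2 * (exp (2 * \<mu> * t) * (v t)\<^sup>2)) * indicator {\<tau> + 3 * r..T} t \<partial>lborel)"
      unfolding X_def by (subst nn_integral_cmult[symmetric]) (auto simp: ennreal_mult mult.assoc)
    also have "\<dots> \<le> (\<integral>\<^sup>+t. liminf (\<lambda>k. ennreal (d\<^sup>2 * (exp (2 * \<mu> * t) * (\<eta> t)\<^sup>2 * (norm (V k t))\<^sup>2)) * indicator {\<alpha>..b} t) \<partial>lborel)"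
    proof (rule nn_integral_mono_AE)
      show "AE t in lborel. ennreal (d\<^sup>2 * (exp (2 * \<mu> * t) * (v t)\<^sup>2)) * indicator {\<tau> + 3 * r..T} t
        \<le> liminf (\<lambda>k. ennreal (d\<^sup>2 * (exp (2 * \<mu> * t) * (\<eta> t)\<^sup>2 * (norm (V k t))\<^sup>2)) * indicator {\<alpha>..b} t)"
        using Vlim
      proof eventually_elim
        case (elim t)
        show ?case
        proof (cases "t \<in> {\<tau> + 3 * r..T}")
          case True
          then have t: "t \<in> {\<alpha>..b}" "\<eta> t = 1" using r by (auto simp: \<alpha>_def b_def intro!: \<eta>(5))
          have "(\<lambda>k. ennreal (d\<^sup>2 * (exp (2 * \<mu> * t) * (norm (V k t))\<^sup>2))) \<longlonglongrightarrow> ennreal (d\<^sup>2 * (exp (2 * \<mu> * t) * (norm (\<phi> t))\<^sup>2))"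
            using elim t(1) by (intro tendsto_ennrealI tendsto_intros) auto
          from lim_imp_Liminf[OF _ this] show ?thesis using elim t True by simp
        qed simp
      qed
    qed
    also have "\<dots> \<le> liminf LHS" unfolding LHS_def by (rule nn_integral_liminf) measurable
    also have "\<dots> \<le> B"
    proof -
      have "liminf LHS \<le> liminf (\<lambda>_. B)"
        by (rule Liminf_mono) (use step small in \<open>auto simp: eventually_sequentially intro!: exI[of _ k0]\<close>)
      then show ?thesis by (simp add: Liminf_const)
    qed
    also have "B \<le> ennreal (4 * \<kappa>\<^sup>2) * X + ennreal (D0 * (1 + \<mu>)\<^sup>2) * Y"
    proof -
      let ?p = "\<lambda>s. ennreal (exp (2 * \<mu> * s) * (v s)\<^sup>2)"
      have "B = (\<integral>\<^sup>+s. WF s * (ennreal ((\<kappa> * v s)\<^sup>2) * indicator {a..b} s) + WV s * ?v2 s \<partial>lborel)"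
        unfolding B_def by (rule nn_integral_add[symmetric]) measurable
      also have "\<dots> \<le> (\<integral>\<^sup>+s. ennreal (4 * \<kappa>\<^sup>2) * (?p s * indicator {\<tau> + 3 * r..T} s)
          + ennreal (D0 * (1 + \<mu>)\<^sup>2) * (?p s * indicator Z s) \<partial>lborel)"
      proof (rule nn_integral_mono)
        fix s
        have D1: "4 * \<kappa>\<^sup>2 + 32 * K\<^sup>2 * \<kappa>\<^sup>2 + 2 * KV \<le> D0 * (1 + \<mu>)\<^sup>2"
        proof -
          have "(4 * \<kappa>\<^sup>2 + 32 * K\<^sup>2 * \<kappa>\<^sup>2) * 1 \<le> (4 * \<kappa>\<^sup>2 + 32 * K\<^sup>2 * \<kappa>\<^sup>2) * (1 + \<mu>)\<^sup>2"
            using e1 by (intro mult_left_mono) auto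
          then show ?thesis by (simp add: D0_def KV_def algebra_simps)
        qed
        define P where "P = exp (2 * \<mu> * s) * (v s)\<^sup>2"
        have P: "P \<ge> 0" by (simp add: P_def)
        define z where "z = (indicator Z s :: real)"
        define i where "i = (indicator {a..b} s :: real)"
        define j where "j = (indicator {\<tau> + 3 * r..T} s :: real)"
        \<comment> \<open>The inequality for \<open>i\<close> says that \<open>{a..b}\<close> is
          covered by the main interval and the zones.\<close>
        have ij: "i \<le> j + z * i" "z \<ge> 0" "i \<ge> 0" "j \<ge> 0" "z * i \<le> z" "i * i = i"
          by (auto simp: i_def j_def z_def indicator_def Z_def a_def b_def)
        have "WF s * (ennreal ((\<kappa> * v s)\<^sup>2) * indicator {a..b} s) + WV s * ?v2 s
          = ennreal ((4 * i + 32 * K\<^sup>2 * z) * \<kappa>\<^sup>2 * P * i + 2 * KV * z * P * i)"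
          unfolding WF_def WV_def E_def
          by (auto simp: z_def i_def P_def indicator_def KV0 power_mult_distrib mult_ac distrib_left distrib_right
              simp del: ennreal_numeral simp flip: ennreal_mult ennreal_plus)
        also have "\<dots> \<le> ennreal (4 * \<kappa>\<^sup>2 * (P * j) + D0 * (1 + \<mu>)\<^sup>2 * (P * z))"
        proof (rule ennreal_leI)
          have "(4 * i + 32 * K\<^sup>2 * z) * \<kappa>\<^sup>2 * P * i + 2 * KV * z * P * i
            = 4 * \<kappa>\<^sup>2 * P * (i * i) + (32 * K\<^sup>2 * \<kappa>\<^sup>2 + 2 * KV) * P * (z * i)" by (simp add: algebra_simps)
          also have "\<dots> \<le> 4 * \<kappa>\<^sup>2 * P * (j + z * i) + (32 * K\<^sup>2 * \<kappa>\<^sup>2 + 2 * KV) * P * (z * i)"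
            unfolding ij(6) using ij(1) P by (intro add_right_mono mult_left_mono) auto
          also have "\<dots> = 4 * \<kappa>\<^sup>2 * (P * j) + (4 * \<kappa>\<^sup>2 + 32 * K\<^sup>2 * \<kappa>\<^sup>2 + 2 * KV) * (P * (z * i))" by (simp add: algebra_simps)
          also have "\<dots> \<le> 4 * \<kappa>\<^sup>2 * (P * j) + D0 * (1 + \<mu>)\<^sup>2 * (P * z)"
            using D1 ij P D0 by (intro add_left_mono mult_mono mult_left_mono) auto
          finally show "(4 * i + 32 * K\<^sup>2 * z) * \<kappa>\<^sup>2 * P * i + 2 * KV * z * P * i \<le> 4 * \<kappa>\<^sup>2 * (P * j) + D0 * (1 + \<mu>)\<^sup>2 * (P * z)" .
        qed
        also have "\<dots> = ennreal (4 * \<kappa>\<^sup>2) * (?p s * indicator {\<tau> + 3 * r..T} s) + ennreal (D0 * (1 + \<mu>)\<^sup>2) * (?p s * indicator Z s)"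
          using D0 P by (auto simp: z_def j_def P_def[symmetric] indicator_def simp flip: ennreal_mult ennreal_plus)
        finally show "WF s * (ennreal ((\<kappa> * v s)\<^sup>2) * indicator {a..b} s) + WV s * ?v2 s
          \<le> ennreal (4 * \<kappa>\<^sup>2) * (?p s * indicator {\<tau> + 3 * r..T} s) + ennreal (D0 * (1 + \<mu>)\<^sup>2) * (?p s * indicator Z s)" .
      qed
      also have "\<dots> = ennreal (4 * \<kappa>\<^sup>2) * X + ennreal (D0 * (1 + \<mu>)\<^sup>2) * Y"
      proof -
        have [measurable]: "Z \<in> sets borel" by (simp add: Z_def)
        show ?thesis unfolding X_def Y_def by (simp add: nn_integral_add nn_integral_cmult)
      qed
      finally show ?thesis .
    qed
    finally have main: "ennreal (d\<^sup>2) * X \<le> ennreal (4 * \<kappa>\<^sup>2) * X + ennreal (D0 * (1 + \<mu>)\<^sup>2) * Y" .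
    have "X \<le> (\<integral>\<^sup>+t. ennreal (exp (2 * \<mu> * T)) * (ennreal ((v t)\<^sup>2) * indicator {\<tau> + 3 * r..T} t) \<partial>lborel)"
      unfolding X_def
      by (intro nn_integral_mono) (auto simp: indicator_def \<mu> mult_left_mono intro!: ennreal_leI mult_right_mono simp flip: ennreal_mult)
    also have "\<dots> = ennreal (exp (2 * \<mu> * T)) * (\<integral>\<^sup>+t. ennreal ((v t)\<^sup>2) * indicator {\<tau> + 3 * r..T} t \<partial>lborel)"
      by (rule nn_integral_cmult) measurable
    also have "\<dots> < \<infinity>" using fin[of "\<tau> + 3 * r" T] \<tau> r by (simp add: ennreal_mult_less_top)
    \<comment> \<open>Finiteness of \<open>X\<close> is what permits moving 4\<kappa>^2 X to the
      left.\<close>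
    finally obtain x where x: "X = ennreal x" "0 \<le> x" by (cases X rule: ennreal_cases) auto
    have "X \<le> ennreal (2 * D0 * (1 + \<mu>)\<^sup>2 / d\<^sup>2) * Y"
    proof (cases Y rule: ennreal_cases)
      case (real y)
      have "ennreal (d\<^sup>2 * x) \<le> ennreal (4 * \<kappa>\<^sup>2 * x + D0 * (1 + \<mu>)\<^sup>2 * y)"
        using main x real D0 by (simp add: ennreal_mult ennreal_plus)
      then have "d\<^sup>2 * x \<le> 4 * \<kappa>\<^sup>2 * x + D0 * (1 + \<mu>)\<^sup>2 * y" using x real D0 by (subst (asm) ennreal_le_iff) auto
      moreover have "8 * \<kappa>\<^sup>2 * x \<le> d\<^sup>2 * x" using d(2) x by (intro mult_right_mono) auto
      ultimately have "d\<^sup>2 * x \<le> 2 * D0 * (1 + \<mu>)\<^sup>2 * y" by (simp add: algebra_simps)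
      then have "x \<le> 2 * D0 * (1 + \<mu>)\<^sup>2 / d\<^sup>2 * y" using d(1) by (simp add: field_simps)
      then show ?thesis using x real D0 by (simp add: ennreal_leI flip: ennreal_mult)
    next
      \<comment> \<open>If the zones have infinite energy, the right-hand side is infinite, except
        that \<open>D0 = 0\<close> makes it zero; then the main inequality itself forces
        \<open>X\<close> to vanish.\<close>
      case top
      show ?thesis
      proof (cases "D0 = 0")
        case True
        then have "ennreal (d\<^sup>2 * x) \<le> ennreal (4 * \<kappa>\<^sup>2 * x)" using main x by (simp add: ennreal_mult)
        then have "d\<^sup>2 * x \<le> 4 * \<kappa>\<^sup>2 * x" using x by (subst (asm) ennreal_le_iff) auto
        moreover have "8 * \<kappa>\<^sup>2 * x \<le> d\<^sup>2 * x" using d(2) x by (intro mult_right_mono) auto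
        ultimately have "d\<^sup>2 * x \<le> 0" by (simp add: algebra_simps)
        then have "x \<le> 0" using d(1) by (simp add: mult_le_0_iff)
        then show ?thesis using x by simp
      next
        case False
        then have "2 * D0 * (1 + \<mu>)\<^sup>2 / d\<^sup>2 > 0" using D0 d(1) \<mu> by simp
        moreover have "ennreal q * top = top" if "q > 0" for q
          using that by (simp add: ennreal_mult_eq_top_iff)
        ultimately show ?thesis unfolding top by (metis top_greatest)
      qed
    qed
    then show "(exp_energy v \<mu> {\<tau> + 3 * r..T})
      \<le> ennreal (2 * D0 * (1 + \<mu>)\<^sup>2 / d\<^sup>2) * (exp_energy v \<mu> ({\<tau> + r..\<tau> + 3 * r} \<union> {T - r..T + r}))"
      by (simp add: X_def Y_def Z_def)
  qed
qed

section \<open>Unique continuation at infinity\<close>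

lemma le_of_forall_ennreal_add:
  fixes p q C :: real
  assumes "\<And>\<epsilon>. \<epsilon> > 0 \<Longrightarrow> p \<le> C * (q + \<epsilon>)" "C \<ge> 0"
  shows "p \<le> C * q"
proof (rule field_le_epsilon)
  fix e :: real assume e: "e > 0"
  have "p \<le> C * (q + e / (C + 1))" using assms e by (intro assms(1)) auto
  also have "\<dots> = C * q + C / (C + 1) * e" by (simp add: algebra_simps)
  also have "C / (C + 1) * e \<le> 1 * e" using assms(2) e by (intro mult_right_mono) (auto simp: field_simps)
  finally show "p \<le> C * q + e" by simp
qed

lemma square_times_exp_decay:
  fixes r :: real
  assumes "r > 0"
  shows "((\<lambda>\<mu>. D * (1 + \<mu>)\<^sup>2 * exp (- (2 * \<mu> * r))) \<longlongrightarrow> 0) at_top"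
proof -
  have f: "filterlim (\<lambda>\<mu>. 2 * r * \<mu>) at_top at_top"
    using assms by (intro filterlim_tendsto_pos_mult_at_top[OF tendsto_const]) (auto intro: filterlim_ident)
  have p: "((\<lambda>\<mu>. (2 * r * \<mu>) ^ k / exp (2 * r * \<mu>)) \<longlongrightarrow> 0) at_top" for k :: nat
    using filterlim_compose[OF tendsto_power_div_exp_0 f] .
  have "((\<lambda>\<mu>. D * ((2 * r * \<mu>) ^ 0 / exp (2 * r * \<mu>) + 1 / r * ((2 * r * \<mu>) ^ 1 / exp (2 * r * \<mu>))
     + 1 / (4 * r\<^sup>2) * ((2 * r * \<mu>) ^ 2 / exp (2 * r * \<mu>)))) \<longlongrightarrow> D * (0 + 1 / r * 0 + 1 / (4 * r\<^sup>2) * 0)) at_top"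
    by (intro tendsto_intros p)
  moreover have "(\<lambda>\<mu>. D * ((2 * r * \<mu>) ^ 0 / exp (2 * r * \<mu>) + 1 / r * ((2 * r * \<mu>) ^ 1 / exp (2 * r * \<mu>))
     + 1 / (4 * r\<^sup>2) * ((2 * r * \<mu>) ^ 2 / exp (2 * r * \<mu>)))) = (\<lambda>\<mu>. D * (1 + \<mu>)\<^sup>2 * exp (- (2 * \<mu> * r)))"
    using assms by (intro ext) (simp add: exp_minus field_simps power2_eq_square)
  ultimately have "((\<lambda>\<mu>. D * (1 + \<mu>)\<^sup>2 * exp (- (2 * \<mu> * r))) \<longlongrightarrow> D * (0 + 1 / r * 0 + 1 / (4 * r\<^sup>2) * 0)) at_top"
    by (simp only:)
  then show ?thesis by simp
qed

text \<open>The weight is at least e^(2\<mu>(\<tau> + 4r)) on the target and at most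
  e^(2\<mu>(\<tau> + 3r)) on the inner zone, so the energy on the target is at most a multiple of (1
  + \<mu>)^2 e^(-2\<mu>r), which tends to 0. Only unboundedly many \<open>\<mu>\<close> are asked
  for, since gaps determine the admissible values; \<open>T\<close> may depend on
  \<open>\<mu>\<close> and \<epsilon> to make the outer zone negligible.\<close>

lemma vanishing_from_weighted_bound:
  fixes v :: "real \<Rightarrow> real"
  assumes v [measurable]: "v \<in> borel_measurable borel" and v0: "\<And>t. 0 \<le> v t"
    and fin: "\<And>a b. 0 < a \<Longrightarrow> (\<integral>\<^sup>+t. ennreal ((v t)\<^sup>2) * indicator {a..b} t \<partial>lborel) < \<infinity>"
    and \<tau>: "0 \<le> \<tau>" and r: "r > 0" and D: "D \<ge> 0"
    and est: "\<And>S \<mu>0. \<exists>\<mu>\<ge>\<mu>0. 0 \<le> \<mu> \<and> (\<forall>\<epsilon>>0. \<exists>T\<ge>S.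
      (exp_energy v \<mu> {\<tau> + 3 * r..T})
        \<le> ennreal (D * (1 + \<mu>)\<^sup>2) * (exp_energy v \<mu> ({\<tau> + r..\<tau> + 3 * r} \<union> {T - r..T + r})) \<and>
      (exp_energy v \<mu> {T - r..T + r}) \<le> ennreal \<epsilon>)"
  shows "AE t in lborel. t > \<tau> + 4 * r \<longrightarrow> v t = 0"
proof -
  have P0: "(\<integral>\<^sup>+t. ennreal ((v t)\<^sup>2) * indicator {\<tau> + 4 * r..S} t \<partial>lborel) = 0" for S
  proof -
    obtain p where p: "(\<integral>\<^sup>+t. ennreal ((v t)\<^sup>2) * indicator {\<tau> + 4 * r..S} t \<partial>lborel) = ennreal p" "0 \<le> p"
      using fin[of "\<tau> + 4 * r" S] \<tau> r
      by (cases "\<integral>\<^sup>+t. ennreal ((v t)\<^sup>2) * indicator {\<tau> + 4 * r..S} t \<partial>lborel" rule: ennreal_cases) auto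
    obtain i where i: "(\<integral>\<^sup>+t. ennreal ((v t)\<^sup>2) * indicator {\<tau> + r..\<tau> + 3 * r} t \<partial>lborel) = ennreal i" "0 \<le> i"
      using fin[of "\<tau> + r" "\<tau> + 3 * r"] \<tau> r
      by (cases "\<integral>\<^sup>+t. ennreal ((v t)\<^sup>2) * indicator {\<tau> + r..\<tau> + 3 * r} t \<partial>lborel" rule: ennreal_cases) auto
    have "p \<le> 0"
    proof (rule ccontr)
      assume "\<not> p \<le> 0"
      then have p0: "p > 0" by simp
      have "((\<lambda>\<mu>. (D * i) * (1 + \<mu>)\<^sup>2 * exp (- (2 * \<mu> * r))) \<longlongrightarrow> 0) at_top" by (rule square_times_exp_decay[OF r])
      then have "\<forall>\<^sub>F \<mu> in at_top. (D * i) * (1 + \<mu>)\<^sup>2 * exp (- (2 * \<mu> * r)) < p"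
        using p0 by (rule order_tendstoD)
      then obtain \<mu>0 where \<mu>0: "\<And>\<mu>. \<mu> \<ge> \<mu>0 \<Longrightarrow> (D * i) * (1 + \<mu>)\<^sup>2 * exp (- (2 * \<mu> * r)) < p"
        by (auto simp: eventually_at_top_linorder)
      obtain \<mu> where \<mu>: "\<mu> \<ge> \<mu>0" "0 \<le> \<mu>" and H: "\<And>\<epsilon>. \<epsilon> > 0 \<Longrightarrow> \<exists>T\<ge>S.
      (exp_energy v \<mu> {\<tau> + 3 * r..T})
        \<le> ennreal (D * (1 + \<mu>)\<^sup>2) * (exp_energy v \<mu> ({\<tau> + r..\<tau> + 3 * r} \<union> {T - r..T + r})) \<and>
      (exp_energy v \<mu> {T - r..T + r}) \<le> ennreal \<epsilon>"
        using est[of \<mu>0 S] by blast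
      define C where "C = D * (1 + \<mu>)\<^sup>2"
      have C: "C \<ge> 0" using D by (simp add: C_def)
      define e3 e4 where "e3 = exp (2 * \<mu> * (\<tau> + 3 * r))" and "e4 = exp (2 * \<mu> * (\<tau> + 4 * r))"
      have e: "e3 > 0" "e4 > 0" by (simp_all add: e3_def e4_def)
      have "e4 * p \<le> C * (e3 * i)"
      proof (rule le_of_forall_ennreal_add[OF _ C])
        fix \<epsilon> :: real assume \<epsilon>: "\<epsilon> > 0"
        obtain T where T: "T \<ge> S" and X: "(exp_energy v \<mu> {\<tau> + 3 * r..T})
          \<le> ennreal (D * (1 + \<mu>)\<^sup>2) * (exp_energy v \<mu> ({\<tau> + r..\<tau> + 3 * r} \<union> {T - r..T + r}))"
          and Y: "(exp_energy v \<mu> {T - r..T + r}) \<le> ennreal \<epsilon>"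
          using H[OF \<epsilon>] by blast
        have mono: "ennreal (exp (2 * \<mu> * x)) * ennreal ((v t)\<^sup>2) \<le> ennreal (exp (2 * \<mu> * t) * (v t)\<^sup>2)" if "x \<le> t" for x t
          using that \<mu>(2) by (auto simp: mult_left_mono intro!: ennreal_leI mult_right_mono simp flip: ennreal_mult)
        have mono': "ennreal (exp (2 * \<mu> * t) * (v t)\<^sup>2) \<le> ennreal (exp (2 * \<mu> * x)) * ennreal ((v t)\<^sup>2)" if "t \<le> x" for x t
          using that \<mu>(2) by (auto simp: mult_left_mono intro!: ennreal_leI mult_right_mono simp flip: ennreal_mult)
        have "ennreal (e4 * p) = ennreal e4 * ennreal p" using e p by (simp add: ennreal_mult)
        also have "\<dots> = (\<integral>\<^sup>+t. ennreal e4 * (ennreal ((v t)\<^sup>2) * indicator {\<tau> + 4 * r..S} t) \<partial>lborel)"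
          unfolding p(1)[symmetric] by (rule nn_integral_cmult[symmetric]) measurable
        also have "\<dots> \<le> (exp_energy v \<mu> {\<tau> + 3 * r..T})"
        proof (rule nn_integral_mono)
          fix t
          show "ennreal e4 * (ennreal ((v t)\<^sup>2) * indicator {\<tau> + 4 * r..S} t)
            \<le> ennreal (exp (2 * \<mu> * t) * (v t)\<^sup>2) * indicator {\<tau> + 3 * r..T} t"
          proof (cases "t \<in> {\<tau> + 4 * r..S}")
            case True
            then show ?thesis using mono[of "\<tau> + 4 * r" t] T r by (simp add: e4_def)
          qed simp
        qed
        also have "\<dots> \<le> ennreal C * (exp_energy v \<mu> ({\<tau> + r..\<tau> + 3 * r} \<union> {T - r..T + r}))" using X by (simp only: C_def)
        also have "\<dots> \<le> ennreal C * (ennreal e3 * ennreal i + ennreal \<epsilon>)"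
        proof (rule mult_left_mono)
          have "(exp_energy v \<mu> ({\<tau> + r..\<tau> + 3 * r} \<union> {T - r..T + r}))
            \<le> (\<integral>\<^sup>+t. ennreal e3 * (ennreal ((v t)\<^sup>2) * indicator {\<tau> + r..\<tau> + 3 * r} t)
              + ennreal (exp (2 * \<mu> * t) * (v t)\<^sup>2) * indicator {T - r..T + r} t \<partial>lborel)"
          proof (rule nn_integral_mono)
            fix t
            have 1: "ennreal (exp (2 * \<mu> * t) * (v t)\<^sup>2) \<le> ennreal e3 * ennreal ((v t)\<^sup>2)" if "t \<le> \<tau> + 3 * r"
              using mono'[OF that] by (simp add: e3_def)
            show "ennreal (exp (2 * \<mu> * t) * (v t)\<^sup>2) * indicator ({\<tau> + r..\<tau> + 3 * r} \<union> {T - r..T + r}) t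
              \<le> ennreal e3 * (ennreal ((v t)\<^sup>2) * indicator {\<tau> + r..\<tau> + 3 * r} t)
              + ennreal (exp (2 * \<mu> * t) * (v t)\<^sup>2) * indicator {T - r..T + r} t"
            proof (cases "t \<in> {T - r..T + r}")
              case True
              then show ?thesis by (simp add: add_increasing)
            next
              case False
              then show ?thesis using 1 by (cases "t \<in> {\<tau> + r..\<tau> + 3 * r}") (auto simp: indicator_def)
            qed
          qed
          also have "\<dots> = (\<integral>\<^sup>+t. ennreal e3 * (ennreal ((v t)\<^sup>2) * indicator {\<tau> + r..\<tau> + 3 * r} t) \<partial>lborel)
              + (exp_energy v \<mu> {T - r..T + r})"
            by (rule nn_integral_add) measurable
          also have "(\<integral>\<^sup>+t. ennreal e3 * (ennreal ((v t)\<^sup>2) * indicator {\<tau> + r..\<tau> + 3 * r} t) \<partial>lborel) = ennreal e3 * ennreal i"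
            unfolding i(1)[symmetric] by (rule nn_integral_cmult) measurable
          also have "ennreal e3 * ennreal i + (exp_energy v \<mu> {T - r..T + r})
              \<le> ennreal e3 * ennreal i + ennreal \<epsilon>" using Y by (rule add_left_mono)
          finally show "(exp_energy v \<mu> ({\<tau> + r..\<tau> + 3 * r} \<union> {T - r..T + r}))
            \<le> ennreal e3 * ennreal i + ennreal \<epsilon>" .
        qed simp
        also have "\<dots> = ennreal (C * (e3 * i + \<epsilon>))" using C e i \<epsilon> by (simp add: ennreal_mult ennreal_plus)
        finally show "e4 * p \<le> C * (e3 * i + \<epsilon>)" using C e i \<epsilon> by (subst (asm) ennreal_le_iff) auto
      qed
      moreover have "e3 = e4 * exp (- (2 * \<mu> * r))" by (simp add: e3_def e4_def algebra_simps flip: exp_add)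
      ultimately have "e4 * p \<le> e4 * ((D * i) * (1 + \<mu>)\<^sup>2 * exp (- (2 * \<mu> * r)))" by (simp add: C_def mult_ac)
      then have "p \<le> (D * i) * (1 + \<mu>)\<^sup>2 * exp (- (2 * \<mu> * r))" using e(2) by simp
      with \<mu>0[OF \<mu>(1)] show False by simp
    qed
    then show ?thesis using p by simp
  qed
  have "AE t in lborel. t \<in> {\<tau> + 4 * r..real n} \<longrightarrow> v t = 0" for n :: nat
  proof -
    have "AE t in lborel. ennreal ((v t)\<^sup>2) * indicator {\<tau> + 4 * r..real n} t = 0"
      using P0[of "real n"] by (subst (asm) nn_integral_0_iff_AE) auto
    then show ?thesis
    proof eventually_elim
      case (elim t)
      show ?case
      proof
        assume "t \<in> {\<tau> + 4 * r..real n}"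
        then have "ennreal ((v t)\<^sup>2) = 0" using elim by simp
        then have "(v t)\<^sup>2 \<le> 0" by (simp add: ennreal_eq_0_iff)
        then show "v t = 0" by simp
      qed
    qed
  qed
  then have "AE t in lborel. \<forall>n::nat. t \<in> {\<tau> + 4 * r..real n} \<longrightarrow> v t = 0" unfolding AE_all_countable by blast
  then show ?thesis
  proof eventually_elim
    case (elim t)
    obtain n :: nat where "t < real n" using reals_Archimedean2 by blast
    then show ?case using elim[rule_format, of n] by auto
  qed
qed

text \<open>Finitely many disjoint sets of measure \<delta> already exhaust any bounded interval, so
  some gap contains a point \<open>w\<close> far out. Its position in the gap is unknown, but the
  gap is not contained in the interval of radius \<delta>/3 around \<open>w\<close>, which has
  measure 2\<delta>/3. The gap therefore contains an open interval of length \<delta>/3 on one side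
  of \<open>w\<close>.\<close>

lemma infinitely_many_gaps_far_out:
  assumes gaps: "infinitely_many_gaps \<delta> S" and \<delta>: "\<delta> > 0"
  shows "\<exists>m\<ge>\<Lambda>. complex_of_real ` {m - \<delta>/6<..<m + \<delta>/6} \<inter> S = {}"
proof -
  obtain \<I> where I: "infinite \<I>" "disjoint \<I>" "\<And>I. I \<in> \<I> \<Longrightarrow> is_interval I \<and> emeasure lborel I = ennreal \<delta> \<and>
    I \<subseteq> {0<..} \<and> complex_of_real ` I \<inter> S = {}"
    using gaps unfolding infinitely_many_gaps_def by blast
  \<comment> \<open>The summand \<delta> ensures that the centre still exceeds \<Lambda> after
    moving left from \<open>w\<close> by \<delta>/6.\<close>
  define K where "K = \<bar>\<Lambda>\<bar> + \<delta>"
  have K: "K > 0" using \<delta> by (simp add: K_def)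
  have "\<exists>I\<in>\<I>. \<exists>w\<in>I. w > K"
  proof (rule ccontr)
    assume "\<not> ?thesis"
    then have sub: "I \<subseteq> {0..K}" if "I \<in> \<I>" for I using I(3)[OF that] that by fastforce
    obtain n :: nat where n: "K / \<delta> < real n" using reals_Archimedean2 by blast
    obtain F where F: "F \<subseteq> \<I>" "finite F" "card F = n" using infinite_arbitrarily_large[OF I(1)] by blast
    have sets: "I \<in> sets lborel" if "I \<in> F" for I
      using I(3)[of I] F(1) that \<delta> by (intro emeasure_neq_0_sets) auto
    have "ennreal (real n * \<delta>) = (\<Sum>I\<in>F. emeasure lborel I)"
      using I(3) F \<delta> by (simp add: subset_eq ennreal_mult ennreal_of_nat_eq_real_of_nat)
    also have "\<dots> = emeasure lborel (\<Union>I\<in>F. I)"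
    proof (rule sum_emeasure)
      show "disjoint_family_on (\<lambda>I. I) F"
        using I(2) F(1) by (auto simp: disjoint_family_on_def disjoint_def)
    qed (use sets F in auto)
    also have "\<dots> \<le> emeasure lborel {0..K}" using sub F(1) by (intro emeasure_mono) auto
    also have "\<dots> = ennreal K" using K by simp
    finally have "real n * \<delta> \<le> K" using K by (simp add: ennreal_le_iff)
    then show False using n \<delta> by (simp add: field_simps)
  qed
  then obtain I0 w where w: "I0 \<in> \<I>" "w \<in> I0" "w > K" by blast
  have "\<exists>z\<in>I0. \<bar>z - w\<bar> > \<delta>/3"
  proof (rule ccontr)
    assume "\<not> ?thesis"
    then have "\<bar>x - w\<bar> \<le> \<delta>/3" if "x \<in> I0" for x using that by (meson not_less)
    have "I0 \<subseteq> {w - \<delta>/3..w + \<delta>/3}"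
    proof
      fix x assume "x \<in> I0"
      with \<open>\<And>x. x \<in> I0 \<Longrightarrow> \<bar>x - w\<bar> \<le> \<delta>/3\<close> have "\<bar>x - w\<bar> \<le> \<delta>/3" by blast
      then show "x \<in> {w - \<delta>/3..w + \<delta>/3}" unfolding atLeastAtMost_iff by linarith
    qed
    then have "emeasure lborel I0 \<le> emeasure lborel {w - \<delta>/3..w + \<delta>/3}" by (intro emeasure_mono) auto
    also have "\<dots> = ennreal (2 * \<delta> / 3)" using \<delta> by simp
    finally show False using I(3)[OF w(1)] \<delta> by (simp add: ennreal_le_iff)
  qed
  then obtain z where z: "z \<in> I0" "\<bar>z - w\<bar> > \<delta>/3" by blast
  have int: "x \<in> I0" if "min z w \<le> x" "x \<le> max z w" for x
  proof -
    have "is_interval I0" using I(3)[OF w(1)] by simp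
    then show ?thesis using that z(1) w(2) unfolding is_interval_1 by (metis max_def min_def)
  qed
  define m where "m = (if z < w then w - \<delta>/6 else w + \<delta>/6)"
  have "{m - \<delta>/6<..<m + \<delta>/6} \<subseteq> I0"
    using z(2) by (intro subsetI int) (auto simp: m_def min_def max_def abs_if split: if_splits)
  then have "complex_of_real ` {m - \<delta>/6<..<m + \<delta>/6} \<inter> S = {}" using I(3)[OF w(1)] by blast
  moreover have "m \<ge> \<Lambda>" using w(3) \<delta> by (auto simp: m_def K_def)
  ultimately show ?thesis by blast
qed

text \<open>A gap of length 2(d + |\<Lambda>|) on the positive axis has its midpoint beyond d +
  |\<Lambda>|: long gaps are automatically far out, and \<open>d\<close> can be prescribed
  freely.\<close>

lemma large_positive_gaps_far_out:
  assumes gaps: "large_positive_gaps S" and d: "d > 0"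
  shows "\<exists>m\<ge>\<Lambda>. complex_of_real ` {m - d<..<m + d} \<inter> S = {}"
proof -
  define L where "L = 2 * (d + \<bar>\<Lambda>\<bar>)"
  have "L > 0" using d by (simp add: L_def)
  then obtain l u where lu: "l < u" "u - l \<ge> L" "{l<..<u} \<subseteq> {0<..}" "complex_of_real ` {l<..<u} \<inter> S = {}"
    using gaps unfolding large_positive_gaps_def by blast
  have "l \<ge> 0"
  proof (rule ccontr)
    assume "\<not> l \<ge> 0"
    then obtain x where "l < x" "x < min u 0" using lu(1) dense[of l "min u 0"] by auto
    then show False using lu(3) by fastforce
  qed
  define m where "m = (l + u) / 2"
  have "{m - d<..<m + d} \<subseteq> {l<..<u}" using lu(2) by (auto simp: m_def L_def field_simps)
  then have "complex_of_real ` {m - d<..<m + d} \<inter> S = {}" using lu(4) by blast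
  moreover have "m \<ge> \<Lambda>" using lu(2) \<open>l \<ge> 0\<close> d by (simp add: m_def L_def)
  ultimately show ?thesis by blast
qed

theorem theorem1p4:
  fixes A :: "'a::complex_hilbert \<rightharpoonup> 'a"
    and \<phi> \<phi>'' :: "real \<Rightarrow> 'a"
    and b :: "real \<Rightarrow> real"
  assumes "self_adjoint A"
    and "lower_semibounded A"
    and "\<phi> \<in> X2_loc A"
    and "has_weak_deriv 2 \<phi> \<phi>''"
    and "b \<in> Linfty"
    and "AE t in half_line. norm (\<phi>'' t - the (A (\<phi> t))) \<le> b t * norm (\<phi> t)"
    and "large_positive_gaps (spectrum_op A) \<or>
         ((\<exists>\<delta>>0. infinitely_many_gaps \<delta> (spectrum_op A)) \<and> ess_tendsto_0_at_top b)"
    and "\<And>\<mu>::real. \<mu> > 0 \<Longrightarrow>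
         (\<integral>\<^sup>+t. ennreal (exp (2 * \<mu> * t) * (norm (\<phi> t))\<^sup>2) \<partial>half_line) < \<infinity>"
  shows "AE t in half_line. \<phi> t = 0"
proof -

  \<comment> \<open>From the function space to a scalar Borel function\<close>
  note A = assms(1) and weak = assms(4)
  obtain c where low: "bounded_below_by c A" using assms(2) by (auto simp: lower_semibounded_def)
  have "AE t in half_line. \<phi> t \<in> dom (plus_id (abs_op A))"
    using assms(3) by (simp add: X2_loc_def pullback_space_def)
  moreover have "dom (plus_id (abs_op A)) = dom A"
    using dom_abs_op[OF A assms(2)] by (auto simp: plus_id_def dom_def)
  ultimately have dom: "AE t in lebesgue. t > 0 \<longrightarrow> \<phi> t \<in> dom A" by (simp add: AE_half_line_iff)
  have sm: "strongly_measurable \<phi>" using weak by (simp add: has_weak_deriv_def Lp_loc_def)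
  obtain v where v: "v \<in> borel_measurable borel" "\<And>t. 0 \<le> v t" "AE t in lebesgue. t > 0 \<longrightarrow> norm (\<phi> t) = v t"
    using strongly_measurable_norm_version[OF sm] by blast
  note [measurable] = v(1)
  define J where "J \<mu> = (exp_energy v \<mu> {0<..})" for \<mu>
  have J: "J \<mu> < \<infinity>" if "\<mu> > 0" for \<mu>
  proof -
    have "(\<integral>\<^sup>+t. ennreal (exp (2 * \<mu> * t) * (norm (\<phi> t))\<^sup>2) \<partial>half_line)
      = (\<integral>\<^sup>+t. ennreal (exp (2 * \<mu> * t) * (norm (\<phi> t))\<^sup>2) * indicator {0<..} t \<partial>lebesgue)"
      by (rule nn_integral_restrict_space) auto
    also have "\<dots> = (\<integral>\<^sup>+t. ennreal (exp (2 * \<mu> * t) * (v t)\<^sup>2) * indicator {0<..} t \<partial>lebesgue)"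
      by (rule nn_integral_cong_AE) (use v(3) in \<open>eventually_elim, auto simp: indicator_def\<close>)
    finally show ?thesis using assms(8)[OF that] by (simp add: J_def nn_integral_completion)
  qed
  have fin: "(\<integral>\<^sup>+t. ennreal ((v t)\<^sup>2) * indicator {a..b} t \<partial>lborel) < \<infinity>" if a: "0 < a" for a b
  proof -
    have "(\<integral>\<^sup>+t. ennreal ((v t)\<^sup>2) * indicator {a..b} t \<partial>lborel) \<le> J 1"
      unfolding J_def
    proof (rule nn_integral_mono)
      fix t
      have "1 * (v t)\<^sup>2 \<le> exp (2 * 1 * t) * (v t)\<^sup>2" if "t > 0" using that by (intro mult_right_mono) auto
      then show "ennreal ((v t)\<^sup>2) * indicator {a..b} t \<le> ennreal (exp (2 * 1 * t) * (v t)\<^sup>2) * indicator {0<..} t"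
        using a by (auto simp: indicator_def intro: ennreal_leI)
    qed
    then show ?thesis using J[of 1] by simp
  qed
  \<comment> \<open>Comparing the exponents \<open>\<mu>\<close> and \<open>\<mu> + 1\<close> gains
    a factor that decays in \<open>T\<close>; the outer zone is thus controlled by the decay
    hypothesis at a larger exponent.\<close>
  have tail: "(exp_energy v \<mu> {T - r..T + r})
      \<le> ennreal (exp (- 2 * (T - r))) * J (\<mu> + 1)" if "T > r" for T r \<mu>
  proof -
    have "(exp_energy v \<mu> {T - r..T + r})
      \<le> (\<integral>\<^sup>+t. ennreal (exp (- 2 * (T - r))) * (ennreal (exp (2 * (\<mu> + 1) * t) * (v t)\<^sup>2) * indicator {0<..} t) \<partial>lborel)"
    proof (rule nn_integral_mono)
      fix t
      show "ennreal (exp (2 * \<mu> * t) * (v t)\<^sup>2) * indicator {T - r..T + r} t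
        \<le> ennreal (exp (- 2 * (T - r))) * (ennreal (exp (2 * (\<mu> + 1) * t) * (v t)\<^sup>2) * indicator {0<..} t)"
      proof (cases "t \<in> {T - r..T + r}")
        case True
        have "exp (2 * \<mu> * t) \<le> exp (- 2 * (T - r) + 2 * (\<mu> + 1) * t)" using True by (simp add: algebra_simps)
        then have "exp (2 * \<mu> * t) * (v t)\<^sup>2 \<le> (exp (- 2 * (T - r)) * exp (2 * (\<mu> + 1) * t)) * (v t)\<^sup>2"
          unfolding exp_add by (rule mult_right_mono) simp
        then have "ennreal (exp (2 * \<mu> * t) * (v t)\<^sup>2) \<le> ennreal (exp (- 2 * (T - r)) * (exp (2 * (\<mu> + 1) * t) * (v t)\<^sup>2))"
          by (intro ennreal_leI) (simp only: mult.assoc)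
        also have "\<dots> = ennreal (exp (- 2 * (T - r))) * ennreal (exp (2 * (\<mu> + 1) * t) * (v t)\<^sup>2)" by (rule ennreal_mult) auto
        finally show ?thesis using True that by simp
      qed simp
    qed
    also have "\<dots> = ennreal (exp (- 2 * (T - r))) * J (\<mu> + 1)" unfolding J_def by (rule nn_integral_cmult) measurable
    finally show ?thesis .
  qed
  have vanish_gap: "AE t in lborel. t > \<tau> + 4 * r \<longrightarrow> v t = 0"
    if \<tau>: "0 \<le> \<tau>" and r: "r > 0" and \<kappa>: "0 \<le> \<kappa>" and d: "d > 0" "8 * \<kappa>\<^sup>2 \<le> d\<^sup>2"
      and ineq: "AE t in lebesgue. t > \<tau> \<longrightarrow> norm (\<phi>'' t - the (A (\<phi> t))) \<le> \<kappa> * norm (\<phi> t)"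
      and gap: "\<And>\<Lambda>. \<exists>m\<ge>\<Lambda>. complex_of_real ` {m - d<..<m + d} \<inter> spectrum_op A = {}" for \<tau> r \<kappa> d
  proof -
    show ?thesis
    proof (rule weighted_l2_bound_by_cutoff_zones[OF A low dom weak v fin \<tau> \<kappa> r ineq])
      fix D assume D: "D \<ge> 0" and est: "\<And>T \<mu> d. \<tau> + 4 * r \<le> T \<Longrightarrow> 0 \<le> \<mu> \<Longrightarrow> 0 < d \<Longrightarrow> 8 * \<kappa>\<^sup>2 \<le> d\<^sup>2 \<Longrightarrow>
      (\<And>R Q. bounded_linear R \<Longrightarrow> bounded_linear Q \<Longrightarrow> (\<And>x. R x \<in> dom A) \<Longrightarrow> (\<And>x. Q x = the (A (R x))) \<Longrightarrow>
        carleman_estimate R Q \<mu> d (T + r)) \<Longrightarrow>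
      (exp_energy v \<mu> {\<tau> + 3 * r..T})
      \<le> ennreal (D * (1 + \<mu>)\<^sup>2 / d\<^sup>2) * (exp_energy v \<mu> ({\<tau> + r..\<tau> + 3 * r} \<union> {T - r..T + r}))"
    show "AE t in lborel. t > \<tau> + 4 * r \<longrightarrow> v t = 0"
    proof (rule vanishing_from_weighted_bound[OF v(1,2) fin \<tau> r, of "D / d\<^sup>2"])
      show "0 \<le> D / d\<^sup>2" using D by simp
      fix S \<mu>0 :: real
      \<comment> \<open>The centre of a gap becomes the square of \<mu>. The bound by
        \<open>\<bar>c\<bar>\<close> meets the requirement \<gamma> \<le> \<mu>^2 of the gap
        estimate, the bound by \<open>\<mu>0\<^sup>2\<close> makes \<mu> as large as
        desired.\<close>
      obtain m where m: "m \<ge> max \<bar>c\<bar> (\<mu>0\<^sup>2)" "complex_of_real ` {m - d<..<m + d} \<inter> spectrum_op A = {}"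
        using gap by blast
      define \<mu> where "\<mu> = sqrt m"
      have m0: "m \<ge> 0" using m(1) by (meson abs_ge_zero max.boundedE order_trans)
      have \<mu>m: "\<mu>\<^sup>2 = m" "\<mu> \<ge> 0" using m0 by (simp_all add: \<mu>_def)
      have "\<mu> \<ge> \<mu>0" unfolding \<mu>_def using m(1) by (intro real_le_rsqrt) simp
      have carl: "carleman_estimate R Q \<mu> d L"
        if "bounded_linear R" "bounded_linear Q" and R: "\<And>x. R x \<in> dom A" "\<And>x. Q x = the (A (R x))" for R Q L
      proof (rule carleman_estimate_gap[OF that(1,2), of "\<bar>c\<bar>"])
        show "inner (Q x) (R y) = inner (R x) (Q y)" for x y using self_adjoint_sym[OF A R(1) R(1)] by (simp add: R(2))
        show "- \<bar>c\<bar> * (norm (R x))\<^sup>2 \<le> inner (Q x) (R x)" for x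
        proof -
          have "- \<bar>c\<bar> * (norm (R x))\<^sup>2 \<le> c * (norm (R x))\<^sup>2" by (intro mult_right_mono) auto
          also have "\<dots> \<le> inner (Q x) (R x)" using low R(1)[of x] by (simp add: bounded_below_by_def Re_cinner R(2))
          finally show ?thesis .
        qed
        show "\<bar>c\<bar> \<le> \<mu>\<^sup>2" using m(1) \<mu>m(1) by simp
        show "d * norm (R x) \<le> norm (Q x - \<mu>\<^sup>2 *\<^sub>R R x)" for x
          using spectral_gap_lower_bound[OF A d(1) m(2) R(1), of x] by (simp add: \<mu>m(1) R(2))
      qed (use d in simp)
      have "\<exists>T\<ge>S. (exp_energy v \<mu> {\<tau> + 3 * r..T})
        \<le> ennreal (D / d\<^sup>2 * (1 + \<mu>)\<^sup>2) * (exp_energy v \<mu> ({\<tau> + r..\<tau> + 3 * r} \<union> {T - r..T + r})) \<and>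
        (exp_energy v \<mu> {T - r..T + r}) \<le> ennreal \<epsilon>" if \<epsilon>: "\<epsilon> > 0" for \<epsilon>
      proof -
        obtain j where j: "J (\<mu> + 1) = ennreal j" "0 \<le> j"
          using J[of "\<mu> + 1"] \<mu>m(2) by (cases "J (\<mu> + 1)" rule: ennreal_cases) auto
        \<comment> \<open>The last entry gives j \<le> \<epsilon>(T - r) \<le> \<epsilon> e^(2(T -
          r)), so the tail is at most \<epsilon>.\<close>
        define T where "T = Max {S, \<tau> + 4 * r, r + 1, r + j / \<epsilon>}"
        have T: "T \<ge> S" "T \<ge> \<tau> + 4 * r" "T > r" "T \<ge> r + j / \<epsilon>"
        proof -
          have "x \<le> T" if "x \<in> {S, \<tau> + 4 * r, r + 1, r + j / \<epsilon>}" for x unfolding T_def by (rule Max_ge) (use that in auto)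
          then show "T \<ge> S" "T \<ge> \<tau> + 4 * r" "T > r" "T \<ge> r + j / \<epsilon>" by fastforce+
        qed
        have "exp (- 2 * (T - r)) * j \<le> \<epsilon>"
        proof -
          have "j \<le> \<epsilon> * (T - r)" using T(4) \<epsilon> by (simp add: field_simps)
          also have "\<dots> \<le> \<epsilon> * exp (2 * (T - r))" 
          proof (rule mult_left_mono)
            have "y \<le> exp (2 * y)" if "y > 0" for y :: real
              using exp_ge_add_one_self[of "2 * y"] that by linarith
            from this[of "T - r"] show "T - r \<le> exp (2 * (T - r))" using T(3) by simp
          qed (use \<epsilon> in simp)
          finally have le: "j \<le> \<epsilon> * exp (2 * (T - r))" .
          have "inverse z * j \<le> \<epsilon>" if "z > 0" "j \<le> \<epsilon> * z" for z using that by (simp add: field_simps)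
          from this[OF _ le] show ?thesis by (simp flip: exp_minus)
        qed
        then have "ennreal (exp (- 2 * (T - r))) * J (\<mu> + 1) \<le> ennreal \<epsilon>"
          using j by (simp add: ennreal_leI flip: ennreal_mult)
        then have "(exp_energy v \<mu> {T - r..T + r}) \<le> ennreal \<epsilon>"
          using tail[OF T(3), of \<mu>] by (rule order_trans[rotated])
        moreover have "(exp_energy v \<mu> {\<tau> + 3 * r..T})
          \<le> ennreal (D * (1 + \<mu>)\<^sup>2 / d\<^sup>2) * (exp_energy v \<mu> ({\<tau> + r..\<tau> + 3 * r} \<union> {T - r..T + r}))"
          by (rule est[OF T(2) \<mu>m(2) d]) (rule carl)
        ultimately show ?thesis using T(1) by (intro exI[of _ T]) simp
      qed
      then show "\<exists>\<mu>\<ge>\<mu>0. 0 \<le> \<mu> \<and> (\<forall>\<epsilon>>0. \<exists>T\<ge>S.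
        (exp_energy v \<mu> {\<tau> + 3 * r..T})
        \<le> ennreal (D / d\<^sup>2 * (1 + \<mu>)\<^sup>2) * (exp_energy v \<mu> ({\<tau> + r..\<tau> + 3 * r} \<union> {T - r..T + r})) \<and>
        (exp_energy v \<mu> {T - r..T + r}) \<le> ennreal \<epsilon>)"
        using \<open>\<mu> \<ge> \<mu>0\<close> \<mu>m(2) by blast
    qed
    qed
  qed
  \<comment> \<open>Once \<open>v\<close> vanishes beyond \<open>T1\<close>, the outer zone can be
    put there and contributes nothing. Now \<open>T\<close> stays fixed while \<mu> grows, so the
    constant \<mu>/(T + r) of the estimate without gap dominates any \<kappa>.\<close>
  have vanish_continuation: "AE t in lborel. t > 0 + 4 * r \<longrightarrow> v t = 0"
    if r: "r > 0" and \<kappa>: "0 \<le> \<kappa>" and zero: "AE t in lborel. t > T1 \<longrightarrow> v t = 0"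
      and ineq: "AE t in lebesgue. t > 0 \<longrightarrow> norm (\<phi>'' t - the (A (\<phi> t))) \<le> \<kappa> * norm (\<phi> t)" for r \<kappa> T1
  proof -
    show ?thesis
    proof (rule weighted_l2_bound_by_cutoff_zones[OF A low dom weak v fin order_refl \<kappa> r ineq])
      fix D assume D: "D \<ge> 0" and est: "\<And>T \<mu> d. 0 + 4 * r \<le> T \<Longrightarrow> 0 \<le> \<mu> \<Longrightarrow> 0 < d \<Longrightarrow> 8 * \<kappa>\<^sup>2 \<le> d\<^sup>2 \<Longrightarrow>
      (\<And>R Q. bounded_linear R \<Longrightarrow> bounded_linear Q \<Longrightarrow> (\<And>x. R x \<in> dom A) \<Longrightarrow> (\<And>x. Q x = the (A (R x))) \<Longrightarrow>
        carleman_estimate R Q \<mu> d (T + r)) \<Longrightarrow>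
      (exp_energy v \<mu> {0 + 3 * r..T})
      \<le> ennreal (D * (1 + \<mu>)\<^sup>2 / d\<^sup>2) * (exp_energy v \<mu> ({0 + r..0 + 3 * r} \<union> {T - r..T + r}))"
    show "AE t in lborel. t > 0 + 4 * r \<longrightarrow> v t = 0"
    proof (rule vanishing_from_weighted_bound[OF v(1,2) fin order_refl r D])
      fix S \<mu>0 :: real
      define T where "T = Max {S, 4 * r, T1 + r + 1}"
      have T: "T \<ge> S" "T \<ge> 0 + 4 * r" "T > T1 + r"
      proof -
        have "x \<le> T" if "x \<in> {S, 4 * r, T1 + r + 1}" for x unfolding T_def by (rule Max_ge) (use that in auto)
        then show "T \<ge> S" "T \<ge> 0 + 4 * r" "T > T1 + r" by fastforce+
      qed
      have L: "T + r > 0" using T(2) r by linarith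
      define \<mu> where "\<mu> = Max {\<mu>0, 0, (3 * \<kappa> + 1) * (T + r)}"
      have \<mu>: "\<mu> \<ge> \<mu>0" "\<mu> \<ge> 0" "\<mu> \<ge> (3 * \<kappa> + 1) * (T + r)"
        unfolding \<mu>_def by (rule Max_ge; simp)+
      define d where "d = \<mu> / (T + r)"
      have d1: "d \<ge> 3 * \<kappa> + 1" using \<mu>(3) L by (simp add: d_def field_simps)
      then have d: "d > 0" "d \<ge> 1" using \<kappa> by linarith+
      have "8 * \<kappa>\<^sup>2 \<le> (3 * \<kappa>)\<^sup>2" by (simp add: power_mult_distrib)
      also have "\<dots> \<le> d\<^sup>2" using d1 \<kappa> by (intro power_mono) auto
      finally have d8: "8 * \<kappa>\<^sup>2 \<le> d\<^sup>2" .
      have carl: "carleman_estimate R Q \<mu> d (T + r)"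
        if "bounded_linear R" "bounded_linear Q" and R: "\<And>x. R x \<in> dom A" "\<And>x. Q x = the (A (R x))" for R Q
        unfolding d_def
      proof (rule carleman_estimate_bounded_interval[OF that(1,2) _ L])
        show "inner (Q x) (R y) = inner (R x) (Q y)" for x y using self_adjoint_sym[OF A R(1) R(1)] by (simp add: R(2))
      qed
      let ?Y = "\<integral>\<^sup>+t. ennreal (exp (2 * \<mu> * t) * (v t)\<^sup>2) * indicator ({0 + r..0 + 3 * r} \<union> {T - r..T + r}) t \<partial>lborel"
      have "(exp_energy v \<mu> {0 + 3 * r..T}) \<le> ennreal (D * (1 + \<mu>)\<^sup>2 / d\<^sup>2) * ?Y"
        by (rule est[OF T(2) \<mu>(2) d(1) d8]) (rule carl)
      also have "\<dots> \<le> ennreal (D * (1 + \<mu>)\<^sup>2) * ?Y"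
      proof (intro mult_right_mono ennreal_leI)
        have "1 \<le> d\<^sup>2" using d(2) by (simp add: one_le_power)
        then have "D * (1 + \<mu>)\<^sup>2 / d\<^sup>2 \<le> D * (1 + \<mu>)\<^sup>2 / 1" using D by (intro divide_left_mono) auto
        then show "D * (1 + \<mu>)\<^sup>2 / d\<^sup>2 \<le> D * (1 + \<mu>)\<^sup>2" by simp
      qed simp
      finally have est1: "(exp_energy v \<mu> {0 + 3 * r..T}) \<le> ennreal (D * (1 + \<mu>)\<^sup>2) * ?Y" .
      have "AE t in lborel. ennreal (exp (2 * \<mu> * t) * (v t)\<^sup>2) * indicator {T - r..T + r} t = 0"
        using zero by eventually_elim (use T(3) in \<open>auto simp: indicator_def\<close>)
      then have z: "(exp_energy v \<mu> {T - r..T + r}) = 0"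
        by (subst nn_integral_0_iff_AE) auto
      show "\<exists>\<mu>\<ge>\<mu>0. 0 \<le> \<mu> \<and> (\<forall>\<epsilon>>0. \<exists>T\<ge>S.
        (exp_energy v \<mu> {0 + 3 * r..T})
        \<le> ennreal (D * (1 + \<mu>)\<^sup>2) * (exp_energy v \<mu> ({0 + r..0 + 3 * r} \<union> {T - r..T + r})) \<and>
        (exp_energy v \<mu> {T - r..T + r}) \<le> ennreal \<epsilon>)"
        by (rule exI[of _ \<mu>], intro conjI \<mu>(1,2) allI impI, rule exI[of _ T], intro conjI T(1) est1) (simp add: z)
    qed
    qed
  qed

  \<comment> \<open>The bound on \<open>b\<close> and the two gap conditions\<close>
  obtain C where C: "AE t in half_line. \<bar>b t\<bar> \<le> C" using assms(5) by (auto simp: Linfty_def)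
  define \<kappa> where "\<kappa> = max C 0"
  have bound: "AE t in lebesgue. t > \<tau> \<longrightarrow> norm (\<phi>'' t - the (A (\<phi> t))) \<le> k * norm (\<phi> t)"
    if "AE t in lebesgue. t > \<tau> \<longrightarrow> b t \<le> k" "\<tau> \<ge> 0" for \<tau> k
    using that(1) assms(6)[unfolded AE_half_line_iff]
  proof eventually_elim
    case (elim t)
    show ?case
    proof
      assume t: "t > \<tau>"
      then have "norm (\<phi>'' t - the (A (\<phi> t))) \<le> b t * norm (\<phi> t)" using elim(2) that(2) by simp
      also have "\<dots> \<le> k * norm (\<phi> t)" using elim(1) t by (intro mult_right_mono) auto
      finally show "norm (\<phi>'' t - the (A (\<phi> t))) \<le> k * norm (\<phi> t)" .
    qed
  qed
  have \<kappa>0: "\<kappa> \<ge> 0" by (simp add: \<kappa>_def)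
  have "AE t in lebesgue. t > 0 \<longrightarrow> b t \<le> \<kappa>"
    using C[unfolded AE_half_line_iff] by eventually_elim (auto simp: \<kappa>_def)
  from bound[OF this] have ineq: "AE t in lebesgue. t > 0 \<longrightarrow> norm (\<phi>'' t - the (A (\<phi> t))) \<le> \<kappa> * norm (\<phi> t)" by simp
  have zero: "AE t in lborel. t > 0 + 4 * r \<longrightarrow> v t = 0" if r: "r > 0" for r
    using assms(7)
  proof
    assume gaps: "large_positive_gaps (spectrum_op A)"
    show ?thesis
    proof (rule vanish_gap[OF order_refl r \<kappa>0 _ _ ineq])
      show "3 * \<kappa> + 1 > 0" using \<kappa>0 by simp
      then show "\<exists>m\<ge>\<Lambda>. complex_of_real ` {m - (3 * \<kappa> + 1)<..<m + (3 * \<kappa> + 1)} \<inter> spectrum_op A = {}" for \<Lambda>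
        by (rule large_positive_gaps_far_out[OF gaps])
      have "8 * \<kappa>\<^sup>2 \<le> (3 * \<kappa>)\<^sup>2" by (simp add: power_mult_distrib)
      also have "\<dots> \<le> (3 * \<kappa> + 1)\<^sup>2" using \<kappa>0 by (intro power_mono) auto
      finally show "8 * \<kappa>\<^sup>2 \<le> (3 * \<kappa> + 1)\<^sup>2" .
    qed
  next
    assume "(\<exists>\<delta>>0. infinitely_many_gaps \<delta> (spectrum_op A)) \<and> ess_tendsto_0_at_top b"
    then obtain \<delta> where \<delta>: "\<delta> > 0" "infinitely_many_gaps \<delta> (spectrum_op A)" and b0: "ess_tendsto_0_at_top b" by blast
    \<comment> \<open>The gaps provide d = \<delta>/6, and a third of it satisfies 8(d/3)^2 \<le>
      d^2.\<close>
    have "\<delta>/18 > 0" using \<delta> by simp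
    then obtain T0 where "AE t in half_line. t > T0 \<longrightarrow> \<bar>b t\<bar> < \<delta>/18"
      using b0 unfolding ess_tendsto_0_at_top_def by blast
    then have "AE t in lebesgue. t > max T0 0 \<longrightarrow> b t \<le> \<delta>/18"
      unfolding AE_half_line_iff by eventually_elim auto
    from bound[OF this] have "AE t in lebesgue. t > max T0 0 \<longrightarrow> norm (\<phi>'' t - the (A (\<phi> t))) \<le> \<delta>/18 * norm (\<phi> t)" by simp
    then have "AE t in lborel. t > max T0 0 + 4 * 1 \<longrightarrow> v t = 0"
    proof (rule vanish_gap[rotated 5])
      show "\<exists>m\<ge>\<Lambda>. complex_of_real ` {m - \<delta>/6<..<m + \<delta>/6} \<inter> spectrum_op A = {}" for \<Lambda>
        by (rule infinitely_many_gaps_far_out[OF \<delta>(2,1)])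
      show "8 * (\<delta>/18)\<^sup>2 \<le> (\<delta>/6)\<^sup>2" by (simp add: power_divide)
    qed (use \<delta> in auto)
    then show ?thesis by (rule vanish_continuation[OF r \<kappa>0 _ ineq])
  qed
  \<comment> \<open>Vanishing beyond 4r holds for every positive \<open>r\<close>; the values 1/(n +
    1) reduce this to countably many null sets.\<close>
  have "AE t in lborel. \<forall>n::nat. t > 0 + 4 * (1 / real (Suc n)) \<longrightarrow> v t = 0"
    unfolding AE_all_countable by (intro allI zero) simp
  then have "AE t in lebesgue. \<forall>n::nat. t > 0 + 4 * (1 / real (Suc n)) \<longrightarrow> v t = 0" by (rule AE_completion)
  then show ?thesis
    unfolding AE_half_line_iff using v(3)
  proof eventually_elim
    case (elim t)
    show ?case
    proof
      assume t: "t > 0"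
      obtain n :: nat where "4 / t < real n" using reals_Archimedean2 by blast
      then have "4 / t < real (Suc n)" by simp
      then have "t > 0 + 4 * (1 / real (Suc n))" using t by (simp add: field_simps)
      then have "v t = 0" using elim(1) by blast
      then show "\<phi> t = 0" using elim(2) t by simp
    qed
  qed
qed

end
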